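(* Let $p,p'\ge2$ be coprime integers and $k+2=\frac{p'}{p}$. There exists a non-trivial $\widehat{sl(2)}$-homomorphism (a homomorphism of vertex algebras) $$\overline\Phi:V_k(sl(2))\rightarrow L^{Vir}(d_{p,p'},0)\otimes\Pi(0)$$ determined by $$e\mapsto e^{c},\qquad h\mapsto 2\mu(-1)\mathbf 1,\qquad f\mapsto\left[(k+2)\omega_{p,p'}-\nu(-1)^2-(k+1)\nu(-2)\right]e^{-c}.$$ Moreover, $$\overline\Phi(\omega_{sug})=\omega_{p,p'}+\tfrac1k\mu(-1)^2\mathbf 1-\tfrac1k\nu(-1)^2\mathbf 1-\nu(-2)\mathbf 1=\omega_{p,p'}+\tfrac12c(-1)d(-1)\mathbf 1-\tfrac12d(-2)\mathbf 1+\tfrac k4c(-2)\mathbf 1 .$$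
   Context: $V_k(sl(2))$ is the simple affine vertex algebra of level $k$ (form normalized by $(h,h)=2$), $e,f,h$ the standard generators identified with $e(-1)\mathbf 1$, etc., and $\omega_{sug}$ its Sugawara Virasoro vector, of central charge $\frac{3k}{k+2}$. $d_{p,p'}=1-\frac{6(p-p')^2}{pp'}$; $L^{Vir}(d_{p,p'},0)$ is the simple Virasoro vertex algebra of that central charge, with conformal vector $\omega_{p,p'}$. Let $\langle c,c\rangle=\langle d,d\rangle=0$, $\langle c,d\rangle=2$, and let $M(1)$ be the Heisenberg vertex algebra generated by $c(z),d(z)$ with $[a(m),b(n)]=m\langle a,b\rangle\delta_{m+n,0}$. $\Pi(0)=M(1)\otimes\mathbb C[\mathbb Zc]$ is the lattice-type vertex algebra with the usual lattice vertex operators (trivial cocycle). Put $\mu=\frac d2+\frac k4c$, $\nu=\frac d2-\frac k4c$, so that $c=\frac2k(\mu-\nu)$, $d=\mu+\nu$, $\langle\mu,\mu\rangle=-\langle\nu,\nu\rangle=\frac k2$, $\langle\mu,\nu\rangle=0$. Tensor signs are suppressed. *)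

theory Defs
  imports Complex_Main "HOL-Library.Groups_Big_Fun"
begin

section \<open>Vertex algebras\<close>

text \<open>
  The underlying vector space is a whole type, whose addition is that of its class
  \<^class>\<open>ab_group_add\<close>; the remaining structure is a record.  The vector
  \<open>nprod V a n b\<close> is \<open>a\<^sub>(\<^sub>n\<^sub>)b\<close>, where
  \<open>Y(a,z) = \<Sum>\<^sub>n a\<^sub>(\<^sub>n\<^sub>) z\<^sup>-\<^sup>n\<^sup>-\<^sup>1\<close>.
\<close>

record 'v va =
  smul :: "complex \<Rightarrow> 'v \<Rightarrow> 'v"
  vac :: 'v
  nprod :: "'v \<Rightarrow> int \<Rightarrow> 'v \<Rightarrow> 'v"

text \<open>
  The Jacobi identity is stated in components (the Borcherds identity).  By truncation both sums
  have finite support, so that \<^const>\<open>Sum_any\<close> is the true sum.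
\<close>

locale vertex_algebra = vector_space "smul V"
  for V :: "'v::ab_group_add va" +
  assumes nprod_add_left: "nprod V (a + b) n c = nprod V a n c + nprod V b n c"
    and nprod_smul_left: "nprod V (smul V r a) n c = smul V r (nprod V a n c)"
    and nprod_add_right: "nprod V a n (b + c) = nprod V a n b + nprod V a n c"
    and nprod_smul_right: "nprod V a n (smul V r c) = smul V r (nprod V a n c)"
    and truncation: "\<exists>N. \<forall>n\<ge>N. nprod V a n b = 0"
    and vacuum: "nprod V (vac V) n b = (if n = - 1 then b else 0)"
    and creation: "n \<ge> 0 \<Longrightarrow> nprod V a n (vac V) = 0" "nprod V a (- 1) (vac V) = a"
    and borcherds:
      "Sum_any (\<lambda>j::nat. smul V (of_int m gchoose j)
          (nprod V (nprod V a (l + int j) b) (m + n - int j) c))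
     = Sum_any (\<lambda>j::nat. smul V ((- 1) ^ j * (of_int l gchoose j))
          (nprod V a (m + l - int j) (nprod V b (n + int j) c)
           - smul V ((- 1) powi l) (nprod V b (n + l - int j) (nprod V a (m + int j) c))))"

definition va_hom :: "'v::ab_group_add va \<Rightarrow> 'w::ab_group_add va \<Rightarrow> ('v \<Rightarrow> 'w) \<Rightarrow> bool" where
  "va_hom V W \<phi> \<longleftrightarrow>
     Vector_Spaces.linear (smul V) (smul W) \<phi> \<and>
     \<phi> (vac V) = vac W \<and>
     (\<forall>a n b. \<phi> (nprod V a n b) = nprod W (\<phi> a) n (\<phi> b))"

definition va_ideal :: "'v::ab_group_add va \<Rightarrow> 'v set \<Rightarrow> bool" where
  "va_ideal V I \<longleftrightarrow>
     module.subspace (smul V) I \<and>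
     (\<forall>a n. \<forall>v\<in>I. nprod V a n v \<in> I \<and> nprod V v n a \<in> I)"

definition simple_va :: "'v::ab_group_add va \<Rightarrow> bool" where
  "simple_va V \<longleftrightarrow>
     vertex_algebra V \<and> vac V \<noteq> 0 \<and> (\<forall>I. va_ideal V I \<longrightarrow> I = {0} \<or> I = UNIV)"

text \<open>\<open>W\<close>, with projection \<open>q\<close>, is the quotient of \<open>V\<close> by a maximal ideal.\<close>

definition simple_quotient :: "'v::ab_group_add va \<Rightarrow> 'w::ab_group_add va \<Rightarrow> ('v \<Rightarrow> 'w) \<Rightarrow> bool" where
  "simple_quotient V W q \<longleftrightarrow> vertex_algebra V \<and> simple_va W \<and> va_hom V W q \<and> surj q"

text \<open>The family \<open>b\<close> indexed by \<open>I\<close> is a basis of \<open>V\<close> (without repetitions).\<close>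

definition basis_family :: "'v::ab_group_add va \<Rightarrow> 'i set \<Rightarrow> ('i \<Rightarrow> 'v) \<Rightarrow> bool" where
  "basis_family V I b \<longleftrightarrow>
     inj_on b I \<and> \<not> module.dependent (smul V) (b ` I) \<and> module.span (smul V) (b ` I) = UNIV"

text \<open>
  The tensor product vertex algebra,
  \<open>Y(a \<otimes> b, z) = Y(a,z) \<otimes> Y(b,z)\<close>; the sum over \<open>j\<close> has finite support by truncation.
\<close>

definition tensor_product_va ::
  "'a::ab_group_add va \<Rightarrow> 'b::ab_group_add va \<Rightarrow> 't::ab_group_add va \<Rightarrow> ('a \<Rightarrow> 'b \<Rightarrow> 't) \<Rightarrow> bool"
where
  "tensor_product_va A B T t \<longleftrightarrow>
     vertex_algebra A \<and> vertex_algebra B \<and> vertex_algebra T \<and>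
     (\<forall>a. Vector_Spaces.linear (smul B) (smul T) (t a)) \<and>
     (\<forall>b. Vector_Spaces.linear (smul A) (smul T) (\<lambda>a. t a b)) \<and>
     (\<forall>X Y. basis_family A X id \<longrightarrow> basis_family B Y id \<longrightarrow>
        basis_family T (X \<times> Y) (\<lambda>(x, y). t x y)) \<and>
     vac T = t (vac A) (vac B) \<and>
     (\<forall>a b n a' b'. nprod T (t a b) n (t a' b') =
        Sum_any (\<lambda>j::int. t (nprod A a j a') (nprod B b (n - 1 - j) b')))"


section \<open>Affine and Virasoro vertex algebras\<close>

definition partitions :: "nat list set" where
  "partitions = {ns. sorted_wrt (\<ge>) ns \<and> 0 \<notin> set ns}"

text \<open>\<open>lower V a [n\<^sub>1,\<dots>,n\<^sub>r] v = a(-n\<^sub>1) \<dots> a(-n\<^sub>r) v\<close>, with \<open>a(n) = a\<^sub>(\<^sub>n\<^sub>)\<close>.\<close>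

definition lower :: "'v va \<Rightarrow> 'v \<Rightarrow> nat list \<Rightarrow> 'v \<Rightarrow> 'v" where
  "lower V a ns v = foldr (\<lambda>n. nprod V a (- int n)) ns v"

text \<open>
  The relations of the affine Lie algebra of \<open>sl(2)\<close> with central element acting as \<open>k\<close>, for the
  form with \<open>(h,h) = 2\<close> and \<open>(e,f) = 1\<close>.
\<close>

definition affine_sl2_relations :: "complex \<Rightarrow> 'v::ab_group_add va \<Rightarrow> 'v \<Rightarrow> 'v \<Rightarrow> 'v \<Rightarrow> bool" where
  "affine_sl2_relations k V e f h \<longleftrightarrow>
    (\<forall>m n v. let br = (\<lambda>x y. nprod V x m (nprod V y n v) - nprod V y n (nprod V x m v));
                 ct = (\<lambda>r. if m + n = 0 then smul V (of_int m * r * k) v else 0) in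
       br h e = smul V 2 (nprod V e (m + n) v) \<and>
       br h f = smul V (- 2) (nprod V f (m + n) v) \<and>
       br e f = nprod V h (m + n) v + ct 1 \<and>
       br h h = ct 2 \<and>
       br e e = 0 \<and>
       br f f = 0)"

text \<open>
  The vertex algebra \<open>V\<^sup>k(sl(2))\<close>.  The annihilation condition \<open>x(n)1 = 0\<close> for \<open>n \<ge> 0\<close> is part
  of the vertex algebra axioms; the Poincare-Birkhoff-Witt basis says that the module is induced
  from the one-dimensional module of \<open>sl(2)[t] \<oplus> CK\<close>.
\<close>

definition universal_affine_sl2 :: "complex \<Rightarrow> 'v::ab_group_add va \<Rightarrow> 'v \<Rightarrow> 'v \<Rightarrow> 'v \<Rightarrow> bool" where
  "universal_affine_sl2 k V e f h \<longleftrightarrow>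
     vertex_algebra V \<and> affine_sl2_relations k V e f h \<and>
     basis_family V (partitions \<times> partitions \<times> partitions)
       (\<lambda>(xs, ys, zs). lower V e xs (lower V h ys (lower V f zs (vac V))))"

text \<open>\<open>V\<close> (with generators \<open>e\<close>, \<open>f\<close>, \<open>h\<close>) is \<open>V\<^sub>k(sl(2))\<close>, presented as the simple quotient of
  \<open>U = V\<^sup>k(sl(2))\<close> by \<open>q\<close>; this is of interest for \<open>k \<noteq> -2\<close>.\<close>

definition simple_affine_sl2 ::
  "complex \<Rightarrow> 'u::ab_group_add va \<Rightarrow> ('u \<Rightarrow> 'v::ab_group_add) \<Rightarrow> 'v::ab_group_add va \<Rightarrow> 'v \<Rightarrow> 'v \<Rightarrow> 'v \<Rightarrow> bool"
where
  "simple_affine_sl2 k U q V e f h \<longleftrightarrow>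
     (\<exists>e' f' h'. universal_affine_sl2 k U e' f' h' \<and> e = q e' \<and> f = q f' \<and> h = q h') \<and>
     simple_quotient U V q"

text \<open>The dual bases are \<open>e, f, h\<close> and \<open>f, e, h/2\<close>.\<close>

definition sugawara :: "complex \<Rightarrow> 'v::ab_group_add va \<Rightarrow> 'v \<Rightarrow> 'v \<Rightarrow> 'v \<Rightarrow> 'v" where
  "sugawara k V e f h = smul V (1 / (2 * (k + 2)))
     (nprod V e (- 1) (nprod V f (- 1) (vac V)) + nprod V f (- 1) (nprod V e (- 1) (vac V))
      + smul V (1 / 2) (nprod V h (- 1) (nprod V h (- 1) (vac V))))"

text \<open>\<open>L(n) = \<omega>\<^sub>(\<^sub>n\<^sub>+\<^sub>1\<^sub>)\<close>\<close>

definition vir :: "'v va \<Rightarrow> 'v \<Rightarrow> int \<Rightarrow> 'v \<Rightarrow> 'v" where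
  "vir V \<omega> n = nprod V \<omega> (n + 1)"

text \<open>
  The universal Virasoro vertex algebra of central charge \<open>C\<close>, with basis
  \<open>L(-n\<^sub>1) \<dots> L(-n\<^sub>r)1\<close>, \<open>n\<^sub>1 \<ge> \<dots> \<ge> n\<^sub>r \<ge> 2\<close>.
\<close>

definition universal_virasoro :: "complex \<Rightarrow> 'v::ab_group_add va \<Rightarrow> 'v \<Rightarrow> bool" where
  "universal_virasoro C V \<omega> \<longleftrightarrow>
     vertex_algebra V \<and>
     (\<forall>m n v. vir V \<omega> m (vir V \<omega> n v) - vir V \<omega> n (vir V \<omega> m v) =
        smul V (of_int (m - n)) (vir V \<omega> (m + n) v) +
        (if m + n = 0 then smul V (of_int (m ^ 3 - m) / 12 * C) v else 0)) \<and>
     basis_family V {ns\<in>partitions. 1 \<notin> set ns}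
       (\<lambda>ns. foldr (\<lambda>n. vir V \<omega> (- int n)) ns (vac V))"

text \<open>\<open>L\<close> is \<open>L\<^sup>V\<^sup>i\<^sup>r(C,0)\<close> with conformal vector \<open>\<omega>\<close>, presented as a quotient of \<open>W\<close>.\<close>

definition simple_virasoro ::
  "complex \<Rightarrow> 'w::ab_group_add va \<Rightarrow> ('w \<Rightarrow> 'l) \<Rightarrow> 'l::ab_group_add va \<Rightarrow> 'l \<Rightarrow> bool"
where
  "simple_virasoro C W r L \<omega> \<longleftrightarrow>
     (\<exists>\<omega>'. universal_virasoro C W \<omega>' \<and> \<omega> = r \<omega>') \<and> simple_quotient W L r"

definition minimal_charge :: "nat \<Rightarrow> nat \<Rightarrow> complex" where
  "minimal_charge p p' = 1 - 6 * (of_nat p - of_nat p') ^ 2 / (of_nat p * of_nat p')"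


section \<open>The lattice type vertex algebra \<open>\<Pi>(0)\<close>\<close>

text \<open>
  Coefficient of \<open>z\<^sup>r\<close> in \<open>exp (\<Sum>\<^bsub>i\<ge>1\<^esub> X\<^sub>i z\<^sup>i)\<close>, applied to \<open>v\<close>:
  the sum over all compositions \<open>(i\<^sub>1,\<dots>,i\<^sub>l)\<close> of \<open>r\<close> of \<open>X\<^bsub>i\<^sub>1\<^esub> \<dots> X\<^bsub>i\<^sub>l\<^esub> v / l!\<close>.
\<close>

definition exp_coeff ::
  "(complex \<Rightarrow> 'v \<Rightarrow> 'v::ab_group_add) \<Rightarrow> (nat \<Rightarrow> 'v \<Rightarrow> 'v) \<Rightarrow> nat \<Rightarrow> 'v \<Rightarrow> 'v" where
  "exp_coeff s X r v =
     (\<Sum>is\<in>{is. 0 \<notin> set is \<and> sum_list is = r}. s (1 / fact (length is)) (foldr X is v))"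

text \<open>
  Coefficient of \<open>z\<^sup>-\<^sup>n\<^sup>-\<^sup>1\<close> in
  \<open>exp (\<Sum>\<^bsub>i\<ge>1\<^esub> \<alpha>(-i) z\<^sup>i / i) exp (- \<Sum>\<^bsub>i\<ge>1\<^esub> \<alpha>(i) z\<^sup>-\<^sup>i / i)\<close>, applied to \<open>v\<close>.
\<close>

definition lattice_vertex_coeff :: "'v::ab_group_add va \<Rightarrow> 'v \<Rightarrow> int \<Rightarrow> 'v \<Rightarrow> 'v" where
  "lattice_vertex_coeff P \<alpha> n v =
     Sum_any (\<lambda>s::nat. if int s - n - 1 < 0 then 0 else
       exp_coeff (smul P) (\<lambda>i w. smul P (1 / of_nat i) (nprod P \<alpha> (- int i) w)) (nat (int s - n - 1))
         (exp_coeff (smul P) (\<lambda>i w. smul P (- 1 / of_nat i) (nprod P \<alpha> (int i) w)) s v))"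

text \<open>
  \<open>P\<close> is \<open>\<Pi>(0) = M(1) \<otimes> C[Zc]\<close>, where \<open>ex m\<close> is \<open>e\<^sup>m\<^sup>c\<close> and \<open>c\<close>, \<open>d\<close> generate \<open>M(1)\<close>.
  The vector \<open>pi_monomial P c d ex (xs, ys, j)\<close> is \<open>c(-x\<^sub>1) \<dots> d(-y\<^sub>1) \<dots> 1 \<otimes> e\<^sup>j\<^sup>c\<close>.
\<close>

definition pi_monomial :: "'v va \<Rightarrow> 'v \<Rightarrow> 'v \<Rightarrow> (int \<Rightarrow> 'v) \<Rightarrow> nat list \<times> nat list \<times> int \<Rightarrow> 'v" where
  "pi_monomial P c d ex = (\<lambda>(xs, ys, j). lower P c xs (lower P d ys (ex j)))"

text \<open>
  The last condition is \<open>Y(e\<^sup>m\<^sup>c,z) = E\<^sup>-(-mc,z) E\<^sup>+(-mc,z) e\<^sub>m\<^sub>c z\<^bsup>mc(0)\<^esup>\<close>, evaluated on a basis: the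
  shift operator \<open>e\<^sub>m\<^sub>c\<close> replaces \<open>e\<^sup>j\<^sup>c\<close> by \<open>e\<^bsup>(j+m)c\<^esup>\<close> without a sign (trivial cocycle), and
  \<open>z\<^bsup>mc(0)\<^esup> = 1\<close> because \<open>\<langle>c,c\<rangle> = 0\<close>.
\<close>

definition lattice_Pi0 :: "'v::ab_group_add va \<Rightarrow> 'v \<Rightarrow> 'v \<Rightarrow> (int \<Rightarrow> 'v) \<Rightarrow> bool" where
  "lattice_Pi0 P c d ex \<longleftrightarrow>
     vertex_algebra P \<and>
     (\<forall>m n v. let br = (\<lambda>x y. nprod P x m (nprod P y n v) - nprod P y n (nprod P x m v)) in
        br c c = 0 \<and> br d d = 0 \<and>
        br c d = (if m + n = 0 then smul P (2 * of_int m) v else 0)) \<and>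
     ex 0 = vac P \<and>
     (\<forall>n\<ge>0. \<forall>j. nprod P c n (ex j) = 0 \<and>
        nprod P d n (ex j) = (if n = 0 then smul P (2 * of_int j) (ex j) else 0)) \<and>
     basis_family P (partitions \<times> partitions \<times> UNIV) (pi_monomial P c d ex) \<and>
     (\<forall>m n j. \<forall>xs\<in>partitions. \<forall>ys\<in>partitions.
        nprod P (ex m) n (pi_monomial P c d ex (xs, ys, j)) =
        lattice_vertex_coeff P (smul P (of_int m) c) n (pi_monomial P c d ex (xs, ys, j + m)))"

end

theory Submission
  imports Defs "HOL-Library.Product_Lexorder" "HOL-Library.Product_Plus"
begin

text \<open>
  A homomorphism \<open>\<phi>\<close> from the universal vertex algebra \<open>V\<^sup>k(sl(2))\<close> to \<open>L \<otimes> \<Pi>(0)\<close> exists as soon as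
  the images of \<open>e, f, h\<close> satisfy the affine relations.  To see that it kills the maximal ideal
  \<open>I\<close>, no singular vector is needed: suppose that \<open>N = \<phi>(I)\<close> contains some \<open>w \<noteq> 0\<close>.  Since
  \<open>e\<close> acts by \<open>e\<^sup>c(z)\<close> and \<open>T e\<^sup>c = c(-1) e\<^sup>c\<close>, suitable modes of \<open>e\<close> turn \<open>w\<close> into a nonzero vector
  killed by \<open>c(n)\<close>, \<open>n \<ge> 0\<close>.  On such vectors \<open>h(n) = d(n)\<close>, and the modes \<open>h(n)\<close> lead to some
  \<open>u \<otimes> e\<^bsup>jc\<^esup>\<close>.  There the leading mode of \<open>f\<close> acts as the leading \<open>L(n)\<close>, \<open>n \<ge> 1\<close>, on \<open>u\<close>, so \<open>u\<close> may
  be taken singular, that is, \<open>u = 1\<close> because \<open>L\<close> is simple.  Finally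
  \<open>f(1) e\<^bsup>jc\<^esup> = j (k + 1 - j) e\<^bsup>(j-1)c\<^esup>\<close> with \<open>k\<close> not an integer, so that \<open>1 \<in> N\<close>, which contradicts
  the grading of \<open>V\<^sup>k(sl(2))\<close> by conformal weights.

  The same argument gives the hardest relation \<open>f\<^sub>(\<^sub>n\<^sub>)f = 0\<close>: the last nonzero \<open>f\<^sub>(\<^sub>n\<^sub>)f\<close> is some
  \<open>u \<otimes> e\<^bsup>-2c\<^esup>\<close> with \<open>L(0)u = (3 - n)u\<close>, so that \<open>n \<le> 3\<close>; as \<open>n\<close> is odd by
  skew-symmetry, only \<open>n = 1\<close> and \<open>n = 3\<close> have to be computed.
\<close>

section \<open>Identities in vertex algebras\<close>

text \<open>The arithmetic of \<open>p, p'\<close> enters at two places. Coprimality with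
  \<open>p >= 2\<close> makes \<open>k\<close> non-integral, so that no factor
  \<open>k + 1 - j\<close> vanishes; the value of the central charge amounts to
  \<open>(k + 2) cc = (k + 2) - 6 (k + 1)^2\<close>, which is what makes \<open>f_(3) f\<close>
  vanish. For \<open>f_(1) f\<close> it is enough that \<open>L(0)\<close> kills it: the terms
  containing \<open>\<omega>\<close> cancel, while a nonzero vector would have
  \<open>L(0)\<close>-weight 2.

  Two gradings must be kept apart. On the free-field side \<open>\<omega> + c(-1)d/2\<close> gives
  every \<open>e^(jc)\<close> weight 0, hence \<open>f\<close> weight 2; this bounds the order of
  the pole of \<open>f\<close> with itself. On \<open>V^k(sl(2))\<close> the Sugawara vector gives
  \<open>e, f, h\<close> weight 1. There \<open>1 = \<phi>(v)\<close> with \<open>v\<close> in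
  \<open>I\<close> means that \<open>v - 1\<close> lies in the kernel of \<open>\<phi>\<close>; both
  ideals are proper and graded, and the part of weight 0 is spanned by \<open>1\<close>, so this is
  impossible.

  The passages to vectors killed by positive modes terminate by local nilpotency
  (\<open>nilp\<close>), which needs no bases of the tensor product.\<close>

context vector_space
begin

text \<open>Applying \<open>A - s0\<close> kills the component with eigenvalue \<open>s0\<close> and
  multiplies every other \<open>v s\<close> by the nonzero scalar \<open>s - s0\<close>; induction
  on \<open>S\<close> then isolates the components inside \<open>N\<close>.\<close>

lemma eigen_component:
  assumes "finite S" and N: "subspace N"
    and add: "\<And>x y. A (x + y) = A x + A y" and scl: "\<And>r x. A (scale r x) = scale r (A x)"
    and AN: "\<And>x. x \<in> N \<Longrightarrow> A x \<in> N"
    and eig: "\<And>s. s \<in> S \<Longrightarrow> A (v s) = scale s (v s)"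
    and sum: "(\<Sum>s\<in>S. v s) \<in> N" and s: "s \<in> S"
  shows "v s \<in> N"
  using \<open>finite S\<close> eig sum s
proof (induction S arbitrary: v s rule: finite_induct)
  case empty
  then show ?case by simp
next
  case (insert s0 S)
  have A0: "A 0 = 0" using scl[of 0 0] by simp
  have Asum: "A (sum f F) = (\<Sum>i\<in>F. A (f i))" if "finite F" for f F
    using that by (induction F rule: finite_induct) (simp_all add: A0 add)
  define w where "w = v s0 + (\<Sum>s\<in>S. v s)"
  have w: "w \<in> N" using insert.prems(2) insert.hyps by (simp add: w_def)
  have "A w - scale s0 w = (\<Sum>s\<in>S. scale (s - s0) (v s))"
    using insert.hyps insert.prems(1)
    by (simp add: w_def add Asum scale_right_distrib scale_sum_right scale_left_diff_distrib
        sum_subtractf)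
  moreover have "A w - scale s0 w \<in> N"
    using w N AN by (simp add: subspace_diff subspace_scale)
  ultimately have "(\<Sum>s\<in>S. scale (s - s0) (v s)) \<in> N" by simp
  then have *: "scale (s - s0) (v s) \<in> N" if "s \<in> S" for s
    by (rule insert.IH[rotated]) (use that insert.prems(1) scl in \<open>auto simp: scale_left_commute\<close>)
  have S: "v s \<in> N" if "s \<in> S" for s
  proof -
    have "s \<noteq> s0" using that insert.hyps by auto
    then have "v s = scale (1 / (s - s0)) (scale (s - s0) (v s))" by simp
    then show ?thesis using *[OF that] N subspace_scale by metis
  qed
  have "v s0 = w - (\<Sum>s\<in>S. v s)" by (simp add: w_def)
  then have "v s0 \<in> N" using w S N by (simp add: subspace_diff subspace_sum)
  then show ?case using S insert.prems(3) by auto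
qed

lemma eigen_decomposition:
  assumes "x \<in> span B" and add: "\<And>x y. A (x + y) = A x + A y"
    and scl: "\<And>r x. A (scale r x) = scale r (A x)"
    and B: "\<And>b. b \<in> B \<Longrightarrow> A b = scale (E b) b"
  obtains S v where "finite S" "S \<subseteq> E ` B" "x = (\<Sum>s\<in>S. v s)"
    "\<And>s. s \<in> S \<Longrightarrow> A (v s) = scale s (v s)"
    "\<And>s. s \<in> S \<Longrightarrow> v s \<in> span {b \<in> B. E b = s}"
proof -
  obtain t r where t: "finite t" "t \<subseteq> B" and x: "x = (\<Sum>a\<in>t. scale (r a) a)"
    using assms(1) unfolding span_explicit by auto
  have A0: "A 0 = 0" using scl[of 0 0] by simp
  have Asum: "A (sum f F) = (\<Sum>i\<in>F. A (f i))" if "finite F" for f F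
    using that by (induction F rule: finite_induct) (simp_all add: A0 add)
  define v where "v s = (\<Sum>a | a \<in> t \<and> E a = s. scale (r a) a)" for s
  show ?thesis
  proof (rule that[of "E ` t" v])
    show "x = (\<Sum>s\<in>E ` t. v s)" unfolding v_def x using t(1) sum.image_gen[of t] by blast
    show "A (v s) = scale s (v s)" for s
      unfolding v_def using t
      by (auto simp: Asum scl B scale_sum_right scale_left_commute intro!: sum.cong)
    show "v s \<in> span {b \<in> B. E b = s}" for s
      unfolding v_def by (rule span_sum, rule span_scale, rule span_base) (use t in auto)
  qed (use t in auto)
qed

lemma linear_image_span:
  assumes "\<And>x y. A (x + y) = A x + A y" and "\<And>r x. A (scale r x) = scale r (A x)"
    and "\<And>b. b \<in> B \<Longrightarrow> A b \<in> N" and "subspace N" and "x \<in> span B"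
  shows "A x \<in> N"
  using assms(5)
proof (induction rule: span_induct_alt)
  case base
  have "A 0 = 0" using assms(2)[of 0 0] by simp
  then show ?case using assms(4) by (simp add: subspace_0)
next
  case (step c x y)
  then show ?case using assms by (simp add: subspace_add subspace_scale)
qed

end


lemma gbinomial_minus_one: "(- 1 :: complex) gchoose j = (- 1) ^ j"
  using gbinomial_minus[of "1::complex" j] by (simp add: binomial_gbinomial[symmetric])

lemma gbinomial_minus_two: "(- 2 :: complex) gchoose j = (- 1) ^ j * (of_nat j + 1)"
proof -
  have "(of_nat (Suc j) :: complex) gchoose j = of_nat (Suc j)"
    by (simp only: binomial_gbinomial[symmetric] binomial_Suc_n)
  then show ?thesis using gbinomial_minus[of "2::complex" j] by (simp add: add.commute)
qed

lemma Sum_any_lessThan: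
  assumes "\<And>j. j \<ge> N \<Longrightarrow> g j = (0 :: 'a::comm_monoid_add)"
  shows "Sum_any g = (\<Sum>j::nat<N. g j)"
  by (rule Sum_any.expand_superset) (use assms in \<open>auto simp: not_le[symmetric]\<close>)

lemma Sum_any_single:
  assumes "\<And>j. j \<noteq> i \<Longrightarrow> g j = (0 :: 'a::comm_monoid_add)"
  shows "Sum_any g = g i"
proof -
  have "Sum_any g = sum g {i}"
    by (rule Sum_any.expand_superset) (use assms in auto)
  then show ?thesis by simp
qed

section \<open>Special cases of the Borcherds identity: commutators, iterates, translation,
  skew-symmetry, weights\<close>

context vertex_algebra
begin

abbreviation Y where "Y \<equiv> nprod V"
abbreviation scl (infixr "\<cdot>" 75) where "r \<cdot> x \<equiv> smul V r x"
abbreviation vc where "vc \<equiv> vac V"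
abbreviation tr where "tr x \<equiv> Y x (- 2) vc"

lemma nprod_zero_left [simp]: "Y 0 n c = 0"
  using nprod_smul_left[of 0 0 n c] by simp

lemma nprod_zero_right [simp]: "Y a n 0 = 0"
  using nprod_smul_right[of a n 0 0] by simp

lemma nprod_minus_left: "Y (- a) n c = - Y a n c"
  using nprod_smul_left[of "- 1" a n c] by simp

lemma nprod_minus_right: "Y a n (- c) = - Y a n c"
  using nprod_smul_right[of a n "- 1" c] by simp

lemma nprod_diff_left: "Y (a - b) n c = Y a n c - Y b n c"
  using nprod_add_left[of a "- b" n c] by (simp add: nprod_minus_left)

lemma nprod_diff_right: "Y a n (b - c) = Y a n b - Y a n c"
  using nprod_add_right[of a n b "- c"] by (simp add: nprod_minus_right)

lemma nprod_sum_right: "Y a n (sum f S) = (\<Sum>i\<in>S. Y a n (f i))"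
  by (induction S rule: infinite_finite_induct) (simp_all add: nprod_add_right)

lemmas bilin = nprod_add_left nprod_smul_left nprod_add_right nprod_smul_right
  nprod_minus_left nprod_minus_right nprod_diff_left nprod_diff_right

lemma truncation2: obtains N :: nat where "\<And>j. j \<ge> N \<Longrightarrow> Y a (n + int j) b = 0"
proof -
  obtain M where M: "\<And>i. i \<ge> M \<Longrightarrow> Y a i b = 0" using truncation by blast
  show ?thesis by (rule that[of "nat (M - n)"]) (rule M, linarith)
qed

lemma truncation1: obtains N :: nat where "\<And>j. j \<ge> N \<Longrightarrow> Y a (int j) b = 0"
  using truncation2[of a 0 b] by auto

text \<open>The Borcherds identity at \<open>l = 0\<close>, where its right-hand side reduces to the
  term \<open>j = 0\<close>.\<close>

lemma commutator:
  assumes "\<And>j. j \<ge> N \<Longrightarrow> Y a (int j) b = 0"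
  shows "Y a m (Y b n c) - Y b n (Y a m c) =
    (\<Sum>j<N. (of_int m gchoose j) \<cdot> Y (Y a (int j) b) (m + n - int j) c)"
proof -
  have "Sum_any (\<lambda>j::nat. (of_int m gchoose j) \<cdot> Y (Y a (0 + int j) b) (m + n - int j) c) =
     (\<Sum>j<N. (of_int m gchoose j) \<cdot> Y (Y a (int j) b) (m + n - int j) c)"
    by (subst Sum_any_lessThan[of N]) (use assms in auto)
  moreover have "Sum_any (\<lambda>j::nat. ((- 1) ^ j * (of_int 0 gchoose j)) \<cdot>
          (Y a (m + 0 - int j) (Y b (n + int j) c)
           - ((- 1) powi 0) \<cdot> (Y b (n + 0 - int j) (Y a (m + int j) c))))
     = Y a m (Y b n c) - Y b n (Y a m c)"
    by (subst Sum_any_single[of 0]) (auto simp: gbinomial_0 gr0_conv_Suc)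
  ultimately show ?thesis using borcherds[of m a 0 b n c] by simp
qed

text \<open>For a nonnegative mode the binomials \<open>M choose j\<close> end the sum by
  themselves, so that no truncation bound appears.\<close>

lemma commutator_nat:
  "Y a (int M) (Y b n c) - Y b n (Y a (int M) c) =
    (\<Sum>j\<le>M. of_nat (M choose j) \<cdot> Y (Y a (int j) b) (int M + n - int j) c)"
proof -
  obtain N where N: "\<And>j. j \<ge> N \<Longrightarrow> Y a (int j) b = 0" by (rule truncation1[of a b]) blast
  have "Y a (int M) (Y b n c) - Y b n (Y a (int M) c) =
    (\<Sum>j<N + Suc M. of_nat (M choose j) \<cdot> Y (Y a (int j) b) (int M + n - int j) c)"
    using commutator[of "N + Suc M" a b "int M" n c] by (simp add: N binomial_gbinomial)
  also have "\<dots> = (\<Sum>j\<le>M. of_nat (M choose j) \<cdot> Y (Y a (int j) b) (int M + n - int j) c)"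
    by (rule sum.mono_neutral_right) auto
  finally show ?thesis .
qed

text \<open>The Borcherds identity at \<open>m = 0\<close>, where its left-hand side reduces to the
  term \<open>j = 0\<close>.\<close>

lemma iterate:
  assumes "\<And>j. j \<ge> N \<Longrightarrow> Y b (n + int j) c = 0" "\<And>j. j \<ge> N \<Longrightarrow> Y a (int j) c = 0"
  shows "Y (Y a l b) n c = (\<Sum>j<N. ((- 1) ^ j * (of_int l gchoose j)) \<cdot>
     (Y a (l - int j) (Y b (n + int j) c) - ((- 1) powi l) \<cdot> Y b (n + l - int j) (Y a (int j) c)))"
proof -
  have "Sum_any (\<lambda>j::nat. (of_int 0 gchoose j) \<cdot> Y (Y a (l + int j) b) (0 + n - int j) c) =
     Y (Y a l b) n c"
    by (subst Sum_any_single[of 0]) (auto simp: gbinomial_0 gr0_conv_Suc)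
  moreover have "Sum_any (\<lambda>j::nat. ((- 1) ^ j * (of_int l gchoose j)) \<cdot>
          (Y a (0 + l - int j) (Y b (n + int j) c)
           - ((- 1) powi l) \<cdot> (Y b (n + l - int j) (Y a (0 + int j) c))))
     = (\<Sum>j<N. ((- 1) ^ j * (of_int l gchoose j)) \<cdot>
     (Y a (l - int j) (Y b (n + int j) c) - ((- 1) powi l) \<cdot> Y b (n + l - int j) (Y a (int j) c)))"
    by (subst Sum_any_lessThan[of N]) (use assms in auto)
  ultimately show ?thesis using borcherds[of 0 a l b n c] by simp
qed

lemma iterate_m1:
  assumes "\<And>j. j \<ge> N \<Longrightarrow> Y b (n + int j) c = 0" "\<And>j. j \<ge> N \<Longrightarrow> Y a (int j) c = 0"
  shows "Y (Y a (- 1) b) n c =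
    (\<Sum>j<N. Y a (- 1 - int j) (Y b (n + int j) c) + Y b (n - 1 - int j) (Y a (int j) c))"
  by (subst iterate[OF assms])
     (simp_all add: gbinomial_minus_one)

lemma iterate_m2:
  assumes "\<And>j. j \<ge> N \<Longrightarrow> Y b (n + int j) c = 0" "\<And>j. j \<ge> N \<Longrightarrow> Y a (int j) c = 0"
  shows "Y (Y a (- 2) b) n c =
    (\<Sum>j<N. (of_nat j + 1) \<cdot>
       (Y a (- 2 - int j) (Y b (n + int j) c) - Y b (n - 2 - int j) (Y a (int j) c)))"
  by (subst iterate[OF assms]) (simp_all add: gbinomial_minus_two)

lemma nprod_mem:
  assumes N: "subspace N" and "\<And>n c. c \<in> N \<Longrightarrow> Y a n c \<in> N" "\<And>n c. c \<in> N \<Longrightarrow> Y b n c \<in> N" "c \<in> N"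
  shows "Y (Y a l b) n c \<in> N"
proof -
  obtain N1 where N1: "\<And>j. j \<ge> N1 \<Longrightarrow> Y b (n + int j) c = 0" by (rule truncation2[of b n c]) blast
  obtain N2 where N2: "\<And>j. j \<ge> N2 \<Longrightarrow> Y a (int j) c = 0" by (rule truncation1[of a c]) blast
  have "Y (Y a l b) n c = (\<Sum>j<max N1 N2. ((- 1) ^ j * (of_int l gchoose j)) \<cdot>
     (Y a (l - int j) (Y b (n + int j) c) - ((- 1) powi l) \<cdot> Y b (n + l - int j) (Y a (int j) c)))"
    by (rule iterate) (simp_all add: N1 N2)
  also have "\<dots> \<in> N"
    by (intro subspace_sum subspace_scale subspace_diff N assms)
  finally show ?thesis .
qed

lemma tr_nprod_left: "Y (tr a) n c = - of_int n \<cdot> Y a (n - 1) c"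
proof -
  obtain N2 where N2: "\<And>j. j \<ge> N2 \<Longrightarrow> Y a (int j) c = 0" by (rule truncation1[of a c]) blast
  define N where "N = max N2 (nat (\<bar>n\<bar> + 2))"
  have N: "N \<ge> N2" "int N \<ge> \<bar>n\<bar> + 2" unfolding N_def by auto
  have "Y (tr a) n c = (\<Sum>j<N. (of_nat j + 1) \<cdot>
       (Y a (- 2 - int j) (Y vc (n + int j) c) - Y vc (n - 2 - int j) (Y a (int j) c)))"
    by (rule iterate_m2) (use N N2 in \<open>auto simp: vacuum\<close>)
  \<comment> \<open>The only nonzero vacuum mode has index -1. This forces \<open>n + j = -1\<close>
    for negative \<open>n\<close> and \<open>n - 2 - j = -1\<close> for positive \<open>n\<close>,
    that is, \<open>j = |n| - 1\<close> in both cases; for \<open>n = 0\<close> there is no such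
    \<open>j\<close>.\<close>
  also have "\<dots> = (\<Sum>j<N. if int j = \<bar>n\<bar> - 1 then - of_int n \<cdot> Y a (n - 1) c else 0)"
  proof (rule sum.cong[OF refl])
    fix j
    show "(of_nat j + 1) \<cdot>
       (Y a (- 2 - int j) (Y vc (n + int j) c) - Y vc (n - 2 - int j) (Y a (int j) c)) =
       (if int j = \<bar>n\<bar> - 1 then - of_int n \<cdot> Y a (n - 1) c else 0)"
    proof (cases "int j = \<bar>n\<bar> - 1")
      case True
      have cj: "(of_nat j :: complex) = of_int (\<bar>n\<bar> - 1)"
        unfolding True[symmetric] by simp
      show ?thesis
      proof (cases "n \<le> - 1")
        case n: True
        then have "n + int j = - 1" "n - 2 - int j \<noteq> - 1" "- 2 - int j = n - 1" using True by auto
        then show ?thesis using n by (simp add: vacuum cj True)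
      next
        case n: False
        then have "n + int j \<noteq> - 1" "n - 2 - int j = - 1" "int j = n - 1" using True by auto
        then show ?thesis using n by (simp add: vacuum cj)
      qed
    next
      case False
      then have "n - 2 - int j \<noteq> - 1" "n + int j \<noteq> - 1" by arith+
      then show ?thesis using False by (simp add: vacuum)
    qed
  qed
  also have "\<dots> = - of_int n \<cdot> Y a (n - 1) c"
  proof (cases "n = 0")
    case False
    then have "(if int j = \<bar>n\<bar> - 1 then - of_int n \<cdot> Y a (n - 1) c else 0) =
      (if j = nat (\<bar>n\<bar> - 1) then - of_int n \<cdot> Y a (n - 1) c else 0)" for j by auto
    moreover have "nat (\<bar>n\<bar> - 1) < N" using N by linarith
    ultimately show ?thesis by simp
  qed simp
  finally show ?thesis .
qed

text \<open>The translation operator \<open>T\<close> is a derivation: on the vacuum the iterate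
  formula keeps only \<open>j = 0\<close>, which gives \<open>a_(n) Tb\<close>, and
  \<open>j = 1\<close>, which gives \<open>-n a_(n-1) b = (Ta)_(n) b\<close>.\<close>

lemma tr_nprod: "tr (Y a n b) = Y (tr a) n b + Y a n (tr b)"
proof -
  obtain N1 where N1: "\<And>j. j \<ge> N1 \<Longrightarrow> Y b (- 2 + int j) vc = 0"
    by (rule truncation2[of b "- 2" vc]) blast
  have "tr (Y a n b) = (\<Sum>j<max N1 2. ((- 1) ^ j * (of_int n gchoose j)) \<cdot>
     (Y a (n - int j) (Y b (- 2 + int j) vc) - ((- 1) powi n) \<cdot> Y b (- 2 + n - int j) (Y a (int j) vc)))"
    by (rule iterate) (use N1 in \<open>auto simp: creation\<close>)
  also have "\<dots> = (\<Sum>j\<in>{0,1}. ((- 1) ^ j * (of_int n gchoose j)) \<cdot>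
     (Y a (n - int j) (Y b (- 2 + int j) vc) - ((- 1) powi n) \<cdot> Y b (- 2 + n - int j) (Y a (int j) vc)))"
    by (rule sum.mono_neutral_right) (auto simp: creation)
  also have "\<dots> = Y (tr a) n b + Y a n (tr b)"
    by (simp add: creation tr_nprod_left)
  finally show ?thesis .
qed

text \<open>Skew-symmetry without the exponential of \<open>T\<close>: the commutator formula at
  \<open>m = -1\<close>, evaluated on the vacuum, where \<open>a_(-1) 1 = a\<close>.\<close>

lemma skew:
  assumes "\<And>j. j \<ge> N \<Longrightarrow> Y a (int j) b = 0"
  shows "Y b n a = Y a (- 1) (Y b n vc) - (\<Sum>j<N. ((- 1) ^ j) \<cdot> Y (Y a (int j) b) (n - 1 - int j) vc)"
  using commutator[OF assms, where m = "- 1" and n = n and c = vc]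
  by (simp add: creation gbinomial_minus_one algebra_simps)

text \<open>Iterated, this expresses every \<open>x_(n) 1\<close> through powers of
  \<open>T\<close>, so that a \<open>T\<close>-stable subspace containing \<open>x\<close> contains
  them all.\<close>

lemma nprod_neg_vac: "Y x (- 1 - int (Suc i)) vc = (1 / of_nat (Suc i)) \<cdot> Y (tr x) (- 1 - int i) vc"
proof -
  have "(of_nat (Suc i) :: complex) \<noteq> 0" by (simp only: of_nat_eq_0_iff)
  then show ?thesis by (simp add: tr_nprod_left add.commute)
qed

text \<open>The part of "weight \<open>h\<close> for a conformal vector \<open>w\<close>" that the
  arguments use: \<open>L(-1)\<close> acts on \<open>a\<close> as \<open>T\<close> and
  \<open>L(0)\<close> as \<open>h\<close>. No Virasoro relations are asked of \<open>w\<close>, so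
  that they need not be derived for the Sugawara vector or for sums of conformal vectors.\<close>

definition conf :: "'v \<Rightarrow> complex \<Rightarrow> 'v \<Rightarrow> bool" where
  "conf w h a \<longleftrightarrow> Y w 0 a = tr a \<and> Y w 1 a = h \<cdot> a"

lemma conf_mode:
  assumes "conf w h a"
  shows "Y w 1 (Y a n c) = Y a n (Y w 1 c) + (h - of_int n - 1) \<cdot> Y a n c"
  using commutator_nat[of w 1 a n c] assms
  by (simp add: conf_def nprod_smul_left tr_nprod_left algebra_simps)

lemma conf_mode0:
  assumes "conf w h a"
  shows "Y w 0 (Y a n c) = Y a n (Y w 0 c) + Y (tr a) n c"
  using commutator_nat[of w 0 a n c] assms
  by (simp add: conf_def algebra_simps)

lemma conf_nprod:
  assumes "conf w h a" "conf w h' b"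
  shows "conf w (h + h' - of_int n - 1) (Y a n b)"
  using assms unfolding conf_def
  by (simp add: conf_mode0[OF assms(1)] conf_mode[OF assms(1)] tr_nprod bilin algebra_simps)

lemma conf_add: "conf w h a \<Longrightarrow> conf w h b \<Longrightarrow> conf w h (a + b)"
  by (simp add: conf_def bilin scale_right_distrib)

lemma conf_diff: "conf w h a \<Longrightarrow> conf w h b \<Longrightarrow> conf w h (a - b)"
  by (simp add: conf_def bilin scale_right_diff_distrib)

lemma conf_smul: "conf w h a \<Longrightarrow> conf w h (r \<cdot> a)"
  by (simp add: conf_def bilin mult.commute)

lemma conf_vac: "conf w 0 vc"
  by (simp add: conf_def creation vacuum)

end

section \<open>Homomorphisms out of the universal affine vertex algebra\<close>

definition word :: "('g \<Rightarrow> int \<Rightarrow> 'v \<Rightarrow> 'v) \<Rightarrow> ('g \<times> int) list \<Rightarrow> 'v \<Rightarrow> 'v" where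
  "word M ws v = foldr (\<lambda>(g, n). M g n) ws v"

lemma word_simps [simp]:
  "word M [] v = v" "word M ((g, n) # ws) v = M g n (word M ws v)"
  by (simp_all add: word_def)

lemma word_append: "word M (us @ ws) v = word M us (word M ws v)"
  by (simp add: word_def)

section \<open>Straightening of words in operators, as in the Poincare-Birkhoff-Witt theorem\<close>

context vector_space
begin

context
  fixes M :: "'g \<Rightarrow> int \<Rightarrow> 'b \<Rightarrow> 'b" and v0 :: 'b and key :: "'g \<times> int \<Rightarrow> 'k::linorder"
  assumes M_add: "\<And>g n x y. M g n (x + y) = M g n x + M g n y"
    and M_scale: "\<And>g n r x. M g n (scale r x) = scale r (M g n x)"
    and M_comm: "\<And>g m g' n x. M g m (M g' n x) - M g' n (M g m x) \<in>
        span (insert x {M g'' i x | g'' i. True})"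
    and M_ann: "\<And>g n. n \<ge> 0 \<Longrightarrow> M g n v0 = 0"
    and key: "\<And>g m g' n. key (g, m) \<le> key (g', n) \<Longrightarrow> m \<ge> 0 \<Longrightarrow> n \<ge> 0"
begin

private abbreviation W where "W r \<equiv> span {word M ws v0 | ws. length ws < r}"

private lemma M_diff: "M g n (x - y) = M g n x - M g n y"
  using M_add[of g n x "scale (- 1) y"] M_scale[of g n "- 1" y] by simp

private lemma M_zero: "M g n 0 = 0"
  using M_scale[of g n 0 0] by simp

private lemma W_mono: "r \<le> s \<Longrightarrow> x \<in> W r \<Longrightarrow> x \<in> W s"
  by (erule rev_subsetD[OF _ span_mono]) auto

private lemma M_W: "x \<in> W r \<Longrightarrow> M g n x \<in> W (Suc r)"
proof (rule linear_image_span[where A = "M g n" and B = "{word M ws v0 | ws. length ws < r}"])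
  fix b assume "b \<in> {word M ws v0 | ws. length ws < r}"
  then obtain ws where "b = word M ws v0" "length ws < r" by auto
  then show "M g n b \<in> W (Suc r)"
    by (intro span_base) (auto intro!: exI[of _ "(g, n) # ws"])
qed (auto simp: M_add M_scale)

private lemma swap_W:
  "word M (x # y # ws) v0 - word M (y # x # ws) v0 \<in> W (length ws + 2)"
proof -
  obtain g m where x: "x = (g, m)" by (cases x)
  obtain g' n where y: "y = (g', n)" by (cases y)
  have "word M (x # y # ws) v0 - word M (y # x # ws) v0 \<in>
      span (insert (word M ws v0) {M g'' i (word M ws v0) | g'' i. True})"
    unfolding x y word_simps by (rule M_comm)
  also have "\<dots> \<subseteq> W (length ws + 2)"
  proof (rule span_mono, safe)
    show "\<exists>us. word M ws v0 = word M us v0 \<and> length us < length ws + 2"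
      by (rule exI[of _ ws]) simp
    show "\<exists>us. M g'' i (word M ws v0) = word M us v0 \<and> length us < length ws + 2" for g'' i
      by (rule exI[of _ "(g'', i) # ws"]) simp
  qed
  finally show ?thesis .
qed

text \<open>An exchange of neighbours costs a commutator, that is, words with fewer letters;
  insertion is a chain of such exchanges.\<close>

private lemma insort_W:
  "word M (x # ws) v0 - word M (insort_key key x ws) v0 \<in> W (length ws + 1)"
proof (induction ws)
  case Nil
  then show ?case by (simp add: span_zero)
next
  case (Cons y ws)
  obtain g n where y: "y = (g, n)" by (cases y)
  show ?case
  proof (cases "key x \<le> key y")
    case True
    then show ?thesis by (simp add: span_zero)
  next
    case False
    have "M g n (word M (x # ws) v0 - word M (insort_key key x ws) v0) \<in> W (length ws + 2)"
      using M_W[OF Cons.IH] by simp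
    then have "word M (y # x # ws) v0 - word M (y # insort_key key x ws) v0 \<in> W (length ws + 2)"
      by (simp add: y M_diff)
    from span_add[OF swap_W[of x y ws] this] False show ?thesis by simp
  qed
qed

private lemma sort_W: "word M ws v0 - word M (sort_key key ws) v0 \<in> W (length ws)"
proof (induction ws)
  case Nil
  then show ?case by (simp add: span_zero)
next
  case (Cons x ws)
  obtain g n where x: "x = (g, n)" by (cases x)
  have "M g n (word M ws v0 - word M (sort_key key ws) v0) \<in> W (Suc (length ws))"
    using M_W[OF Cons.IH] .
  then have "word M (x # ws) v0 - word M (x # sort_key key ws) v0 \<in> W (Suc (length ws))"
    by (simp add: x M_diff)
  from span_add[OF this insort_W[of x "sort_key key ws", simplified]] show ?case
    by simp
qed

text \<open>Sorting changes a word by shorter ones, so induction on the length applies. In a sorted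
  word the annihilating letters stand at the right end; if there is one, the last letter kills
  \<open>v0\<close> and the word vanishes.\<close>

lemma word_in_span_sorted:
  "word M ws v0 \<in> span {word M us v0 | us. sorted (map key us) \<and> (\<forall>u\<in>set us. snd u < 0)}"
    (is "_ \<in> span ?B")
proof -
  have "W r \<subseteq> span ?B" for r
  proof (induction r)
    case 0
    then show ?case by (simp add: span_zero)
  next
    case (Suc r)
    show ?case
    proof (rule span_minimal)
      show "{word M ws v0 |ws. length ws < Suc r} \<subseteq> span ?B"
      proof safe
        fix ws :: "('g \<times> int) list" assume "length ws < Suc r"
        then have "word M ws v0 - word M (sort_key key ws) v0 \<in> span ?B"
          using sort_W[of ws] W_mono[of "length ws" r] Suc.IH by auto
        moreover have "word M (sort_key key ws) v0 \<in> span ?B"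
        proof (cases "\<forall>u\<in>set ws. snd u < 0")
          case True
          then show ?thesis by (intro span_base) (auto intro!: exI[of _ "sort_key key ws"])
        next
          case False
          let ?us = "sort_key key ws"
          from False obtain u where u: "u \<in> set ?us" "snd u \<ge> 0" by force
          then have ne: "?us \<noteq> []" by (metis empty_iff list.set(1))
          then obtain zs l where zs: "?us = zs @ [l]" by (metis append_butlast_last_id)
          have "key u \<le> key l"
            using sorted_sort_key[of key ws] u unfolding zs by (auto simp: sorted_append)
          then have "snd l \<ge> 0"
            using u key[of "fst u" "snd u" "fst l" "snd l"] by simp
          then have "word M [l] v0 = 0" by (cases l) (simp add: M_ann)
          moreover have "word M zs 0 = 0" by (induction zs) (auto simp: M_zero)
          ultimately have "word M ?us v0 = 0" unfolding zs word_append by simp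
          then show ?thesis by (simp add: span_zero)
        qed
        ultimately show "word M ws v0 \<in> span ?B"
          using span_add[of "word M ws v0 - word M (sort_key key ws) v0" ?B
              "word M (sort_key key ws) v0"] by simp
      qed
    qed auto
  qed
  moreover have "word M ws v0 \<in> W (Suc (length ws))" by (rule span_base) auto
  ultimately show ?thesis by blast
qed

end

end

datatype sl2_letter = Le | Lh | Lf

fun letter_rank :: "sl2_letter \<Rightarrow> nat" where
  "letter_rank Le = 0" | "letter_rank Lh = 1" | "letter_rank Lf = 2"

text \<open>Annihilating modes come last, so that a sorted word either is negative or vanishes on the vacuum.\<close>

definition letter_key :: "sl2_letter \<times> int \<Rightarrow> nat \<times> nat \<times> int" where
  "letter_key u = ((if snd u \<ge> 0 then 1 else 0), letter_rank (fst u), snd u)"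

definition ordered_word :: "nat list \<Rightarrow> nat list \<Rightarrow> nat list \<Rightarrow> (sl2_letter \<times> int) list" where
  "ordered_word xs ys zs = map (\<lambda>n. (Le, - int n)) xs @ map (\<lambda>n. (Lh, - int n)) ys
     @ map (\<lambda>n. (Lf, - int n)) zs"

text \<open>Weakly increasing keys mean weakly decreasing parts for each letter and the order e, h,
  f among the letters: exactly the index set of the basis in
  \<open>universal_affine_sl2\<close>.\<close>

lemma sorted_negative_word:
  assumes "sorted (map letter_key us)" "\<forall>u\<in>set us. snd u < 0"
  shows "\<exists>xs\<in>partitions. \<exists>ys\<in>partitions. \<exists>zs\<in>partitions. us = ordered_word xs ys zs"
  using assms
proof (induction us)
  case Nil
  then show ?case
    by (intro bexI[of _ "[]"]) (auto simp: ordered_word_def partitions_def)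
next
  case (Cons u us)
  then obtain xs ys zs where P: "xs \<in> partitions" "ys \<in> partitions" "zs \<in> partitions"
    and us: "us = ordered_word xs ys zs" by auto
  obtain g n where u: "u = (g, n)" by (cases u)
  then have n: "n < 0" using Cons.prems by auto
  define m where "m = nat (- n)"
  have m: "n = - int m" "m \<noteq> 0" using n by (auto simp: m_def)
  have le: "letter_key u \<le> letter_key w" if "w \<in> set us" for w
    using Cons.prems(1) that by auto
  have nz: "0 \<notin> set xs" "0 \<notin> set ys" "0 \<notin> set zs" using P by (auto simp: partitions_def)
  have le_x: "letter_rank g \<le> 0 \<and> (g = Le \<longrightarrow> i \<le> m)" if "i \<in> set xs" for i
  proof -
    have "i > 0" using that nz by (metis gr0I)
    then show ?thesis using le[of "(Le, - int i)"] that m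
      by (auto simp: us u ordered_word_def letter_key_def)
  qed
  have le_y: "letter_rank g \<le> 1 \<and> (g = Lh \<longrightarrow> i \<le> m)" if "i \<in> set ys" for i
  proof -
    have "i > 0" using that nz by (metis gr0I)
    then show ?thesis using le[of "(Lh, - int i)"] that m
      by (auto simp: us u ordered_word_def letter_key_def)
  qed
  have le_z: "g = Lf \<longrightarrow> i \<le> m" if "i \<in> set zs" for i
  proof -
    have "i > 0" using that nz by (metis gr0I)
    then show ?thesis using le[of "(Lf, - int i)"] that m
      by (auto simp: us u ordered_word_def letter_key_def)
  qed
  show ?case
  proof (cases g)
    case Le
    then have "m # xs \<in> partitions" using P(1) m le_x by (auto simp: partitions_def)
    moreover have "u # us = ordered_word (m # xs) ys zs" by (simp add: u us Le m ordered_word_def)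
    ultimately show ?thesis using P by blast
  next
    case Lh
    then have "xs = []" using le_x by (cases xs) auto
    moreover have "m # ys \<in> partitions" using Lh P(2) m le_y by (auto simp: partitions_def)
    ultimately have "u # us = ordered_word [] (m # ys) zs" by (simp add: u us Lh m ordered_word_def)
    then show ?thesis using P \<open>m # ys \<in> partitions\<close> \<open>xs = []\<close> by blast
  next
    case Lf
    then have "xs = []" using le_x by (cases xs) auto
    moreover have "ys = []" using Lf le_y by (cases ys) auto
    moreover have "m # zs \<in> partitions" using Lf P(3) m le_z by (auto simp: partitions_def)
    ultimately have "u # us = ordered_word [] [] (m # zs)" by (simp add: u us Lf m ordered_word_def)
    then show ?thesis using P \<open>m # zs \<in> partitions\<close> \<open>xs = []\<close> \<open>ys = []\<close> by blast
  qed
qed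

fun letter :: "'v \<Rightarrow> 'v \<Rightarrow> 'v \<Rightarrow> sl2_letter \<Rightarrow> 'v" where
  "letter e f h Le = e" | "letter e f h Lh = h" | "letter e f h Lf = f"

lemma word_ordered:
  "word (\<lambda>g. nprod V (letter e f h g)) (ordered_word xs ys zs) v =
     lower V e xs (lower V h ys (lower V f zs v))"
proof -
  have "word (\<lambda>g. nprod V (letter e f h g)) (map (\<lambda>n. (g, - int n)) ns) v =
     lower V (letter e f h g) ns v" for g ns v
    by (induction ns) (simp_all add: lower_def)
  then show ?thesis by (simp add: ordered_word_def word_append)
qed

text \<open>Phrased through stable subspaces, generation is at once an induction rule along vectors
  \<open>g1(n1) ... gr(nr) 1\<close>.\<close>

definition generated_by :: "'v::ab_group_add va \<Rightarrow> 'v set \<Rightarrow> bool" where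
  "generated_by V G \<longleftrightarrow>
     (\<forall>N. module.subspace (smul V) N \<longrightarrow> vac V \<in> N \<longrightarrow>
        (\<forall>g\<in>G. \<forall>n. \<forall>v\<in>N. nprod V g n v \<in> N) \<longrightarrow> N = UNIV)"

context vertex_algebra
begin

lemma generated_induct:
  assumes "generated_by V G" "subspace N" "vc \<in> N" "\<And>g n v. g \<in> G \<Longrightarrow> v \<in> N \<Longrightarrow> Y g n v \<in> N"
  shows "v \<in> N"
  using assms unfolding generated_by_def by blast

text \<open>The vectors all of whose modes preserve \<open>M\<close> include the vacuum and, by the
  iterate formula, are closed under every \<open>g_(n)\<close> with \<open>g\<close> in
  \<open>G\<close>.\<close>

lemma generated_closed:
  assumes G: "generated_by V G" and M: "subspace M"
    and GM: "\<And>g n v. g \<in> G \<Longrightarrow> v \<in> M \<Longrightarrow> Y g n v \<in> M" and v: "v \<in> M"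
  shows "Y a n v \<in> M"
proof -
  have "a \<in> {a. \<forall>n. \<forall>c\<in>M. Y a n c \<in> M}"
  proof (rule generated_induct[OF G])
    show "subspace {a. \<forall>n. \<forall>c\<in>M. Y a n c \<in> M}"
      by (rule subspaceI) (use M in \<open>auto simp: bilin subspace_0 subspace_add subspace_scale\<close>)
    show "vc \<in> {a. \<forall>n. \<forall>c\<in>M. Y a n c \<in> M}" using M by (auto simp: vacuum subspace_0)
    fix g n v assume "g \<in> G" "v \<in> {a. \<forall>n. \<forall>c\<in>M. Y a n c \<in> M}"
    then show "Y g n v \<in> {a. \<forall>n. \<forall>c\<in>M. Y a n c \<in> M}"
      using GM by (auto intro!: nprod_mem[OF M])
  qed
  then show ?thesis using v by auto
qed

text \<open>Both \<open>w_(0)\<close> and \<open>T\<close> are derivations of all products, so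
  agreement on generators propagates.\<close>

lemma generated_tr:
  assumes G: "generated_by V G" and g: "\<And>g. g \<in> G \<Longrightarrow> conf w (H g) g"
  shows "Y w 0 a = tr a"
proof -
  have "a \<in> {a. Y w 0 a = tr a}"
  proof (rule generated_induct[OF G])
    show "subspace {a. Y w 0 a = tr a}"
      by (rule subspaceI) (auto simp: bilin)
    show "vc \<in> {a. Y w 0 a = tr a}" by (auto simp: creation vacuum)
    fix x n v assume "x \<in> G" "v \<in> {a. Y w 0 a = tr a}"
    then show "Y x n v \<in> {a. Y w 0 a = tr a}"
      using conf_mode0[OF g] tr_nprod by auto
  qed
  then show ?thesis by auto
qed

lemma conf_lower:
  assumes "conf w 1 a" "conf w s v"
  shows "conf w (s + of_nat (sum_list ns)) (lower V a ns v)"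
proof (induction ns)
  case Nil
  then show ?case using assms(2) by (simp add: lower_def)
next
  case (Cons n ns)
  from conf_nprod[OF assms(1) this, of "- int n"] show ?case
    by (simp add: lower_def algebra_simps)
qed

text \<open>A proper ideal is graded and so lies in the span of the vectors of positive weight; hence two
  proper ideals cannot add up to everything.\<close>

lemma vac_not_in_sum:
  assumes B: "span B = UNIV" "\<And>b. b \<in> B \<Longrightarrow> Y w 1 b = of_nat (D b) \<cdot> b"
    "\<And>b. b \<in> B \<Longrightarrow> D b = 0 \<Longrightarrow> b \<in> span {vc}"
    and w: "Y w 1 vc = 0"
    and I: "subspace I" "\<And>x. x \<in> I \<Longrightarrow> Y w 1 x \<in> I" "vc \<notin> I"
    and K: "subspace K" "\<And>x. x \<in> K \<Longrightarrow> Y w 1 x \<in> K" "vc \<notin> K"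
    and v: "v \<in> I" "v - vc \<in> K"
  shows False
proof -
  obtain S x where S: "finite S" and vS: "v = (\<Sum>s\<in>S. x s)"
    and eig: "\<And>s. s \<in> S \<Longrightarrow> Y w 1 (x s) = s \<cdot> x s"
    and xB: "\<And>s. s \<in> S \<Longrightarrow> x s \<in> span {b \<in> B. of_nat (D b) = s}"
    by (rule eigen_decomposition[of v B "Y w 1" "\<lambda>b. of_nat (D b)"]) (use B in \<open>auto simp: bilin\<close>)
  have xI: "x s \<in> I" if "s \<in> S" for s
    by (rule eigen_component[OF S I(1), of "Y w 1"]) (use I eig vS v that in \<open>auto simp: bilin\<close>)
  have x0: "x 0 = 0" if "0 \<in> S"
  proof (rule ccontr)
    assume ne: "x 0 \<noteq> 0"
    have "x 0 \<in> span {vc}"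
    proof -
      have "x 0 \<in> span {b \<in> B. of_nat (D b) = (0 :: complex)}" using xB[OF that] .
      also have "\<dots> \<subseteq> span {vc}" by (rule span_minimal) (use B(3) in auto)
      finally show ?thesis .
    qed
    then obtain r where r: "x 0 = r \<cdot> vc" by (auto simp: span_singleton)
    then have "vc = (1 / r) \<cdot> x 0" using ne by auto
    then show False using xI[OF that] I(1,3) subspace_scale by metis
  qed
  \<comment> \<open>The component of \<open>v\<close> of weight 0 vanishes, so \<open>v - 1\<close>
    has weight-0 component \<open>-1\<close>; \<open>y\<close> lists its components.\<close>
  define y where "y s = (if s = 0 then - vc else x s)" for s
  have "v - vc = (\<Sum>s\<in>insert 0 S. y s)"
  proof (cases "0 \<in> S")
    case True
    then have "v = (\<Sum>s\<in>S - {0}. x s)" using True x0 S vS by (simp add: sum.remove)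
    moreover have "(\<Sum>s\<in>S - {0}. y s) = (\<Sum>s\<in>S - {0}. x s)" by (rule sum.cong) (auto simp: y_def)
    ultimately show ?thesis unfolding sum.insert_remove[OF S] by (simp add: y_def)
  next
    case False
    then have "(\<Sum>s\<in>S. y s) = (\<Sum>s\<in>S. x s)" by (intro sum.cong) (auto simp: y_def)
    then show ?thesis using S False vS by (simp add: y_def)
  qed
  then have "y 0 \<in> K"
    by (intro eigen_component[of "insert 0 S" K "Y w 1" y])
      (use S K v eig w in \<open>auto simp: bilin y_def\<close>)
  then have "- vc \<in> K" by (simp add: y_def)
  then show False using subspace_neg[OF K(1)] K(3) by fastforce
qed

text \<open>The commutator formula reads all mode relations off the nonnegative products; here only
  \<open>j = 0, 1\<close> contribute.\<close>

lemma affineI: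
  assumes "\<And>n. Y h (int n) e = (if n = 0 then 2 \<cdot> e else 0)"
    and "\<And>n. Y h (int n) f = (if n = 0 then (- 2) \<cdot> f else 0)"
    and "\<And>n. Y e (int n) f = (if n = 0 then h else if n = 1 then k \<cdot> vc else 0)"
    and "\<And>n. Y h (int n) h = (if n = 1 then (2 * k) \<cdot> vc else 0)"
    and "\<And>n. Y e (int n) e = 0" "\<And>n. Y f (int n) f = 0"
  shows "affine_sl2_relations k V e f h"
proof -
  have two: "{..<2::nat} = {0, 1}" by auto
  show ?thesis
    unfolding affine_sl2_relations_def Let_def
  proof (intro allI conjI)
    fix m n v
    show "Y h m (Y e n v) - Y e n (Y h m v) = 2 \<cdot> Y e (m + n) v"
      by (subst commutator[of 2]) (simp_all add: assms two bilin)
    show "Y h m (Y f n v) - Y f n (Y h m v) = (- 2) \<cdot> Y f (m + n) v"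
      by (subst commutator[of 2]) (simp_all add: assms two bilin)
    show "Y e m (Y f n v) - Y f n (Y e m v) =
        Y h (m + n) v + (if m + n = 0 then (of_int m * 1 * k) \<cdot> v else 0)"
      by (subst commutator[of 2]) (auto simp add: assms two bilin vacuum)
    show "Y h m (Y h n v) - Y h n (Y h m v) = (if m + n = 0 then (of_int m * 2 * k) \<cdot> v else 0)"
      by (subst commutator[of 2]) (auto simp add: assms two bilin vacuum mult.assoc)
    show "Y e m (Y e n v) - Y e n (Y e m v) = 0"
      by (subst commutator[of 2]) (simp_all add: assms)
    show "Y f m (Y f n v) - Y f n (Y f m v) = 0"
      by (subst commutator[of 2]) (simp_all add: assms)
  qed
qed

context
  fixes k :: complex and e f h :: 'v
  assumes R: "affine_sl2_relations k V e f h"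
begin

lemma affine_rules:
  "Y h m (Y e n v) = Y e n (Y h m v) + 2 \<cdot> Y e (m + n) v"
  "Y f m (Y h n v) = Y h n (Y f m v) + 2 \<cdot> Y f (m + n) v"
  "Y f m (Y e n v) = Y e n (Y f m v) - Y h (m + n) v + (if m + n = 0 then (of_int m * k) \<cdot> v else 0)"
  "Y h m (Y h n v) = Y h n (Y h m v) + (if m + n = 0 then (2 * of_int m * k) \<cdot> v else 0)"
  "Y e m (Y e n v) = Y e n (Y e m v)"
  "Y f m (Y f n v) = Y f n (Y f m v)"
proof -
  note R' = R[unfolded affine_sl2_relations_def Let_def, rule_format]
  show "Y h m (Y e n v) = Y e n (Y h m v) + 2 \<cdot> Y e (m + n) v"
    using R'[of m n v] by (simp add: algebra_simps)
  have "Y h n (Y f m v) - Y f m (Y h n v) = (- 2) \<cdot> Y f (n + m) v" using R'[of n m v] by blast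
  then show "Y f m (Y h n v) = Y h n (Y f m v) + 2 \<cdot> Y f (m + n) v"
    by (simp add: algebra_simps)
  have "Y e n (Y f m v) - Y f m (Y e n v) =
     Y h (n + m) v + (if n + m = 0 then (of_int n * 1 * k) \<cdot> v else 0)" using R'[of n m v] by blast
  moreover have "(if n + m = 0 then (of_int n * 1 * k) \<cdot> v else 0) =
    - (if m + n = 0 then (of_int m * k) \<cdot> v else 0)"
    by (cases "m + n = 0") (auto simp: add.commute eq_neg_iff_add_eq_0[symmetric])
  ultimately show "Y f m (Y e n v) = Y e n (Y f m v) - Y h (m + n) v + (if m + n = 0 then (of_int m * k) \<cdot> v else 0)"
    by (simp add: algebra_simps)
  have "Y h m (Y h n v) - Y h n (Y h m v) = (if m + n = 0 then (of_int m * 2 * k) \<cdot> v else 0)"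
    using R'[of m n v] by blast
  then show "Y h m (Y h n v) = Y h n (Y h m v) + (if m + n = 0 then (2 * of_int m * k) \<cdot> v else 0)"
    by (simp add: algebra_simps)
  show "Y e m (Y e n v) = Y e n (Y e m v)" "Y f m (Y f n v) = Y f n (Y f m v)"
    using R'[of m n v] by auto
qed

end

end

text \<open>Each bracket of basis elements is a multiple of a single basis element, which allows one
  uniform formula in \<open>affine_bracket\<close>; \<open>(0, Le)\<close> encodes a vanishing
  bracket.\<close>

fun sl2_bracket :: "sl2_letter \<Rightarrow> sl2_letter \<Rightarrow> complex \<times> sl2_letter" where
  "sl2_bracket Lh Le = (2, Le)" | "sl2_bracket Le Lh = (- 2, Le)" |
  "sl2_bracket Lh Lf = (- 2, Lf)" | "sl2_bracket Lf Lh = (2, Lf)" |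
  "sl2_bracket Le Lf = (1, Lh)" | "sl2_bracket Lf Le = (- 1, Lh)" |
  "sl2_bracket _ _ = (0, Le)"

fun sl2_form :: "sl2_letter \<Rightarrow> sl2_letter \<Rightarrow> complex" where
  "sl2_form Le Lf = 1" | "sl2_form Lf Le = 1" | "sl2_form Lh Lh = 2" | "sl2_form _ _ = 0"

lemma (in vertex_algebra) affine_bracket:
  assumes R: "affine_sl2_relations k V e f h"
  shows "Y (letter e f h g) m (Y (letter e f h g') n v) - Y (letter e f h g') n (Y (letter e f h g) m v)
   = fst (sl2_bracket g g') \<cdot> Y (letter e f h (snd (sl2_bracket g g'))) (m + n) v
     + (if m + n = 0 then of_int m * sl2_form g g' * k else 0) \<cdot> v"
proof -
  note r = affine_rules[OF R]
  show ?thesis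
  proof (cases g; cases g')
    assume "g = Le" "g' = Le" then show ?thesis using r(5)[of m n v] by simp
  next
    assume "g = Le" "g' = Lh" then show ?thesis using r(1)[of n m v] by (simp add: add.commute)
  next
    assume "g = Le" "g' = Lf" then show ?thesis
      using r(3)[of n m v] by (cases "m = - n") (auto simp add: add.commute add_eq_0_iff)
  next
    assume "g = Lh" "g' = Le" then show ?thesis using r(1)[of m n v] by (simp add: add.commute)
  next
    assume "g = Lh" "g' = Lh" then show ?thesis using r(4)[of m n v] by (simp add: mult_ac)
  next
    assume "g = Lh" "g' = Lf" then show ?thesis using r(2)[of n m v] by (simp add: add.commute)
  next
    assume "g = Lf" "g' = Le" then show ?thesis using r(3)[of m n v] by simp
  next
    assume "g = Lf" "g' = Lh" then show ?thesis using r(2)[of m n v] by simp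
  next
    assume "g = Lf" "g' = Lf" then show ?thesis using r(6)[of m n v] by simp
  qed
qed

text \<open>The vectors whose modes are all intertwined by \<open>\<phi>\<close> are closed under
  products with generators: with one common truncation bound, the iterate formula writes the modes
  of \<open>g_(l) b\<close> as the same combination in \<open>V\<close> and in
  \<open>W\<close>.\<close>

lemma va_hom_of_generators:
  assumes "vertex_algebra V" "vertex_algebra W"
    and G: "generated_by V G" and lin: "Vector_Spaces.linear (smul V) (smul W) \<phi>"
    and vac: "\<phi> (vac V) = vac W"
    and gen: "\<And>g n v. g \<in> G \<Longrightarrow> \<phi> (nprod V g n v) = nprod W (\<phi> g) n (\<phi> v)"
  shows "va_hom V W \<phi>"
proof -
  interpret V: vertex_algebra V by fact
  interpret W: vertex_algebra W by fact
  interpret lin: Vector_Spaces.linear "smul V" "smul W" \<phi> by fact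
  define A where "A = {a. \<forall>n v. \<phi> (nprod V a n v) = nprod W (\<phi> a) n (\<phi> v)}"
  have "a \<in> A" for a
  proof (rule V.generated_induct[OF G])
    show "V.subspace A"
      by (rule V.subspaceI) (auto simp: A_def V.bilin W.bilin lin.add lin.scale)
    show "vac V \<in> A" by (auto simp: A_def V.vacuum W.vacuum vac)
    fix g l b assume g: "g \<in> G" and b: "b \<in> A"
    show "nprod V g l b \<in> A"
      unfolding A_def
    proof (intro CollectI allI)
      fix n c
      obtain N1 where N1: "\<And>j. j \<ge> N1 \<Longrightarrow> nprod V b (n + int j) c = 0"
        by (rule V.truncation2[of b n c]) blast
      obtain N2 where N2: "\<And>j. j \<ge> N2 \<Longrightarrow> nprod V g (int j) c = 0"
        by (rule V.truncation1[of g c]) blast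
      obtain N3 where N3: "\<And>j. j \<ge> N3 \<Longrightarrow> nprod W (\<phi> b) (n + int j) (\<phi> c) = 0"
        by (rule W.truncation2[of "\<phi> b" n "\<phi> c"]) blast
      obtain N4 where N4: "\<And>j. j \<ge> N4 \<Longrightarrow> nprod W (\<phi> g) (int j) (\<phi> c) = 0"
        by (rule W.truncation1[of "\<phi> g" "\<phi> c"]) blast
      define N where "N = N1 + N2 + N3 + N4"
      have b': "\<phi> (nprod V b n v) = nprod W (\<phi> b) n (\<phi> v)" for n v using b by (auto simp: A_def)
      have "nprod V (nprod V g l b) n c = (\<Sum>j<N. smul V ((- 1) ^ j * (of_int l gchoose j))
         (nprod V g (l - int j) (nprod V b (n + int j) c) - smul V ((- 1) powi l)
            (nprod V b (n + l - int j) (nprod V g (int j) c))))"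
        by (rule V.iterate) (simp_all add: N_def N1 N2)
      then have "\<phi> (nprod V (nprod V g l b) n c) = (\<Sum>j<N. smul W ((- 1) ^ j * (of_int l gchoose j))
         (nprod W (\<phi> g) (l - int j) (nprod W (\<phi> b) (n + int j) (\<phi> c)) - smul W ((- 1) powi l)
            (nprod W (\<phi> b) (n + l - int j) (nprod W (\<phi> g) (int j) (\<phi> c)))))"
        by (simp only: lin.sum lin.scale lin.diff gen[OF g] b')
      also have "\<dots> = nprod W (nprod W (\<phi> g) l (\<phi> b)) n (\<phi> c)"
        by (rule W.iterate[symmetric]) (simp_all add: N_def N3 N4)
      finally show "\<phi> (nprod V (nprod V g l b) n c) = nprod W (\<phi> (nprod V g l b)) n (\<phi> c)"
        by (simp add: gen[OF g])
    qed
  qed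
  then show ?thesis using lin vac by (auto simp: va_hom_def A_def)
qed

lemma generated_by_surj:
  assumes "vertex_algebra V" "vertex_algebra W" "generated_by V G" "va_hom V W q" "surj q"
  shows "generated_by W (q ` G)"
  unfolding generated_by_def
proof (intro allI impI)
  interpret V: vertex_algebra V by fact
  interpret W: vertex_algebra W by fact
  have lin: "Vector_Spaces.linear (smul V) (smul W) q" and hom: "q (nprod V a n b) = nprod W (q a) n (q b)"
    and vac: "q (vac V) = vac W" for a n b
    using assms(4) by (auto simp: va_hom_def)
  interpret lin: Vector_Spaces.linear "smul V" "smul W" q by fact
  fix N assume N: "W.subspace N" "vac W \<in> N" "\<forall>g\<in>q ` G. \<forall>n. \<forall>v\<in>N. nprod W g n v \<in> N"
  have "v \<in> q -` N" for v
    by (rule V.generated_induct[OF assms(3)])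
      (use N in \<open>auto simp: vac hom lin.add lin.scale W.subspace_add W.subspace_scale W.subspace_0
        lin.zero intro!: V.subspaceI\<close>)
  then show "N = UNIV" using assms(5) by (metis UNIV_eq_I surjD vimageE)
qed

lemma va_hom_unique:
  assumes "vertex_algebra V" "vertex_algebra W" "generated_by V G" "va_hom V W \<phi>" "va_hom V W \<psi>"
    and "\<And>g. g \<in> G \<Longrightarrow> \<phi> g = \<psi> g"
  shows "\<phi> = \<psi>"
proof
  interpret V: vertex_algebra V by fact
  interpret W: vertex_algebra W by fact
  interpret p: Vector_Spaces.linear "smul V" "smul W" \<phi> using assms(4) by (simp add: va_hom_def)
  interpret s: Vector_Spaces.linear "smul V" "smul W" \<psi> using assms(5) by (simp add: va_hom_def)
  fix v
  have "v \<in> {v. \<phi> v = \<psi> v}"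
    by (rule V.generated_induct[OF assms(3)])
      (use assms(4-6) in \<open>auto simp: va_hom_def p.add s.add p.scale s.scale p.zero s.zero
         intro!: V.subspaceI\<close>)
  then show "\<phi> v = \<psi> v" by simp
qed

lemma universal_affine_generated:
  assumes "universal_affine_sl2 k U e f h"
  shows "generated_by U {e, f, h}"
  unfolding generated_by_def
proof (intro allI impI)
  interpret vertex_algebra U using assms by (simp add: universal_affine_sl2_def)
  fix N assume N: "subspace N" "vac U \<in> N" "\<forall>g\<in>{e, f, h}. \<forall>n. \<forall>v\<in>N. nprod U g n v \<in> N"
  have low: "lower U g ns v \<in> N" if "g \<in> {e, f, h}" "v \<in> N" for g ns v
    using that N(3) by (induction ns) (auto simp: lower_def)
  have "UNIV = span ((\<lambda>(xs, ys, zs). lower U e xs (lower U h ys (lower U f zs (vac U)))) `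
      (partitions \<times> partitions \<times> partitions))"
    using assms by (simp add: universal_affine_sl2_def basis_family_def)
  also have "\<dots> \<subseteq> N"
    by (rule span_minimal) (use N low in auto)
  finally show "N = UNIV" by auto
qed

text \<open>The straightening is carried out in \<open>U \<times> T\<close>: there, the span of all words is the graph of the
  linear map that is given on the Poincare-Birkhoff-Witt basis.\<close>

theorem universal_affine_hom:
  assumes U: "universal_affine_sl2 k U e f h" and T: "vertex_algebra T"
    and R: "affine_sl2_relations k T e' f' h'"
  obtains \<phi> where "va_hom U T \<phi>" "\<phi> e = e'" "\<phi> f = f'" "\<phi> h = h'"
proof -
  interpret U: vertex_algebra U using U by (simp add: universal_affine_sl2_def)
  interpret T: vertex_algebra T by fact
  have RU: "affine_sl2_relations k U e f h" using U by (simp add: universal_affine_sl2_def)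
  define ps where "ps r x = (smul U r (fst x), smul T r (snd x))" for r x
  interpret PR: vector_space ps
    by unfold_locales
      (auto simp: ps_def U.scale_right_distrib T.scale_right_distrib U.scale_left_distrib T.scale_left_distrib)
  interpret UT: vector_space_pair "smul U" "smul T" ..
  define M where "M g n x = (nprod U (letter e f h g) n (fst x), nprod T (letter e' f' h' g) n (snd x))"
    for g n x
  have word_pair: "word M ws (u, v) = (word (\<lambda>g. nprod U (letter e f h g)) ws u,
      word (\<lambda>g. nprod T (letter e' f' h' g)) ws v)" for ws u v
    by (induction ws) (auto simp: M_def)
  let ?I = "partitions \<times> partitions \<times> partitions"
  define bU where "bU = (\<lambda>(xs, ys, zs). lower U e xs (lower U h ys (lower U f zs (vac U))))"
  define bT where "bT = (\<lambda>(xs, ys, zs). lower T e' xs (lower T h' ys (lower T f' zs (vac T))))"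
  have bU: "inj_on bU ?I" "U.independent (bU ` ?I)" "U.span (bU ` ?I) = UNIV"
    using U by (simp_all add: universal_affine_sl2_def basis_family_def bU_def)
  obtain \<phi> where lin: "Vector_Spaces.linear (smul U) (smul T) \<phi>"
    and \<phi>: "\<forall>x\<in>bU ` ?I. \<phi> x = bT (inv_into ?I bU x)"
    using UT.linear_independent_extend[OF bU(2), of "\<lambda>x. bT (inv_into ?I bU x)"] by blast
  have \<phi>b: "\<phi> (bU i) = bT i" if "i \<in> ?I" for i 
    using bspec[OF \<phi> imageI[OF that]] by (simp only: inv_into_f_f[OF bU(1) that])
  interpret lin: Vector_Spaces.linear "smul U" "smul T" \<phi> by fact
  define v0 where "v0 = (vac U, vac T)"
  have M_add: "M g n (x + y) = M g n x + M g n y"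
    and M_scale: "M g n (ps r x) = ps r (M g n x)" for g n r x y
    by (auto simp: M_def ps_def U.bilin T.bilin)
  define G where "G = {x. snd x = \<phi> (fst x)}"
  have G: "PR.subspace G"
    by (rule PR.subspaceI) (auto simp: G_def ps_def lin.add lin.scale lin.zero)
  have word_G: "word M ws v0 \<in> G" for ws
  proof -
    have "word M ws v0 \<in> PR.span {word M us v0 | us. sorted (map letter_key us) \<and> (\<forall>u\<in>set us. snd u < 0)}"
    proof (rule PR.word_in_span_sorted)
      fix g m g' n x
      let ?c = "fst (sl2_bracket g g')" and ?g = "snd (sl2_bracket g g')"
      let ?r = "if m + n = 0 then of_int m * sl2_form g g' * k else 0"
      have "M g m (M g' n x) - M g' n (M g m x) = ps ?c (M ?g (m + n) x) + ps ?r x"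
        using U.affine_bracket[OF RU, of g m g' n "fst x"] T.affine_bracket[OF R, of g m g' n "snd x"]
        by (auto simp: M_def ps_def)
      also have "\<dots> \<in> PR.span (insert x {M g'' i x |g'' i. True})"
        by (intro PR.span_add PR.span_scale PR.span_base) auto
      finally show "M g m (M g' n x) - M g' n (M g m x) \<in> PR.span (insert x {M g'' i x |g'' i. True})" .
    next
      fix g and n :: int assume "n \<ge> 0"
      then show "M g n v0 = 0"
        by (simp add: M_def v0_def U.creation T.creation zero_prod_def)
    next
      fix g g' and m n :: int assume "letter_key (g, m) \<le> letter_key (g', n)" "0 \<le> m"
      then show "0 \<le> n" by (auto simp: letter_key_def split: if_splits)
    qed (simp_all add: M_add M_scale)
    also have "\<dots> \<subseteq> G"
    proof (rule PR.span_minimal[OF _ G], rule subsetI)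
      fix x assume "x \<in> {word M us v0 | us. sorted (map letter_key us) \<and> (\<forall>u\<in>set us. snd u < 0)}"
      then obtain us where x: "x = word M us v0"
        and us: "sorted (map letter_key us)" "\<forall>u\<in>set us. snd u < 0" by blast
      obtain xs ys zs where i: "(xs, ys, zs) \<in> ?I" and "us = ordered_word xs ys zs"
        using sorted_negative_word[OF us] by auto
      then have "word M us v0 = (bU (xs, ys, zs), bT (xs, ys, zs))"
        unfolding v0_def word_pair by (simp add: word_ordered bU_def bT_def)
      then show "x \<in> G" unfolding x using \<phi>b[OF i] by (simp add: G_def)
    qed
    finally show ?thesis .
  qed
  \<comment> \<open>\<open>S\<close> is stable under all letters by construction, lies in the graph
    by straightening and contains the graph by the basis of \<open>U\<close>. So the graph is
    stable, which says that \<open>\<phi>\<close> intertwines the letters.\<close>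
  define S where "S = PR.span {word M ws v0 | ws. True}"
  have SG: "S \<subseteq> G" unfolding S_def by (rule PR.span_minimal[OF _ G]) (use word_G in auto)
  have M_S: "M g n x \<in> S" if "x \<in> S" for g n x
  proof (rule PR.linear_image_span[where A = "M g n"])
    show "x \<in> PR.span {word M ws v0 | ws. True}" using that by (simp add: S_def)
    fix b assume "b \<in> {word M ws v0 | ws. True}"
    then obtain ws where "b = word M ws v0" by auto
    then have "M g n b = word M ((g, n) # ws) v0" by simp
    then show "M g n b \<in> S" unfolding S_def by (intro PR.span_base) blast
  qed (simp_all add: M_add M_scale S_def)
  have graph: "(u, \<phi> u) \<in> S" for u
  proof -
    have "U.subspace {u. (u, \<phi> u) \<in> S}"
    proof (rule U.subspaceI)
      show "0 \<in> {u. (u, \<phi> u) \<in> S}"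
        using PR.span_zero[of "{word M ws v0 | ws. True}"] by (simp add: lin.zero S_def zero_prod_def)
      show "x + y \<in> {u. (u, \<phi> u) \<in> S}" if "x \<in> {u. (u, \<phi> u) \<in> S}" "y \<in> {u. (u, \<phi> u) \<in> S}" for x y
        using PR.span_add[of "(x, \<phi> x)" "{word M ws v0 | ws. True}" "(y, \<phi> y)"] that
        by (simp add: lin.add S_def)
      show "smul U c x \<in> {u. (u, \<phi> u) \<in> S}" if "x \<in> {u. (u, \<phi> u) \<in> S}" for c x
        using PR.span_scale[of "(x, \<phi> x)" "{word M ws v0 | ws. True}" c] that
        by (simp add: lin.scale S_def ps_def)
    qed
    moreover have "bU ` ?I \<subseteq> {u. (u, \<phi> u) \<in> S}"
    proof clarify
      fix xs ys zs assume "xs \<in> partitions" "ys \<in> partitions" "zs \<in> partitions"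
      then have i: "(xs, ys, zs) \<in> ?I" by auto
      have "word M (ordered_word xs ys zs) v0 = (bU (xs, ys, zs), \<phi> (bU (xs, ys, zs)))"
        unfolding v0_def word_pair \<phi>b[OF i] by (simp add: word_ordered bU_def bT_def)
      then show "(bU (xs, ys, zs), \<phi> (bU (xs, ys, zs))) \<in> S"
        unfolding S_def by (metis (mono_tags, lifting) PR.span_base mem_Collect_eq)
    qed
    ultimately show ?thesis using U.span_minimal bU(3) by blast
  qed
  have step: "\<phi> (nprod U (letter e f h g) n u) = nprod T (letter e' f' h' g) n (\<phi> u)" for g n u
  proof -
    have "M g n (u, \<phi> u) \<in> G" using M_S[OF graph] SG by blast
    then show ?thesis by (simp add: G_def M_def)
  qed
  have vac: "\<phi> (vac U) = vac T"
    using \<phi>b[of "([], [], [])"] by (simp add: bU_def bT_def lower_def partitions_def)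
  have letters: "\<phi> (letter e f h g) = letter e' f' h' g" for g
    using step[of g "- 1" "vac U"] by (simp add: vac U.creation T.creation)
  have "va_hom U T \<phi>"
  proof (rule va_hom_of_generators[OF U.vertex_algebra_axioms T universal_affine_generated[OF U] lin vac])
    fix g n v assume "g \<in> {e, f, h}"
    then obtain l where "g = letter e f h l" by (metis insertE letter.simps singletonD)
    then show "\<phi> (nprod U g n v) = nprod T (\<phi> g) n (\<phi> v)" using step letters by simp
  qed
  then show ?thesis
    using that letters[of Le] letters[of Lf] letters[of Lh] by simp
qed

section \<open>The Sugawara vector and the weights of the generators\<close>

context vertex_algebra
begin

lemma numeral_scale:
  "2 \<cdot> x = x + x" "(- 2) \<cdot> x = - (x + x)" "4 \<cdot> x = x + x + x + x" "8 \<cdot> x = x + x + x + x + x + x + x + x"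
  "(2 * r) \<cdot> x = r \<cdot> x + r \<cdot> x" "(4 * r) \<cdot> x = r \<cdot> x + r \<cdot> x + r \<cdot> x + r \<cdot> x"
  using scale_left_distrib[of 1 1 x] scale_left_distrib[of 2 2 x] scale_left_distrib[of 4 4 x]
    scale_left_distrib[of r r x] scale_left_distrib[of "2 * r" "2 * r" x]
  by (simp_all add: add.assoc)

text \<open>By skew-symmetry, weight 1 can be read off \<open>x_(n) w\<close> instead of
  \<open>w_(n) x\<close>. The former is easy to compute: nonnegative modes of a generator are moved
  through creation modes to the vacuum.\<close>

lemma conf_of_modes:
  assumes "\<And>n. Y x (int n) w = (if n = 1 then x else 0)"
  shows "conf w 1 x"
proof -
  have two: "{..<2::nat} = {0, 1}" by auto
  have *: "Y w 0 x = tr x" "Y w 1 x = x"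
    using skew[of 2 x w 0] skew[of 2 x w 1] assms by (simp_all add: two creation)
  then show ?thesis by (simp add: conf_def)
qed

lemma sugawara_conf:
  assumes R: "affine_sl2_relations k V e f h" and k: "k + 2 \<noteq> 0"
  shows "conf (sugawara k V e f h) 1 e" "conf (sugawara k V e f h) 1 f" "conf (sugawara k V e f h) 1 h"
proof -
  note r = affine_rules[OF R]
  \<comment> \<open>\<open>S\<close> is \<open>4 (k + 2)\<close> times the Sugawara vector, with
    \<open>f(-1) e(-1) 1\<close> rewritten as \<open>e(-1) f(-1) 1 - h(-2) 1\<close>, so that no
    denominators occur.\<close>
  define S where "S = 4 \<cdot> Y e (- 1) (Y f (- 1) vc) - 2 \<cdot> Y h (- 2) vc + Y h (- 1) (Y h (- 1) vc)"
  have fe: "Y f (- 1) (Y e (- 1) vc) = Y e (- 1) (Y f (- 1) vc) - Y h (- 2) vc"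
    using r(3)[of "- 1" "- 1" vc] by simp
  have "4 \<cdot> ((1 / 2) \<cdot> x) = 2 \<cdot> x" "2 \<cdot> ((1 / 2) \<cdot> x) = x" for x by simp_all
  then have "(1 / (4 * (k + 2))) \<cdot> (2 \<cdot> (Y e (- 1) (Y f (- 1) vc) + Y f (- 1) (Y e (- 1) vc)
      + (1 / 2) \<cdot> Y h (- 1) (Y h (- 1) vc))) = (1 / (4 * (k + 2))) \<cdot> S"
    unfolding S_def fe
    by (simp only: scale_right_distrib scale_right_diff_distrib)
       (simp add: numeral_scale(1,3) algebra_simps)
  moreover have "1 / (2 * z) = 1 / (4 * z) * 2" for z :: complex by simp
  then have "(1 / (2 * (k + 2))) \<cdot> x = (1 / (4 * (k + 2))) \<cdot> (2 \<cdot> x)" for x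
    by (simp only: scale_scale)
  ultimately have sug: "sugawara k V e f h = (1 / (4 * (k + 2))) \<cdot> S"
    unfolding sugawara_def by (simp only:)
  have e: "i \<ge> 0 \<Longrightarrow> j < 0 \<Longrightarrow> Y e i (Y h j v) = Y h j (Y e i v) - 2 \<cdot> Y e (i + j) v"
    "i \<ge> 0 \<Longrightarrow> Y e i (Y e (- 1) v) = Y e (- 1) (Y e i v)"
    "i \<ge> 0 \<Longrightarrow> j < 0 \<Longrightarrow> Y e i (Y f j v) = Y f j (Y e i v) + Y h (i + j) v
       + (if i + j = 0 then (of_int i * k) \<cdot> v else 0)" for i j v
    using r(1)[of j i v] r(5)[of i "- 1" v] r(3)[of j i v]
    by (auto simp add: add.commute add_eq_0_iff)
  have h: "i \<ge> 0 \<Longrightarrow> j < 0 \<Longrightarrow> Y h i (Y e j v) = Y e j (Y h i v) + 2 \<cdot> Y e (i + j) v"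
    "i \<ge> 0 \<Longrightarrow> j < 0 \<Longrightarrow> Y h i (Y h j v) = Y h j (Y h i v) + (if i + j = 0 then (2 * of_int i * k) \<cdot> v else 0)"
    "i \<ge> 0 \<Longrightarrow> j < 0 \<Longrightarrow> Y h i (Y f j v) = Y f j (Y h i v) - 2 \<cdot> Y f (i + j) v" for i j v
    using r(1)[of i j v] r(4)[of i j v] r(2)[of j i v]
    by (auto simp add: add.commute)
  have f: "i \<ge> 0 \<Longrightarrow> j < 0 \<Longrightarrow> Y f i (Y e j v) = Y e j (Y f i v) - Y h (i + j) v
      + (if i + j = 0 then (of_int i * k) \<cdot> v else 0)"
    "i \<ge> 0 \<Longrightarrow> j < 0 \<Longrightarrow> Y f i (Y h j v) = Y h j (Y f i v) + 2 \<cdot> Y f (i + j) v"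
    "i \<ge> 0 \<Longrightarrow> Y f i (Y f (- 1) v) = Y f (- 1) (Y f i v)" for i j v
    using r(3)[of i j v] r(2)[of i j v] r(6)[of i "- 1" v] by auto
  have split: "n = 0 \<or> n = 1 \<or> n = 2 \<or> n \<ge> 3" for n :: nat by linarith
  have he: "Y h (- 1) (Y e (- 1) vc) = Y e (- 1) (Y h (- 1) vc) + 2 \<cdot> Y e (- 2) vc"
    "Y f (- 1) (Y h (- 1) vc) = Y h (- 1) (Y f (- 1) vc) + 2 \<cdot> Y f (- 2) vc"
    using r(1)[of "- 1" "- 1" vc] r(2)[of "- 1" "- 1" vc] by simp_all
  have four: "(4 * k + 8) \<cdot> x = (4 * k) \<cdot> x + 8 \<cdot> x" for x
    by (rule scale_left_distrib)
  note cr = creation(1) bilin he S_def scale_right_distrib scale_right_diff_distrib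
  have eS: "Y e (int n) S = (if n = 1 then (4 * (k + 2)) \<cdot> Y e (- 1) vc else 0)" for n
    using split[of n]
    by (elim disjE; simp add: cr e add_eq_0_iff; (simp add: numeral_scale four)?)
  have fS: "Y f (int n) S = (if n = 1 then (4 * (k + 2)) \<cdot> Y f (- 1) vc else 0)" for n
    using split[of n]
    by (elim disjE; simp add: cr f h add_eq_0_iff; (simp add: numeral_scale four)?)
  have hS: "Y h (int n) S = (if n = 1 then (4 * (k + 2)) \<cdot> Y h (- 1) vc else 0)" for n
    using split[of n]
    by (elim disjE; simp add: cr h e add_eq_0_iff; (simp add: numeral_scale four)?)
  have c: "4 * k + 8 \<noteq> 0" using k mult_cancel_left[of 4 "k + 2" 0] by (simp only: distrib_left) simp
  show "conf (sugawara k V e f h) 1 e" "conf (sugawara k V e f h) 1 f" "conf (sugawara k V e f h) 1 h"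
    by (rule conf_of_modes, use c in \<open>simp add: sug bilin eS fS hS creation(2)\<close>)+
qed

end

section \<open>Free fields\<close>

text \<open>Vectors killed by all products of \<open>n + 1\<close> operators from \<open>S\<close>;
  level 0 is the joint kernel, not the zero space.\<close>

primrec nilp :: "('a \<Rightarrow> 'a::ab_group_add) set \<Rightarrow> nat \<Rightarrow> 'a set" where
  "nilp S 0 = {w. \<forall>F\<in>S. F w = 0}"
| "nilp S (Suc n) = {w. \<forall>F\<in>S. F w \<in> nilp S n}"

context vector_space
begin

lemma nilp_subspace:
  assumes "\<And>F x y. F \<in> S \<Longrightarrow> F (x + y) = F x + F y" "\<And>F r x. F \<in> S \<Longrightarrow> F (scale r x) = scale r (F x)"
  shows "subspace (nilp S n)"
proof -
  have F0: "F 0 = 0" if "F \<in> S" for F using assms(2)[OF that, of 0 0] by simp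
  show ?thesis
  proof (induction n)
    case 0
    show ?case by (rule subspaceI) (auto simp: assms F0)
  next
    case (Suc n)
    show ?case
      by (rule subspaceI) (auto simp: assms F0 subspace_0[OF Suc] subspace_add[OF Suc] subspace_scale[OF Suc])
  qed
qed

lemma nilp_Suc_mono:
  assumes "\<And>F x y. F \<in> S \<Longrightarrow> F (x + y) = F x + F y" "\<And>F r x. F \<in> S \<Longrightarrow> F (scale r x) = scale r (F x)"
  shows "nilp S n \<subseteq> nilp S (Suc n)"
proof (induction n)
  case 0
  have "0 \<in> nilp S 0" using subspace_0[OF nilp_subspace[OF assms, of S 0]] by blast
  then show ?case by auto
next
  case (Suc n)
  then show ?case by auto
qed

lemma nilp_mono:
  assumes "\<And>F x y. F \<in> S \<Longrightarrow> F (x + y) = F x + F y" "\<And>F r x. F \<in> S \<Longrightarrow> F (scale r x) = scale r (F x)"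
    and "m \<le> n"
  shows "nilp S m \<subseteq> nilp S n"
  using lift_Suc_mono_le[of "nilp S", OF nilp_Suc_mono[OF assms(1,2)] assms(3)] by blast

lemma nilp_commute:
  assumes "\<And>F w. F \<in> S \<Longrightarrow> F (B w) = B (F w)" "B 0 = 0" "w \<in> nilp S n"
  shows "B w \<in> nilp S n"
  using assms(3) by (induction n arbitrary: w) (auto simp: assms(1,2))

text \<open>Meant for Heisenberg creation operators: moving \<open>B\<close> past a product of
  operators in \<open>S\<close> loses at most one of them, so one further factor suffices.\<close>

lemma nilp_scalar_commutator:
  assumes S: "\<And>F x y. F \<in> S \<Longrightarrow> F (x + y) = F x + F y" "\<And>F r x. F \<in> S \<Longrightarrow> F (scale r x) = scale r (F x)"
    and B: "\<And>F w. F \<in> S \<Longrightarrow> F (B w) = B (F w) + scale (r F) w" "B 0 = 0" and w: "w \<in> nilp S n"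
  shows "B w \<in> nilp S (Suc n)"
  using w
proof (induction n arbitrary: w)
  case 0
  then have *: "F w = 0" if "F \<in> S" for F using that by simp
  have "F (B w) = scale (r F) w" if "F \<in> S" for F using B(1)[OF that, of w] by (simp add: *[OF that] B(2))
  then have "Fa (F (B w)) = 0" if "F \<in> S" "Fa \<in> S" for F Fa
    unfolding \<open>\<And>F. F \<in> S \<Longrightarrow> F (B w) = scale (r F) w\<close>[OF that(1)] S(2)[OF that(2)] *[OF that(2)] by simp
  then show ?case by auto
next
  case (Suc n)
  have "scale (r F) w \<in> nilp S (Suc n)" for F
    using Suc.prems nilp_subspace[of S, OF S] subspace_scale by blast
  moreover have "B (F w) \<in> nilp S (Suc n)" if "F \<in> S" for F
    using Suc.prems that by (intro Suc.IH) auto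
  ultimately have "F (B w) \<in> nilp S (Suc n)" if "F \<in> S" for F
    using that nilp_subspace[of S, OF S] subspace_add B(1)[OF that] by metis
  then show ?case by simp
qed

end

context vertex_algebra
begin

lemma commute:
  assumes "\<And>n. Y a (int n) b = 0"
  shows "Y a m (Y b n c) = Y b n (Y a m c)"
  using commutator[of 0 a b m n c] assms by simp

lemma nilp_modes_subspace: "S \<subseteq> range (\<lambda>(a, n). Y a n) \<Longrightarrow> subspace (nilp S m)"
  by (rule nilp_subspace) (auto simp: bilin dest: subsetD)

lemma nilp_modes_mono: "S \<subseteq> range (\<lambda>(a, n). Y a n) \<Longrightarrow> i \<le> j \<Longrightarrow> nilp S i \<subseteq> nilp S j"
  by (rule nilp_mono) (auto simp: bilin dest: subsetD)

lemma last_nonzero_mode: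
  assumes "Y a (int i) w \<noteq> 0"
  obtains j where "Y a (int j) w \<noteq> 0" "j \<ge> i" "\<And>l. l > j \<Longrightarrow> Y a (int l) w = 0"
proof -
  obtain N where N: "\<And>j. j \<ge> N \<Longrightarrow> Y a (int j) w = 0" by (rule truncation1[of a w]) blast
  define A where "A = {j. Y a (int j) w \<noteq> 0}"
  have A: "finite A" "A \<noteq> {}"
    using N assms by (auto simp: A_def not_le[symmetric] intro!: finite_subset[of _ "{..<N}"])
  show ?thesis
    by (rule that[of "Max A"])
      (use Max_in[OF A] Max_ge[OF A(1)] assms in \<open>auto simp: A_def not_le[symmetric]\<close>)
qed

end

text \<open>\<open>C, D, X j, Om\<close> stand for \<open>1 \<otimes> c\<close>, \<open>1 \<otimes> d\<close>, \<open>1 \<otimes> e\<^bsup>jc\<^esup>\<close> and \<open>\<omega> \<otimes> 1\<close>.  The last assumption is the formula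
  for the central charge \<open>d\<^bsub>p,p'\<^esub>\<close> in terms of \<open>k + 2 = p'/p\<close>.\<close>

locale free_field = vertex_algebra V for V :: "'v::ab_group_add va" +
  fixes C D Om :: 'v and X :: "int \<Rightarrow> 'v" and k cc :: complex
  assumes C_C: "nprod V C (int n) C = 0"
    and D_D: "nprod V D (int n) D = 0"
    and C_D: "nprod V C (int n) D = (if n = 1 then smul V 2 (vac V) else 0)"
    and C_X: "nprod V C (int n) (X j) = 0"
    and D_X: "nprod V D (int n) (X j) = (if n = 0 then smul V (2 * of_int j) (X j) else 0)"
    and X_X: "nprod V (X i) (int n) (X j) = 0" "nprod V (X i) (- 1) (X j) = X (i + j)"
    and X_0: "X 0 = vac V"
    and X_tr: "nprod V (X j) (- 2) (vac V) = smul V (of_int j) (nprod V C (- 1) (X j))"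
    and Om_C: "nprod V Om (int n) C = 0"
    and Om_D: "nprod V Om (int n) D = 0"
    and Om_X: "nprod V Om (int n) (X j) = 0"
    and Om_Om: "nprod V Om (int n) Om = (if n = 0 then nprod V Om (- 2) (vac V)
       else if n = 1 then smul V 2 Om else if n = 3 then smul V (cc / 2) (vac V) else 0)"
    and central_charge: "(k + 2) * cc = (k + 2) - 6 * (k + 1)\<^sup>2"
begin

lemmas C_C_comm = commute[OF C_C] and D_D_comm = commute[OF D_D] and C_X_comm = commute[OF C_X]
  and X_X_comm = commute[OF X_X(1)] and Om_X_comm = commute[OF Om_X]

lemma C_D_comm: "Y C m (Y D n v) = Y D n (Y C m v) + (if m + n = 0 then (2 * of_int m) \<cdot> v else 0)"
proof -
  have two: "{..<2::nat} = {0, 1}" by auto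
  have "Y C m (Y D n v) - Y D n (Y C m v) = (if m + n = 0 then (2 * of_int m) \<cdot> v else 0)"
    by (subst commutator[of 2]) (auto simp: two C_D bilin vacuum mult.commute)
  then show ?thesis by (simp add: algebra_simps)
qed

lemma D_X_comm: "Y D m (Y (X j) n v) = Y (X j) n (Y D m v) + (2 * of_int j) \<cdot> Y (X j) (m + n) v"
proof -
  have one: "{..<1::nat} = {0}" by auto
  have "Y D m (Y (X j) n v) - Y (X j) n (Y D m v) = (2 * of_int j) \<cdot> Y (X j) (m + n) v"
    using D_X[of 0 j] by (subst commutator[of 1]) (auto simp: one D_X bilin)
  then show ?thesis by (simp add: algebra_simps)
qed

definition Cs where "Cs = {Y C (int i) | i. True}"
definition Ds where "Ds = {Y D (1 + int i) | i. True}"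

lemma Cs_modes: "Cs \<subseteq> range (\<lambda>(a, n). Y a n)" by (auto simp: Cs_def)
lemma Ds_modes: "Ds \<subseteq> range (\<lambda>(a, n). Y a n)" by (auto simp: Ds_def)

text \<open>Mode \<open>n\<close> of \<open>T e^c = c(-1) e^c\<close>. Since the modes of
  \<open>e^c\<close> from \<open>n\<close> upwards kill \<open>w\<close>, only the half of the
  normally ordered product with \<open>c(j)\<close> on the right remains.\<close>

lemma X1_rec:
  assumes "\<And>j. Y (X 1) (n + int j) w = 0" "\<And>j. j \<ge> N \<Longrightarrow> Y C (int j) w = 0"
  shows "- of_int n \<cdot> Y (X 1) (n - 1) w = (\<Sum>j<N. Y (X 1) (n - 1 - int j) (Y C (int j) w))"
proof -
  have "- of_int n \<cdot> Y (X 1) (n - 1) w = Y (Y C (- 1) (X 1)) n w"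
    using tr_nprod_left[of "X 1" n w] X_tr[of 1] by simp
  also have "\<dots> = (\<Sum>j<N. Y (X 1) (n - 1 - int j) (Y C (int j) w))"
    by (subst iterate_m1[of N]) (simp_all add: assms)
  finally show ?thesis .
qed

text \<open>When every \<open>c(j)\<close>, \<open>j >= 0\<close>, kills \<open>w\<close>, the
  recursion says \<open>-n e_(n-1) w = 0\<close>. Descending from the truncation bound it removes
  all modes down to index 0 and is blocked at \<open>n = 0\<close>, hence the special part of mode
  -1; below it the descent resumes.\<close>

lemma X1_C_lowest:
  assumes w: "w \<in> nilp Cs 0"
  shows "Y (X 1) (int n) w = 0" "Y (X 1) (- 1) w = 0 \<Longrightarrow> w = 0"
proof -
  have C0: "Y C (int j) w = 0" for j using w by (auto simp: Cs_def)
  have lower: "Y (X 1) (n - 1) w = 0" if "\<And>j. Y (X 1) (n + int j) w = 0" "n \<noteq> 0" for n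
    using X1_rec[of n w 0] that C0 by simp
  obtain N where N: "\<And>j. j \<ge> N \<Longrightarrow> Y (X 1) (int j) w = 0" by (rule truncation1[of "X 1" w]) blast
  have down: "Y (X 1) (int m + int j) w = 0" if "m \<le> N" for m j
    using that
  proof (induction m arbitrary: j rule: inc_induct)
    case base
    then show ?case using N[of "N + j"] by simp
  next
    case (step m)
    have "Y (X 1) (int (Suc m) - 1) w = 0" by (rule lower) (use step.IH in auto)
    then show ?case using step.IH[of "j - 1"] by (cases j) (auto simp: algebra_simps)
  qed
  show pos: "Y (X 1) (int n) w = 0" for n using down[of 0 n] by simp
  assume m1: "Y (X 1) (- 1) w = 0"
  have neg: "Y (X 1) (- 1 - int m + int j) w = 0" for m j
  proof (induction m arbitrary: j)
    case 0
    show ?case using m1 pos[of "j - 1"] by (cases j) auto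
  next
    case (Suc m)
    have "Y (X 1) (- 1 - int m - 1) w = 0" by (rule lower) (use Suc.IH in auto)
    then show ?case using Suc.IH[of "j - 1"] by (cases j) (auto simp: algebra_simps)
  qed
  have all: "Y (X 1) n w = 0" for n
    using pos[of "nat n"] neg[of "nat (- 1 - n)" 0] by (cases "n \<ge> 0") auto
  \<comment> \<open>\<open>e^c\<close> is invertible: \<open>e^(-c)_(-1) e^c = 1\<close>. A vector
    killed by all modes of \<open>e^c\<close> is thus killed by the vacuum mode that acts as the
    identity.\<close>
  have "w = Y vc (- 1) w" by (simp add: vacuum)
  also have "vc = Y (X (- 1)) (- 1) (X 1)" using X_X(2)[of "- 1" 1] X_0 by simp
  also have "Y (Y (X (- 1)) (- 1) (X 1)) (- 1) w \<in> {0}"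
  proof -
    obtain N where N: "\<And>j. j \<ge> N \<Longrightarrow> Y (X (- 1)) (int j) w = 0" by (rule truncation1[of "X (- 1)" w]) blast
    have "Y (X 1) m (Y (X (- 1)) n w) = 0" for m n by (subst X_X_comm) (simp add: all)
    then show ?thesis
      by (subst iterate_m1[of N]) (use N in \<open>simp_all add: all\<close>)
  qed
  finally show "w = 0" by simp
qed

text \<open>By induction each \<open>c(i) v\<close> is killed by all \<open>c(l)\<close>,
  \<open>l >= 0\<close>. If \<open>c(j) v\<close> is the last nonzero one, the recursion at
  \<open>n = j\<close> leaves only \<open>e_(-1) c(j) v = 0\<close>, and then
  \<open>c(j) v = 0\<close>.\<close>

lemma X1_nonneg_zero:
  assumes "v \<in> nilp Cs d" "\<And>n. Y (X 1) (int n) v = 0"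
  shows "v \<in> nilp Cs 0"
  using assms
proof (induction d arbitrary: v)
  case (Suc d)
  have Cv: "Y C (int i) v \<in> nilp Cs 0" for i
    using Suc.prems by (intro Suc.IH) (auto simp: Cs_def C_X_comm[symmetric])
  show ?case
  proof (rule ccontr)
    assume "v \<notin> nilp Cs 0"
    then obtain i where "Y C (int i) v \<noteq> 0" by (auto simp: Cs_def)
    then obtain j where j: "Y C (int j) v \<noteq> 0" "\<And>l. l > j \<Longrightarrow> Y C (int l) v = 0"
      by (rule last_nonzero_mode) blast
    have "Y (X 1) (int j + int i) v = 0" for i using Suc.prems(2)[of "j + i"] by simp
    then have "- of_int (int j) \<cdot> Y (X 1) (int j - 1) v =
       (\<Sum>i<Suc j. Y (X 1) (int j - 1 - int i) (Y C (int i) v))"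
      by (rule X1_rec) (use j in auto)
    also have "\<dots> = (\<Sum>i<j. Y (X 1) (int j - 1 - int i) (Y C (int i) v)) + Y (X 1) (- 1) (Y C (int j) v)"
      by simp
    also have "(\<Sum>i<j. Y (X 1) (int j - 1 - int i) (Y C (int i) v)) = 0"
    proof (rule sum.neutral, safe)
      fix i assume "i < j"
      then have "int j - 1 - int i = int (j - 1 - i)" by auto
      then show "Y (X 1) (int j - 1 - int i) (Y C (int i) v) = 0"
        using X1_C_lowest(1)[OF Cv] by metis
    qed
    also have "- of_int (int j) \<cdot> Y (X 1) (int j - 1) v = 0"
      using Suc.prems(2)[of "j - 1"] by (cases j) auto
    finally have "Y (X 1) (- 1) (Y C (int j) v) = 0" by simp
    then show False using X1_C_lowest(2)[OF Cv] j(1) by blast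
  qed
qed simp

lemma X1_stable_meets_lowest:
  assumes N: "\<And>n v. v \<in> N \<Longrightarrow> Y (X 1) n v \<in> N"
    and w: "w \<in> N" "w \<noteq> 0" "w \<in> nilp Cs d"
  shows "\<exists>v\<in>N. v \<noteq> 0 \<and> v \<in> nilp Cs 0"
  using w
proof (induction d arbitrary: w)
  case (Suc d)
  show ?case
  proof (cases "w \<in> nilp Cs 0")
    case False
    then obtain n where "Y (X 1) (int n) w \<noteq> 0" using X1_nonneg_zero[OF Suc.prems(3)] by blast
    then obtain j where j: "Y (X 1) (int j) w \<noteq> 0" "\<And>l. l > j \<Longrightarrow> Y (X 1) (int l) w = 0"
      by (rule last_nonzero_mode) blast
    obtain M where M: "\<And>j. j \<ge> M \<Longrightarrow> Y C (int j) w = 0" by (rule truncation1[of C w]) blast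
    have sub: "subspace (nilp Cs d)" by (rule nilp_modes_subspace[OF Cs_modes])
    have z: "Y (X 1) (int (Suc j) + int i) w = 0" for i using j(2)[of "Suc j + i"] by (simp add: algebra_simps)
    \<comment> \<open>For the last nonzero mode \<open>e_(j) w\<close>, the recursion at
      \<open>n = j + 1\<close> expresses it through the \<open>c(i) w\<close>, which have lower
      nilpotency level; modes of \<open>e\<close> keep that level because they commute with those of
      \<open>c\<close>.\<close>
    have "- of_int (int (Suc j)) \<cdot> Y (X 1) (int (Suc j) - 1) w =
       (\<Sum>i<M. Y (X 1) (int (Suc j) - 1 - int i) (Y C (int i) w))"
      by (rule X1_rec) (use z M in auto)
    also have "\<dots> \<in> nilp Cs d"
    proof (rule subspace_sum[OF sub])
      fix i
      have "Y C (int i) w \<in> nilp Cs d" using Suc.prems(3) by (auto simp: Cs_def)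
      then show "Y (X 1) (int (Suc j) - 1 - int i) (Y C (int i) w) \<in> nilp Cs d"
        by (rule nilp_commute[rotated 2]) (auto simp: Cs_def C_X_comm)
    qed
    finally have *: "- of_int (int (Suc j)) \<cdot> Y (X 1) (int j) w \<in> nilp Cs d" by simp
    have "(of_int (int (Suc j)) :: complex) \<noteq> 0" by (simp only: of_int_of_nat_eq of_nat_eq_0_iff)
    then have "Y (X 1) (int j) w = (- 1 / of_int (int (Suc j))) \<cdot> (- of_int (int (Suc j)) \<cdot> Y (X 1) (int j) w)"
      by (simp del: of_nat_Suc)
    then have "Y (X 1) (int j) w \<in> nilp Cs d" using subspace_scale[OF sub *] by metis
    then show ?thesis using Suc.IH[of "Y (X 1) (int j) w"] N Suc.prems(1) j(1) by blast
  qed (use Suc.prems in blast)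
qed blast

end

context vertex_algebra
begin

lemma ope_zero_sym:
  assumes "\<And>n. Y a (int n) b = 0"
  shows "Y b (int n) a = 0"
  using skew[of 0 a b "int n"] assms by (simp add: creation)

end

section \<open>Operator products of the summands of \<open>f\<close>, up to \<open>f_(3) f\<close>
  and \<open>f_(1) f\<close>\<close>

context free_field
begin

text \<open>The images of \<open>e, h, f\<close> are \<open>X 1\<close>, \<open>HH = 2 \<mu>\<close> and \<open>FF\<close>.\<close>

abbreviation psi where "psi \<equiv> X (- 1)"
abbreviation chi where "chi \<equiv> X (- 2)"

definition nu where "nu = (1 / 2) \<cdot> D - (k / 4) \<cdot> C"
definition HH where "HH = D + (k / 2) \<cdot> C"
definition sq where "sq = Y nu (- 1) (Y nu (- 1) psi)"
definition dn where "dn = Y nu (- 2) psi"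
definition GG where "GG = sq + (k + 1) \<cdot> dn"
definition Ompsi where "Ompsi = Y Om (- 1) psi"
definition FF where "FF = (k + 2) \<cdot> Ompsi - GG"

lemma D_C_comm: "Y D m (Y C n v) = Y C n (Y D m v) + (if m + n = 0 then (2 * of_int m) \<cdot> v else 0)"
  using C_D_comm[of n m v] by (auto simp: add_eq_0_iff)

lemma D_C: "Y D (int n) C = (if n = 1 then 2 \<cdot> vc else 0)"
  using D_C_comm[of "int n" "- 1" vc] by (auto simp: creation)

lemma nu_nu_comm:
  "Y nu m (Y nu n v) = Y nu n (Y nu m v) - (if m + n = 0 then (k / 2 * of_int m) \<cdot> v else 0)"
proof -
  have [simp]: "(k * of_int m / 2) \<cdot> v = (k * of_int m / 4) \<cdot> v + (k * of_int m / 4) \<cdot> v"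
    by (simp add: scale_left_distrib[symmetric])
  show ?thesis
    unfolding nu_def
    by (simp add: bilin D_D_comm[of m n] C_C_comm[of m n] C_D_comm[of m n] D_C_comm[of m n]
        scale_right_distrib scale_right_diff_distrib mult.commute)
qed

lemma nu_X_comm: "Y nu m (Y (X j) n v) = Y (X j) n (Y nu m v) + of_int j \<cdot> Y (X j) (m + n) v"
  unfolding nu_def
  by (simp add: bilin D_X_comm C_X_comm scale_right_distrib scale_right_diff_distrib)

lemma X_nu: "Y (X j) n (Y nu m v) = Y nu m (Y (X j) n v) - of_int j \<cdot> Y (X j) (n + m) v"
  using nu_X_comm[of m j n v] by (simp add: add.commute)

lemma nu_X: "Y nu (int n) (X j) = (if n = 0 then of_int j \<cdot> X j else 0)"
  unfolding nu_def using D_X[of n j] C_X[of n j] by (simp add: bilin)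

lemma Om_nu: "Y Om (int n) nu = 0"
  unfolding nu_def using Om_C Om_D by (simp add: bilin)

text \<open>The features common to \<open>e^(jc)\<close> and \<open>u \<otimes> e^(jc)\<close>; the
  action of the \<open>\<nu>\<close>-part of \<open>f\<close> is thereby computed once for
  both.\<close>

definition primary :: "complex \<Rightarrow> 'v \<Rightarrow> bool" where
  "primary a y \<longleftrightarrow> (\<forall>n::nat. Y nu (int n) y = (if n = 0 then a \<cdot> y else 0) \<and> Y psi (int n) y = 0)"

lemma beta_primary:
  assumes "primary a y"
  shows "Y (Y nu (- 1) psi) (int n) y = (if n = 0 then a \<cdot> Y psi (- 1) y else 0)"
proof -
  have p: "Y nu (int n) y = (if n = 0 then a \<cdot> y else 0)" "Y psi (int n) y = 0" for n
    using assms by (auto simp: primary_def)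
  have "Y (Y nu (- 1) psi) (int n) y = (\<Sum>j<1. Y nu (- 1 - int j) (Y psi (int n + int j) y)
      + Y psi (int n - 1 - int j) (Y nu (int j) y))"
    by (rule iterate_m1) (use p(2)[of "n + j" for j] p in auto)
  then show ?thesis using p(1)[of 0] p(2)[of n] p(2)[of "n - 1"]
    by (cases n) (auto simp: bilin)
qed

lemma sq_primary:
  assumes "primary a y"
  shows "Y sq (int (Suc n)) y = (if n = 0 then (a * a) \<cdot> Y psi (- 1) y else 0)"
proof -
  have p: "Y nu (int n) y = (if n = 0 then a \<cdot> y else 0)" "Y psi (int n) y = 0" for n
    using assms by (auto simp: primary_def)
  note b = beta_primary[OF assms]
  have z: "Y (Y nu (- 1) psi) (int (Suc n) + int j) y = 0" for j
    using b[of "Suc n + j"] by (simp add: algebra_simps)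
  have "Y sq (int (Suc n)) y = (\<Sum>j<1. Y nu (- 1 - int j) (Y (Y nu (- 1) psi) (int (Suc n) + int j) y)
      + Y (Y nu (- 1) psi) (int (Suc n) - 1 - int j) (Y nu (int j) y))"
    unfolding sq_def by (rule iterate_m1) (use z p in auto)
  then show ?thesis using p(1)[of 0] z[of 0] b[of n] by (simp add: bilin)
qed

lemma dn_primary:
  assumes "primary a y"
  shows "Y dn (int (Suc n)) y = (if n = 0 then (- a) \<cdot> Y psi (- 1) y else 0)"
proof -
  have p: "Y nu (int n) y = (if n = 0 then a \<cdot> y else 0)" "Y psi (int n) y = 0" for n
    using assms by (auto simp: primary_def)
  have z: "Y psi (int (Suc n) + int j) y = 0" for j
    using p(2)[of "Suc n + j"] by (simp add: algebra_simps)
  have "Y dn (int (Suc n)) y = (\<Sum>j<1. (of_nat j + 1) \<cdot> (Y nu (- 2 - int j) (Y psi (int (Suc n) + int j) y)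
      - Y psi (int (Suc n) - 2 - int j) (Y nu (int j) y)))"
    unfolding dn_def by (rule iterate_m2) (use z p in auto)
  then show ?thesis using p(1)[of 0] z[of 0] p(2)[of "n - 1"] by (cases n) (auto simp: bilin)
qed

text \<open>\<open>sq\<close> contributes \<open>a^2\<close> and \<open>(k + 1) dn\<close>
  contributes \<open>-(k + 1) a\<close>. At \<open>a = j\<close> this is, up to sign, the factor
  \<open>j (k + 1 - j)\<close>.\<close>

lemma GG_primary:
  assumes "primary a y"
  shows "Y GG (int (Suc n)) y = (if n = 0 then (a * (a - k - 1)) \<cdot> Y psi (- 1) y else 0)"
  using sq_primary[OF assms, of n] dn_primary[OF assms, of n]
  by (simp add: GG_def bilin scale_left_distrib[symmetric] del: of_nat_Suc) (simp add: algebra_simps)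

lemma primary_X: "primary (of_int j) (X j)"
  using nu_X X_X by (simp add: primary_def)

lemma psi_psi: "Y psi (- 1) psi = chi"
  using X_X(2)[of "- 1" "- 1"] by simp

lemma psi_sq: "Y psi n sq = Y nu (- 1) (Y nu (- 1) (Y psi n psi)) + 2 \<cdot> Y nu (- 1) (Y psi (n - 1) psi)
    + Y psi (n - 2) psi"
  unfolding sq_def by (simp add: X_nu bilin numeral_scale)

lemma psi_dn: "Y psi n dn = Y nu (- 2) (Y psi n psi) + Y psi (n - 2) psi"
  unfolding dn_def by (simp add: X_nu bilin)

lemma psi_psi0: "n \<ge> 0 \<Longrightarrow> Y psi n psi = 0"
  using X_X(1)[of "- 1" "nat n" "- 1"] by simp

lemma psi_GG: "Y psi (int (Suc n)) GG = (if n = 0 then (k + 2) \<cdot> chi else 0)"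
proof -
  have "k + 2 = 1 + (k + 1)" by simp
  then have "(k + 2) \<cdot> chi = chi + (k + 1) \<cdot> chi" by (simp only: scale_left_distrib scale_one)
  then show ?thesis
    using psi_psi0[of "int n - 1"]
    by (cases n) (simp_all add: GG_def bilin psi_sq psi_dn psi_psi0 psi_psi)
qed

lemma psi_beta: "Y psi 0 (Y nu (- 1) psi) = chi"
  by (simp add: X_nu psi_psi0 psi_psi)

lemma nu_ann: "n \<ge> 1 \<Longrightarrow> Y nu (int n) psi = 0" using nu_X[of n "- 1"] by simp

text \<open>\<open>\<nu>(0)\<close> measures the charge -1 of \<open>e^(-c)\<close>.
  \<open>\<nu>(1)\<close> contracts with either factor of \<open>\<nu>(-1)^2\<close>, each time with
  value \<open>-k/2\<close>; \<open>\<nu>(2)\<close> contracts with \<open>\<nu>(-2)\<close>, with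
  value \<open>-k\<close>, and \<open>dn\<close> carries the coefficient
  \<open>k + 1\<close>.\<close>

lemma nu_GG: "Y nu (int n) GG = (if n = 0 then - GG else if n = 1 then (- k) \<cdot> Y nu (- 1) psi
   else if n = 2 then (- k * (k + 1)) \<cdot> psi else 0)"
proof -
  have 0: "Y nu 0 psi = - psi" using nu_X[of 0 "- 1"] by simp
  have kk: "(k / 2) \<cdot> x + (k / 2) \<cdot> x = k \<cdot> x" for x by (simp add: scale_left_distrib[symmetric])
  have "n = 0 \<or> n = 1 \<or> n = 2 \<or> n \<ge> 3" by linarith
  then show ?thesis
    using nu_ann[of n]
    by (elim disjE; simp add: GG_def sq_def dn_def bilin nu_nu_comm[of 0] nu_nu_comm[of 1] nu_nu_comm[of 2]
        nu_nu_comm[of "int n"] 0 nu_ann[of 1, simplified] nu_ann[of 2, simplified]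
        scale_right_diff_distrib mult.commute; (simp add: kk algebra_simps)?)
qed

lemma lessThan_3: "{..<3::nat} = {0, 1, 2}" by auto

lemma dn_GG3: "Y dn 3 GG = (3 * k\<^sup>2 + 6 * k + 2) \<cdot> chi"
proof -
  have z: "Y psi (3 + int j) GG = 0" for j using psi_GG[of "2 + j"] by (simp add: algebra_simps)
  have "Y dn 3 GG = (\<Sum>j<3. (of_nat j + 1) \<cdot> (Y nu (- 2 - int j) (Y psi (3 + int j) GG)
      - Y psi (3 - 2 - int j) (Y nu (int j) GG)))"
    unfolding dn_def by (rule iterate_m2) (auto simp: z nu_GG)
  also have "\<dots> = (k + 2) \<cdot> chi + (2 * k) \<cdot> chi + (3 * (k * (k + 1))) \<cdot> chi"
    using psi_GG[of 0] nu_GG[of 0] nu_GG[of 1] nu_GG[of 2] z[of 0] z[of 1] z[of 2]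
    by (simp add: lessThan_3 bilin psi_beta psi_psi add.assoc)
  also have "\<dots> = (3 * k\<^sup>2 + 6 * k + 2) \<cdot> chi"
    unfolding scale_left_distrib[symmetric] by (simp add: algebra_simps power2_eq_square)
  finally show ?thesis .
qed

lemma beta_GG:
  "Y (Y nu (- 1) psi) (2 + int n) GG = (if n = 0 then (- (k\<^sup>2 + 3 * k + 2)) \<cdot> chi else 0)"
proof -
  have z: "Y psi (2 + int n + int j) GG = 0" for j using psi_GG[of "1 + n + j"] by (simp add: algebra_simps)
  have "Y (Y nu (- 1) psi) (2 + int n) GG = (\<Sum>j<3. Y nu (- 1 - int j) (Y psi (2 + int n + int j) GG)
      + Y psi (2 + int n - 1 - int j) (Y nu (int j) GG))"
    by (rule iterate_m1) (auto simp: z nu_GG)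
  also have "\<dots> = - Y psi (1 + int n) GG - k \<cdot> Y psi (int n) (Y nu (- 1) psi)
      - (k * (k + 1)) \<cdot> Y psi (int n - 1) psi"
  proof -
    have "Y nu 0 GG = - GG" "Y nu 1 GG = - (k \<cdot> Y nu (- 1) psi)" "Y nu 2 GG = - ((k * (k + 1)) \<cdot> psi)"
      using nu_GG[of 0] nu_GG[of 1] nu_GG[of 2] by simp_all
    then show ?thesis using z[of 0] z[of 1] z[of 2] by (simp add: lessThan_3 bilin)
  qed
  also have "\<dots> = (if n = 0 then (- (k\<^sup>2 + 3 * k + 2)) \<cdot> chi else 0)"
  proof (cases "n = 0")
    case True
    then have "- Y psi (1 + int n) GG - k \<cdot> Y psi (int n) (Y nu (- 1) psi)
      - (k * (k + 1)) \<cdot> Y psi (int n - 1) psi = - ((k + 2) \<cdot> chi) - k \<cdot> chi - (k * (k + 1)) \<cdot> chi"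
      using psi_GG[of 0] by (simp add: psi_beta psi_psi)
    also have "\<dots> = (- (k + 2) - k - k * (k + 1)) \<cdot> chi"
      by (simp only: scale_left_diff_distrib scale_minus_left)
    also have "- (k + 2) - k - k * (k + 1) = - (k\<^sup>2 + 3 * k + 2)"
      by (simp add: algebra_simps power2_eq_square)
    finally show ?thesis using True by simp
  next
    case False
    then show ?thesis using psi_GG[of n] psi_psi0[of "int n - 1"] psi_psi0[of "int n"]
      by (simp add: X_nu)
  qed
  finally show ?thesis .
qed

lemma beta_beta: "Y (Y nu (- 1) psi) 1 (Y nu (- 1) psi) = (- (1 + k / 2)) \<cdot> chi"
proof -
  have two: "{..<2::nat} = {0, 1}" by auto
  have z: "Y psi (1 + int j) (Y nu (- 1) psi) = 0" for j by (simp add: X_nu psi_psi0)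
  have n0: "Y nu 0 (Y nu (- 1) psi) = - Y nu (- 1) psi"
    using nu_nu_comm[of 0 "- 1" psi] nu_X[of 0 "- 1"] by (simp add: bilin)
  have n1: "Y nu 1 (Y nu (- 1) psi) = - ((k / 2) \<cdot> psi)"
    using nu_nu_comm[of 1 "- 1" psi] nu_X[of 1 "- 1"] by (simp add: bilin)
  have n2: "Y nu (int j) (Y nu (- 1) psi) = 0" if "j \<ge> 2" for j
    using that nu_nu_comm[of "int j" "- 1" psi] nu_X[of j "- 1"] by (simp add: bilin)
  have "Y (Y nu (- 1) psi) 1 (Y nu (- 1) psi) =
      (\<Sum>j<2. Y nu (- 1 - int j) (Y psi (1 + int j) (Y nu (- 1) psi))
      + Y psi (1 - 1 - int j) (Y nu (int j) (Y nu (- 1) psi)))"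
    by (rule iterate_m1) (auto simp: z n2)
  also have "\<dots> = - chi - (k / 2) \<cdot> chi"
    using z[of 0] z[of 1] by (simp add: two n0 n1 bilin psi_beta psi_psi)
  also have "\<dots> = (- (1 + k / 2)) \<cdot> chi" by (simp add: scale_left_distrib scale_left_diff_distrib)
  finally show ?thesis .
qed

lemma sq_GG3: "Y sq 3 GG = (5 / 2 * k\<^sup>2 + 5 * k + 2) \<cdot> chi"
proof -
  have z: "Y (Y nu (- 1) psi) (3 + int j) GG = 0" for j
    using beta_GG[of "1 + j"] by (simp add: algebra_simps)
  have b0: "Y (Y nu (- 1) psi) 0 psi = - chi"
    using beta_primary[OF primary_X[of "- 1"], of 0] by (simp add: psi_psi)
  have "Y sq 3 GG = (\<Sum>j<3. Y nu (- 1 - int j) (Y (Y nu (- 1) psi) (3 + int j) GG)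
      + Y (Y nu (- 1) psi) (3 - 1 - int j) (Y nu (int j) GG))"
    unfolding sq_def by (rule iterate_m1) (auto simp: z nu_GG)
  also have "\<dots> = (k\<^sup>2 + 3 * k + 2) \<cdot> chi + (k * (1 + k / 2)) \<cdot> chi + (k * (k + 1)) \<cdot> chi"
    using nu_GG[of 0] nu_GG[of 1] nu_GG[of 2] z[of 0] z[of 1] z[of 2] beta_GG[of 0]
    by (simp add: lessThan_3 bilin beta_beta b0 add.assoc del: minus_add_distrib)
  also have "\<dots> = (5 / 2 * k\<^sup>2 + 5 * k + 2) \<cdot> chi"
    unfolding scale_left_distrib[symmetric] by (simp add: algebra_simps power2_eq_square)
  finally show ?thesis .
qed

text \<open>Here the central charge is used: the cubic in \<open>k\<close> collected from
  \<open>sq\<close> and \<open>dn\<close> factors as \<open>-(k + 2)/2\<close> times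
  \<open>(k + 2) - 6 (k + 1)^2\<close>.\<close>

lemma GG_GG3: "Y GG 3 GG = (- ((k + 2)\<^sup>2 * (cc / 2))) \<cdot> chi"
proof -
  have "(k + 2)\<^sup>2 * (cc / 2) = (k + 2) / 2 * ((k + 2) - 6 * (k + 1)\<^sup>2)"
    unfolding central_charge[symmetric] by (simp add: power2_eq_square)
  also have "\<dots> = - ((5 / 2 * k\<^sup>2 + 5 * k + 2) + (k + 1) * (3 * k\<^sup>2 + 6 * k + 2))"
    by (simp add: field_simps power2_eq_square)
  finally have "- ((k + 2)\<^sup>2 * (cc / 2)) =
    (5 / 2 * k\<^sup>2 + 5 * k + 2) + (k + 1) * (3 * k\<^sup>2 + 6 * k + 2)"
    by (simp only: minus_minus)
  moreover have "Y GG 3 GG = Y sq 3 GG + (k + 1) \<cdot> Y dn 3 GG"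
    unfolding GG_def[THEN arg_cong[where f = "\<lambda>x. Y x 3 GG"]] by (simp add: bilin)
  ultimately show ?thesis
    by (simp only: sq_GG3 dn_GG3 scale_scale scale_left_distrib[symmetric])
qed

lemma Om_zero_prod:
  assumes "\<And>n. Y Om (int n) a = 0" "\<And>n. Y Om (int n) b = 0"
  shows "Y Om (int n) (Y a m b) = 0"
  using commute[of Om a "int n" m b] assms by simp

lemma Om_GG: "Y Om (int n) GG = 0"
  unfolding GG_def sq_def dn_def by (simp add: bilin Om_zero_prod Om_nu Om_X)

text \<open>\<open>\<omega>\<close> commutes with \<open>e^(-c)\<close>, so the products of
  \<open>\<omega>\<close> with itself are carried over to \<open>e^(-c)\<close>.\<close>

lemma Om_Ompsi: "Y Om (int n) Ompsi = (if n = 0 then Y Om (- 2) psi else if n = 1 then 2 \<cdot> Ompsi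
    else if n = 3 then (cc / 2) \<cdot> psi else 0)"
proof -
  have "Y Om (int n) Ompsi = Y Om (int n) Ompsi - Y Om (- 1) (Y Om (int n) psi)"
    by (simp add: Om_X)
  also have "\<dots> = (\<Sum>j<4. (of_int (int n) gchoose j) \<cdot> Y (Y Om (int j) Om) (int n + - 1 - int j) psi)"
    unfolding Ompsi_def by (rule commutator) (auto simp: Om_Om)
  also have "{..<4::nat} = {0, 1, 2, 3}" by auto
  also have "(\<Sum>j\<in>{0, 1, 2, 3}. (of_int (int n) gchoose j) \<cdot> Y (Y Om (int j) Om) (int n + - 1 - int j) psi)
     = Y (tr Om) (int n - 1) psi + (2 * of_nat n) \<cdot> Y Om (int n - 2) psi
       + ((of_nat n gchoose 3) * (cc / 2)) \<cdot> Y vc (int n - 4) psi"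
    using Om_Om[of 0] Om_Om[of 1] Om_Om[of 2] Om_Om[of 3] by (simp add: bilin mult.commute)
  also have "\<dots> = (if n = 0 then Y Om (- 2) psi else if n = 1 then 2 \<cdot> Ompsi
    else if n = 3 then (cc / 2) \<cdot> psi else 0)"
  proof -
    have z: "Y Om (int n - 2) psi = 0" if "n \<ge> 2"
      using that Om_X[of "n - 2" "- 1"] by simp
    have "n = 0 \<or> n = 1 \<or> n = 2 \<or> n = 3 \<or> n \<ge> 4" by linarith
    moreover have "(3 :: complex) gchoose 3 = 1" using binomial_gbinomial[of 3 3, where ?'a = complex] by simp
    ultimately show ?thesis using z
      by (elim disjE) (simp_all add: tr_nprod_left vacuum Ompsi_def)
  qed
  finally show ?thesis .
qed

lemma Ompsi_iterate:
  assumes "\<And>j. j \<ge> N \<Longrightarrow> Y psi (n + int j) w = 0" "\<And>j. j \<ge> N \<Longrightarrow> Y Om (int j) w = 0"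
  shows "Y Ompsi n w = (\<Sum>j<N. Y Om (- 1 - int j) (Y psi (n + int j) w) + Y psi (n - 1 - int j) (Y Om (int j) w))"
  unfolding Ompsi_def by (rule iterate_m1) (use assms in auto)

lemma lessThan_4: "{..<4::nat} = {0, 1, 2, 3}" by auto

lemma psi_Ompsi: "n \<ge> 0 \<Longrightarrow> Y psi n Ompsi = 0"
  unfolding Ompsi_def by (simp add: Om_X_comm[symmetric] psi_psi0)

lemma Ompsi_Ompsi3: "Y Ompsi 3 Ompsi = (cc / 2) \<cdot> chi"
proof -
  have "Y Ompsi 3 Ompsi = (\<Sum>j<4. Y Om (- 1 - int j) (Y psi (3 + int j) Ompsi)
      + Y psi (3 - 1 - int j) (Y Om (int j) Ompsi))"
    by (rule Ompsi_iterate) (auto simp: psi_Ompsi Om_Ompsi)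
  also have "\<dots> = Y psi 2 (Y Om (- 2) psi) + (cc / 2) \<cdot> chi"
    using Om_Ompsi[of 0] Om_Ompsi[of 1] Om_Ompsi[of 2] Om_Ompsi[of 3]
    by (simp add: lessThan_4 psi_Ompsi bilin psi_psi)
  also have "Y psi 2 (Y Om (- 2) psi) = 0" by (simp add: Om_X_comm[symmetric] psi_psi0)
  finally show ?thesis by simp
qed

lemma Ompsi_Ompsi1: "Y Ompsi 1 Ompsi = 2 \<cdot> Y Om (- 1) chi + (cc / 2) \<cdot> Y psi (- 3) psi"
proof -
  have "Y Ompsi 1 Ompsi = (\<Sum>j<4. Y Om (- 1 - int j) (Y psi (1 + int j) Ompsi)
      + Y psi (1 - 1 - int j) (Y Om (int j) Ompsi))"
    by (rule Ompsi_iterate) (auto simp: psi_Ompsi Om_Ompsi)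
  also have "\<dots> = Y psi 0 (Y Om (- 2) psi) + 2 \<cdot> Y psi (- 1) Ompsi + (cc / 2) \<cdot> Y psi (- 3) psi"
    using Om_Ompsi[of 0] Om_Ompsi[of 1] Om_Ompsi[of 2] Om_Ompsi[of 3]
    by (simp add: lessThan_4 psi_Ompsi bilin psi_psi)
  also have "Y psi 0 (Y Om (- 2) psi) = 0" by (simp add: Om_X_comm[symmetric] psi_psi0)
  also have "Y psi (- 1) Ompsi = Y Om (- 1) chi"
    unfolding Ompsi_def by (simp add: Om_X_comm[symmetric] psi_psi)
  finally show ?thesis by simp
qed

lemma Ompsi_GG: "Y Ompsi (int (Suc n)) GG = (if n = 0 then (k + 2) \<cdot> Y Om (- 1) chi else 0)"
proof -
  have z: "Y psi (int (Suc n) + int (Suc j)) GG = 0" for j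
    using psi_GG[of "Suc (n + j)"] by (simp add: algebra_simps)
  have "Y Ompsi (int (Suc n)) GG = (\<Sum>j<1. Y Om (- 1 - int j) (Y psi (int (Suc n) + int j) GG)
      + Y psi (int (Suc n) - 1 - int j) (Y Om (int j) GG))"
  proof (rule Ompsi_iterate)
    fix j :: nat assume "1 \<le> j"
    then show "Y psi (int (Suc n) + int j) GG = 0" using z[of "j - 1"] by simp
  qed (simp add: Om_GG)
  then show ?thesis using psi_GG[of n] Om_GG[of 0] by (simp add: bilin)
qed

lemma GG_Ompsi: "Y GG (int (Suc n)) Ompsi = (if n = 0 then (k + 2) \<cdot> Y Om (- 1) chi else 0)"
  using GG_primary[OF primary_X[of "- 1"], of n]
  by (simp add: Ompsi_def commute[OF Om_GG, symmetric] bilin psi_psi del: of_nat_Suc)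

text \<open>The mixed products have no pole of this order, and the anomaly
  \<open>(k + 2)^2 cc / 2\<close> of the Virasoro part is cancelled by \<open>GG\<close> with
  itself.\<close>

lemma FF_FF3: "Y FF 3 FF = 0"
proof -
  have "Y Ompsi 3 GG = 0" "Y GG 3 Ompsi = 0"
    using Ompsi_GG[of 2] GG_Ompsi[of 2] by simp_all
  then show ?thesis
    by (simp add: FF_def bilin Ompsi_Ompsi3 GG_GG3 power2_eq_square mult.assoc
        scale_left_distrib[symmetric])
qed

text \<open>The Virasoro part contributes \<open>2 (k + 2)^2 \<omega>_(-1) e^(-2c)\<close> and each
  of the two mixed products \<open>-(k + 2)^2 \<omega>_(-1) e^(-2c)\<close>. After this cancellation
  \<open>f_(1) f\<close> contains no \<open>\<omega>\<close>, and \<open>L(0)\<close> kills it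
  without \<open>GG_(1) GG\<close> being computed.\<close>

lemma Om_FF_FF1: "Y Om 1 (Y FF 1 FF) = 0"
proof -
  have 1: "Y Ompsi 1 GG = (k + 2) \<cdot> Y Om (- 1) chi" "Y GG 1 Ompsi = (k + 2) \<cdot> Y Om (- 1) chi"
    using Ompsi_GG[of 0] GG_Ompsi[of 0] by simp_all
  have 2: "((k + 2) * ((k + 2) * 2)) \<cdot> x = ((k + 2) * (k + 2)) \<cdot> x + ((k + 2) * (k + 2)) \<cdot> x" for x
    unfolding scale_left_distrib[symmetric] by (simp add: algebra_simps)
  have "Y FF 1 FF = ((k + 2) * ((k + 2) * (cc / 2))) \<cdot> Y psi (- 3) psi + Y GG 1 GG"
    unfolding FF_def bilin Ompsi_Ompsi1 1
    by (simp only: scale_right_distrib scale_right_diff_distrib scale_scale 2 mult.assoc) simp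
  then show ?thesis
    using Om_zero_prod[of psi psi 1 "- 3"] Om_zero_prod[of GG GG 1 1] Om_X Om_GG by (simp add: bilin)
qed

end

section \<open>The remaining affine relations, and weights on the free-field side\<close>

context free_field
begin

lemma HH_modes: "Y HH n v = Y D n v + (k / 2) \<cdot> Y C n v"
  by (simp add: HH_def bilin)

lemma HH_nu_comm: "Y HH m (Y nu n v) = Y nu n (Y HH m v)"
proof -
  have "(k * of_int m / 2) \<cdot> v - (k / 2) \<cdot> ((2 * of_int m) \<cdot> v) + (k * of_int m / 2) \<cdot> v = 0"
    unfolding scale_scale scale_left_distrib[symmetric] scale_left_diff_distrib[symmetric] by simp
  then show ?thesis
    by (simp add: HH_modes nu_def bilin D_D_comm[of m n] C_C_comm[of m n] C_D_comm[of m n] D_C_comm[of m n]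
        scale_right_distrib scale_right_diff_distrib mult.commute)
qed

lemma HH_X: "Y HH (int n) (X j) = (if n = 0 then (2 * of_int j) \<cdot> X j else 0)"
  using D_X[of n j] C_X[of n j] by (simp add: HH_modes)

lemma HH_HH: "Y HH (int n) HH = (if n = 1 then (2 * k) \<cdot> vc else 0)"
  using C_C[of n] D_D[of n] C_D[of n] D_C[of n]
  by (cases "n = 1")
    (simp_all add: HH_modes, simp_all add: HH_def bilin scale_left_distrib[symmetric])

lemma Om_HH: "Y Om (int n) HH = 0"
  using Om_C[of n] Om_D[of n] by (simp add: HH_def bilin)

lemma HH_FF: "Y HH (int n) FF = (if n = 0 then (- 2) \<cdot> FF else 0)"
proof -
  have psi: "Y HH (int n) psi = (if n = 0 then (- 2) \<cdot> psi else 0)" for n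
    using HH_X[of n "- 1"] by simp
  have 1: "Y HH (int n) Ompsi = (if n = 0 then (- 2) \<cdot> Ompsi else 0)"
    unfolding Ompsi_def commute[OF ope_zero_sym[OF Om_HH]] by (simp add: psi bilin)
  have 2: "Y HH (int n) sq = (if n = 0 then (- 2) \<cdot> sq else 0)"
    unfolding sq_def by (simp add: HH_nu_comm psi bilin)
  have 3: "Y HH (int n) dn = (if n = 0 then (- 2) \<cdot> dn else 0)"
    unfolding dn_def by (simp add: HH_nu_comm psi bilin)
  have "(k + 2) \<cdot> (- 2) \<cdot> Ompsi - ((- 2) \<cdot> sq + (k + 1) \<cdot> (- 2) \<cdot> dn) = (- 2) \<cdot> FF"
    unfolding FF_def GG_def scale_right_diff_distrib scale_right_distrib
    by (simp only: scale_left_commute[of "- 2"])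
  then show ?thesis
    by (simp only: FF_def[THEN arg_cong[where f = "Y HH (int n)"]] GG_def bilin 1 2 3) auto
qed

text \<open>The first coefficients of \<open>exp (c(-1) z + c(-2) z^2 / 2 + ...)\<close>, obtained
  from \<open>T e^c = c(-1) e^c\<close>.\<close>

lemma X1_psi: "Y (X 1) (int n) psi = 0" "Y (X 1) (- 1) psi = vc" "Y (X 1) (- 2) psi = C"
  "2 \<cdot> Y (X 1) (- 3) psi = Y C (- 2) vc + Y C (- 1) C"
proof -
  show 0: "Y (X 1) (int n) psi = 0" for n using X_X(1) .
  show 1: "Y (X 1) (- 1) psi = vc" using X_X(2)[of 1 "- 1"] X_0 by simp
  have tr: "tr (X 1) = Y C (- 1) (X 1)" using X_tr[of 1] by simp
  have z: "Y (X 1) (int j - 1) psi = 0" if "j \<ge> 1" for j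
    using 0[of "j - 1"] that by (cases j) auto
  have z': "Y (X 1) (int j - 2) psi = 0" if "j \<ge> 2" for j
    using 0[of "j - 2"] that le_Suc_ex[of 2 j] by auto
  have "Y (X 1) (- 2) psi = Y (tr (X 1)) (- 1) psi" by (simp add: tr_nprod_left)
  also have "\<dots> = (\<Sum>j<1. Y C (- 1 - int j) (Y (X 1) (- 1 + int j) psi) + Y (X 1) (- 1 - 1 - int j) (Y C (int j) psi))"
    unfolding tr by (rule iterate_m1) (auto simp: z C_X)
  finally show 2: "Y (X 1) (- 2) psi = C" using C_X[of 0 "- 1"] by (simp add: 1 creation)
  have two: "{..<2::nat} = {0, 1}" by auto
  have "2 \<cdot> Y (X 1) (- 3) psi = Y (tr (X 1)) (- 2) psi" by (simp add: tr_nprod_left)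
  also have "\<dots> = (\<Sum>j<2. Y C (- 1 - int j) (Y (X 1) (- 2 + int j) psi) + Y (X 1) (- 2 - 1 - int j) (Y C (int j) psi))"
    unfolding tr by (rule iterate_m1) (auto simp: z' C_X)
  finally show "2 \<cdot> Y (X 1) (- 3) psi = Y C (- 2) vc + Y C (- 1) C"
    using C_X[of 0 "- 1"] C_X[of 1 "- 1"] by (simp add: 1 2 two creation add.commute)
qed

lemma X1_sq: "Y (X 1) n sq = Y nu (- 1) (Y nu (- 1) (Y (X 1) n psi))
    - 2 \<cdot> Y nu (- 1) (Y (X 1) (n - 1) psi) + Y (X 1) (n - 2) psi"
  unfolding sq_def by (simp add: X_nu bilin numeral_scale)

lemma X1_dn: "Y (X 1) n dn = Y nu (- 2) (Y (X 1) n psi) - Y (X 1) (n - 2) psi"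
  unfolding dn_def by (simp add: X_nu bilin)

lemma X1_Ompsi: "Y (X 1) n Ompsi = Y Om (- 1) (Y (X 1) n psi)"
  unfolding Ompsi_def by (simp add: Om_X_comm)

lemma X1_FF: "Y (X 1) (int n) FF = (if n = 0 then HH else if n = 1 then k \<cdot> vc else 0)"
proof -
  have e: "Y (X 1) m FF = (k + 2) \<cdot> Y (X 1) m Ompsi - Y (X 1) m sq - (k + 1) \<cdot> Y (X 1) m dn" for m
    by (simp add: FF_def GG_def bilin diff_diff_eq)
  have p: "m \<ge> 0 \<Longrightarrow> Y (X 1) m psi = 0" for m using X1_psi(1)[of "nat m"] by simp
  \<comment> \<open>The shape in which \<open>e_(0) f\<close> arises: \<open>2 \<nu> - c\<close>
    from \<open>-sq\<close> and \<open>(k + 1) c\<close> from \<open>-(k + 1) dn\<close>. Their sum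
    \<open>2 \<nu> + k c\<close> is \<open>2 \<mu>\<close>.\<close>
  have H: "HH = 2 \<cdot> nu - C + (k + 1) \<cdot> C"
  proof -
    have "(k / 2) \<cdot> C = k \<cdot> C - (k / 2) \<cdot> C" unfolding scale_left_diff_distrib[symmetric] by simp
    moreover have "2 \<cdot> nu = D - (k / 2) \<cdot> C" by (simp add: nu_def scale_right_diff_distrib)
    ultimately show ?thesis unfolding HH_def by (simp add: scale_left_distrib)
  qed
  have split: "n = 0 \<or> n = 1 \<or> n \<ge> 2" by linarith
  then show ?thesis
    by (elim disjE) (simp_all add: e X1_Ompsi X1_sq X1_dn p X1_psi(2,3) H creation scale_left_distrib)
qed

lemma affine_of_FF:
  assumes "\<And>n. Y FF (int n) FF = 0"
  shows "affine_sl2_relations k V (X 1) FF HH"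
  by (rule affineI) (use HH_X[of _ 1] HH_FF X1_FF HH_HH X_X assms in auto)

text \<open>Together with \<open>Om\<close> this is a conformal vector for which \<open>e\<^bsup>jc\<^esup>\<close> has weight \<open>0\<close>.\<close>

definition A0 where "A0 = (1 / 2) \<cdot> Y C (- 1) D"

lemma conf_A0: "conf A0 1 C" "conf A0 1 D" "conf A0 0 (X j)"
proof -
  have C: "Y C (int n) A0 = (if n = 1 then C else 0)" for n
    using C_D[of n] C_C_comm[of "int n" "- 1" D] by (simp add: A0_def bilin creation)
  show "conf A0 1 C" by (rule conf_of_modes) (rule C)
  have D: "Y D (int n) A0 = (if n = 1 then D else 0)" for n
    using D_D[of n] D_C_comm[of "int n" "- 1" D] by (simp add: A0_def bilin)
  show "conf A0 1 D" by (rule conf_of_modes) (rule D)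
  have "Y (Y C (- 1) D) (int n) (X j) =
    (\<Sum>i<1. Y C (- 1 - int i) (Y D (int n + int i) (X j)) + Y D (int n - 1 - int i) (Y C (int i) (X j)))" for n
  proof (rule iterate_m1)
    fix i :: nat assume "1 \<le> i"
    then show "Y D (int n + int i) (X j) = 0" using D_X[of "n + i" j] by simp
  qed (simp add: C_X)
  then have "Y A0 (int n) (X j) = (if n = 0 then tr (X j) else 0)" for n
    using C_X[of 0 j] D_X[of n j] by (simp add: A0_def bilin X_tr)
  from this[of 0] this[of 1] show "conf A0 0 (X j)" by (simp add: conf_def)
qed

text \<open>\<open>e^(-c)\<close> has weight 0, and each of \<open>\<omega>_(-1)\<close>,
  \<open>\<nu>(-1)^2\<close>, \<open>\<nu>(-2)\<close> adds 2.\<close>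

lemma conf_FF: "conf (Om + A0) 2 FF"
proof -
  have O_C: "Y C (int n) Om = 0" and O_D: "Y D (int n) Om = 0" for n
    using ope_zero_sym Om_C Om_D by blast+
  have A_Om: "Y A0 (int n) Om = 0" for n
  proof -
    have "Y Om (int n) A0 = 0" for n
      unfolding A0_def by (simp add: bilin Om_zero_prod Om_C Om_D)
    then show ?thesis by (rule ope_zero_sym)
  qed
  have C: "conf (Om + A0) 1 C" and D: "conf (Om + A0) 1 D" and X: "conf (Om + A0) 0 (X j)" for j
    using conf_A0(1,2) conf_A0(3)[of j] Om_C[of 0] Om_C[of 1] Om_D[of 0] Om_D[of 1] Om_X[of 0 j] Om_X[of 1 j]
    by (auto simp: conf_def bilin)
  have Om: "conf (Om + A0) 2 Om"
    using Om_Om[of 0] Om_Om[of 1] A_Om[of 0] A_Om[of 1] by (simp add: conf_def bilin)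
  have nu: "conf (Om + A0) 1 nu" unfolding nu_def by (intro conf_diff conf_smul C D)
  have "conf (Om + A0) 2 Ompsi" using conf_nprod[OF Om X[of "- 1"], of "- 1"] by (simp add: Ompsi_def)
  moreover have "conf (Om + A0) 2 sq"
    using conf_nprod[OF nu conf_nprod[OF nu X[of "- 1"], of "- 1"], of "- 1"] by (simp add: sq_def)
  moreover have "conf (Om + A0) 2 dn" using conf_nprod[OF nu X[of "- 1"], of "- 2"] by (simp add: dn_def)
  ultimately show ?thesis unfolding FF_def GG_def by (intro conf_diff conf_add conf_smul)
qed

end

context vector_space
begin

lemma eigen_component_indexed:
  assumes "finite I" "inj_on e I" and N: "subspace N"
    and add: "\<And>x y. A (x + y) = A x + A y" and scl: "\<And>r x. A (scale r x) = scale r (A x)"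
    and AN: "\<And>x. x \<in> N \<Longrightarrow> A x \<in> N"
    and eig: "\<And>i. i \<in> I \<Longrightarrow> A (v i) = scale (e i) (v i)"
    and sum: "(\<Sum>i\<in>I. v i) \<in> N" and i: "i \<in> I"
  shows "v i \<in> N"
proof -
  have "(\<Sum>s\<in>e ` I. v (inv_into I e s)) = (\<Sum>i\<in>I. v i)"
    unfolding sum.reindex[OF assms(2)] using assms(2) by (intro sum.cong) auto
  then have "v (inv_into I e (e i)) \<in> N"
    by (intro eigen_component[of "e ` I" N A "\<lambda>s. v (inv_into I e s)"])
      (use assms in \<open>auto simp: inv_into_f_f\<close>)
  then show ?thesis using assms(2) i by simp
qed

text \<open>Moving \<open>w\<close> into the term \<open>i0\<close> gives a vanishing sum of
  eigenvectors with distinct eigenvalues, so \<open>v i0 - w = 0\<close>.\<close>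

lemma eigen_unique_component:
  assumes I: "finite I" "inj_on e I" "i0 \<in> I"
    and add: "\<And>x y. A (x + y) = A x + A y" and scl: "\<And>r x. A (scale r x) = scale r (A x)"
    and eig: "\<And>i. i \<in> I \<Longrightarrow> A (v i) = scale (e i) (v i)"
    and w: "w = (\<Sum>i\<in>I. v i)" "A w = scale (e i0) w"
  shows "w = v i0"
proof -
  define v' where "v' i = (if i = i0 then v i - w else v i)" for i
  have A_diff: "A (x - y) = A x - A y" for x y
    using add[of x "scale (- 1) y"] scl[of "- 1" y] by simp
  have "(\<Sum>i\<in>I. v' i) = v' i0 + (\<Sum>i\<in>I - {i0}. v' i)" using I by (simp add: sum.remove)
  also have "(\<Sum>i\<in>I - {i0}. v' i) = (\<Sum>i\<in>I - {i0}. v i)" by (rule sum.cong) (auto simp: v'_def)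
  also have "v' i0 + \<dots> = 0" using I by (simp add: v'_def w(1) sum.remove[of I i0 v])
  finally have "v' i0 \<in> {0}"
    by (intro eigen_component_indexed[of I e "{0}" A v'])
      (use I add scl eig w(2) in \<open>auto simp: v'_def A_diff scale_right_diff_distrib subspace_def\<close>,
       use scl[of 0 0] in simp)
  then show ?thesis by (simp add: v'_def)
qed

lemma eigen_kernel:
  assumes "x \<in> span B" and add: "\<And>x y. A (x + y) = A x + A y"
    and scl: "\<And>r x. A (scale r x) = scale r (A x)"
    and B: "\<And>b. b \<in> B \<Longrightarrow> A b = scale (E b) b" and x: "A x = scale a x"
  shows "x \<in> span {b \<in> B. E b = a}"
proof -
  obtain S v where S: "finite S" "S \<subseteq> E ` B" "x = (\<Sum>s\<in>S. v s)"
    "\<And>s. s \<in> S \<Longrightarrow> A (v s) = scale s (v s)"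
    "\<And>s. s \<in> S \<Longrightarrow> v s \<in> span {b \<in> B. E b = s}"
    by (rule eigen_decomposition[of x B A E]) (use assms in auto)
  define v' where "v' s = (if s \<in> S then v s else 0)" for s
  have A0: "A 0 = 0" using scl[of 0 0] by simp
  have "x = v' a"
    by (rule eigen_unique_component[of "insert a S" "\<lambda>s. s" a A v'])
      (use S add scl x A0 in \<open>auto simp: v'_def sum.insert_if intro!: sum.cong\<close>)
  then show ?thesis using S(5)[of a] span_zero by (auto simp: v'_def split: if_splits)
qed

end

section \<open>Subspaces stable under affine \<open>sl(2)\<close>\<close>

text \<open>Mode \<open>2 + n\<close> of the conformal vector is \<open>L(1 + n)\<close>.\<close>

definition positive_modes :: "'v::ab_group_add va \<Rightarrow> 'v \<Rightarrow> ('v \<Rightarrow> 'v) set" where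
  "positive_modes V w = {nprod V w (2 + int n) | n. True}"

text \<open>\<open>\<tau> j u\<close> stands for \<open>u \<otimes> e\<^bsup>jc\<^esup>\<close>.\<close>

locale free_field_module = free_field V C D Om X k cc + L: vertex_algebra L
  for V :: "'v::ab_group_add va" and C D Om X k cc and L :: "'l::ab_group_add va" +
  fixes \<omega> :: 'l and \<tau> :: "int \<Rightarrow> 'l \<Rightarrow> 'v"
  assumes \<tau>_add: "\<tau> j (u + u') = \<tau> j u + \<tau> j u'"
    and \<tau>_scale: "\<tau> j (smul L r u) = smul V r (\<tau> j u)"
    and \<tau>_inj: "\<tau> j u = 0 \<Longrightarrow> u = 0"
    and C_\<tau>: "nprod V C (int n) (\<tau> j u) = 0"
    and D_\<tau>: "nprod V D (int n) (\<tau> j u) = (if n = 0 then smul V (2 * of_int j) (\<tau> j u) else 0)"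
    and X_\<tau>: "nprod V (X i) (int n) (\<tau> j u) = 0" "nprod V (X i) (- 1) (\<tau> j u) = \<tau> (i + j) u"
    and Om_\<tau>: "nprod V Om m (\<tau> j u) = \<tau> j (nprod L \<omega> m u)"
    and X_vac: "X j = \<tau> j (vac L)"
    and exhaustive: "\<lbrakk>module.subspace (smul V) N; \<And>j u. \<tau> j u \<in> N;
       \<And>n v. v \<in> N \<Longrightarrow> nprod V C (- 1 - int n) v \<in> N;
       \<And>n v. v \<in> N \<Longrightarrow> nprod V D (- 1 - int n) v \<in> N\<rbrakk> \<Longrightarrow> w \<in> N"
    and L_spectrum: "nprod L \<omega> 1 u = smul L s u \<Longrightarrow> u \<noteq> 0 \<Longrightarrow> \<exists>m::nat. s = of_nat m"
    and L_nilp: "\<exists>d. u \<in> nilp (positive_modes L \<omega>) d"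
    and L_singular: "u \<in> nilp (positive_modes L \<omega>) 0 \<Longrightarrow> \<exists>r. u = smul L r (vac L)"
begin

lemma \<tau>_zero [simp]: "\<tau> j 0 = 0"
  using \<tau>_scale[of j 0 0] by simp

lemma \<tau>_diff: "\<tau> j (u - u') = \<tau> j u - \<tau> j u'"
  using \<tau>_add[of j "u - u'" u'] by simp

lemma HH_\<tau>: "Y HH (int n) (\<tau> j u) = (if n = 0 then (2 * of_int j) \<cdot> \<tau> j u else 0)"
  by (simp add: HH_modes C_\<tau> D_\<tau>)

text \<open>All vectors arise from the \<open>\<tau> j u\<close> by creation modes of
  \<open>C\<close> and \<open>D\<close>; each such mode has scalar commutators with \<open>S\<close>
  and raises the level by at most one.\<close>

lemma nilp_exhaustive:
  assumes S: "S \<subseteq> range (\<lambda>(a, n). Y a n)" and \<tau>: "\<And>j u. \<tau> j u \<in> nilp S 0"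
    and comm: "\<And>F a n. F \<in> S \<Longrightarrow> a \<in> {C, D} \<Longrightarrow>
      \<exists>r. \<forall>w. F (Y a (- 1 - int n) w) = Y a (- 1 - int n) (F w) + r \<cdot> w"
  shows "\<exists>d. v \<in> nilp S d"
proof -
  note sub = nilp_modes_subspace[OF S]
  have lin: "F (x + y) = F x + F y" "F (r \<cdot> x) = r \<cdot> F x" if "F \<in> S" for F x y r
    using that S by (auto simp: bilin)
  have step: "Y a (- 1 - int n) v \<in> {v. \<exists>d. v \<in> nilp S d}"
    if "v \<in> {v. \<exists>d. v \<in> nilp S d}" "a \<in> {C, D}" for a n v
  proof -
    from that obtain d where d: "v \<in> nilp S d" by auto
    have "\<forall>F\<in>S. \<exists>r. \<forall>w. F (Y a (- 1 - int n) w) = Y a (- 1 - int n) (F w) + r \<cdot> w"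
      using comm[OF _ that(2)] by blast
    from bchoice[OF this] obtain r where
      r: "\<And>F w. F \<in> S \<Longrightarrow> F (Y a (- 1 - int n) w) = Y a (- 1 - int n) (F w) + r F \<cdot> w" by blast
    have "Y a (- 1 - int n) v \<in> nilp S (Suc d)"
      by (rule nilp_scalar_commutator[OF lin r _ d]) simp_all
    then show ?thesis by blast
  qed
  have "v \<in> {v. \<exists>d. v \<in> nilp S d}"
  proof (rule exhaustive)
    show "subspace {v. \<exists>d. v \<in> nilp S d}"
    proof (rule subspaceI)
      show "0 \<in> {v. \<exists>d. v \<in> nilp S d}" using subspace_0[OF sub] by blast
      fix x y assume "x \<in> {v. \<exists>d. v \<in> nilp S d}" "y \<in> {v. \<exists>d. v \<in> nilp S d}"
      then obtain d1 d2 where "x \<in> nilp S d1" "y \<in> nilp S d2" by auto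
      then have "x \<in> nilp S (d1 + d2)" "y \<in> nilp S (d1 + d2)"
        using nilp_modes_mono[OF S, of d1 "d1 + d2"] nilp_modes_mono[OF S, of d2 "d1 + d2"] by auto
      then show "x + y \<in> {v. \<exists>d. v \<in> nilp S d}" using subspace_add[OF sub] by blast
    next
      fix r x assume "x \<in> {v. \<exists>d. v \<in> nilp S d}"
      then show "r \<cdot> x \<in> {v. \<exists>d. v \<in> nilp S d}" using subspace_scale[OF sub] by blast
    qed
    show "\<tau> j u \<in> {v. \<exists>d. v \<in> nilp S d}" for j u using \<tau> by blast
  qed (rule step; simp)+
  then show ?thesis by simp
qed

lemma \<tau>_lowest: "\<tau> j u \<in> nilp Cs 0" "\<tau> j u \<in> nilp Ds 0"
  using D_\<tau>[of "Suc n" j u for n] by (auto simp: Cs_def Ds_def C_\<tau>)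

lemma C_nilp: "\<exists>d. v \<in> nilp Cs d"
proof (rule nilp_exhaustive[OF Cs_modes \<tau>_lowest(1)])
  fix F a n assume "F \<in> Cs" "a \<in> {C, D}"
  then obtain i where F: "F = Y C (int i)" and a: "a = C \<or> a = D" by (auto simp: Cs_def)
  from a show "\<exists>r. \<forall>w. F (Y a (- 1 - int n) w) = Y a (- 1 - int n) (F w) + r \<cdot> w"
  proof
    assume "a = C"
    then show ?thesis unfolding F by (intro exI[of _ 0]) (simp add: C_C_comm[of "int i"])
  next
    assume "a = D"
    then show ?thesis unfolding F
      by (intro exI[of _ "if int i + (- 1 - int n) = 0 then 2 * of_int (int i) else 0"])
        (simp add: C_D_comm)
  qed
qed

lemma D_nilp: "\<exists>d. v \<in> nilp Ds d"
proof (rule nilp_exhaustive[OF Ds_modes \<tau>_lowest(2)])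
  fix F a n assume "F \<in> Ds" "a \<in> {C, D}"
  then obtain i where F: "F = Y D (1 + int i)" and a: "a = C \<or> a = D" by (auto simp: Ds_def)
  from a show "\<exists>r. \<forall>w. F (Y a (- 1 - int n) w) = Y a (- 1 - int n) (F w) + r \<cdot> w"
  proof
    assume "a = D"
    then show ?thesis unfolding F by (intro exI[of _ 0]) (simp add: D_D_comm[of "1 + int i"])
  next
    assume "a = C"
    then show ?thesis unfolding F
      by (intro exI[of _ "if 1 + int i + (- 1 - int n) = 0 then 2 * of_int (1 + int i) else 0"])
        (simp add: D_C_comm)
  qed
qed

lemma A0_annihilates:
  assumes "w \<in> nilp Cs 0" "w \<in> nilp Ds 0"
  shows "Y A0 1 w = 0"
proof -
  have "Y D (1 + int j) w = 0" "Y C (int j) w = 0" for j using assms by (auto simp: Cs_def Ds_def)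
  then have "Y (Y C (- 1) D) 1 w = 0" by (subst iterate_m1[of 0]) auto
  then show ?thesis by (simp add: A0_def bilin)
qed

lemma span_\<tau>:
  assumes "w \<in> span (\<Union>j. range (\<tau> j))"
  shows "\<exists>J u. finite J \<and> w = (\<Sum>j\<in>J. \<tau> j (u j))"
  using assms
proof (induction rule: span_induct_alt)
  case base
  then show ?case by (intro exI[of _ "{}"]) auto
next
  case (step r x y)
  then obtain j0 u0 J u where x: "x = \<tau> j0 u0" and y: "finite J" "y = (\<Sum>j\<in>J. \<tau> j (u j))" by auto
  define u' where "u' j = (if j \<in> J then u j else 0)" for j
  have y': "y = (\<Sum>j\<in>insert j0 J. \<tau> j (u' j))"
    using y by (cases "j0 \<in> J") (auto simp: u'_def insert_absorb intro!: sum.cong)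
  have "r \<cdot> x + y = (\<Sum>j\<in>insert j0 J. \<tau> j (u' j + (if j = j0 then smul L r u0 else 0)))"
    using y(1) unfolding y' x \<tau>_add sum.distrib
    by (simp add: \<tau>_scale if_distrib[of "\<tau> _"] sum.insert_if sum.delta cong: if_cong)
  then show ?case using y(1) by (intro exI[of _ "insert j0 J"]) auto
qed

text \<open>\<open>A0_(1)\<close> counts Heisenberg oscillators: creation modes raise its
  eigenvalue, and the \<open>\<tau> j u\<close> have eigenvalue 0. It kills \<open>w\<close> because
  it is a normally ordered product of modes that kill \<open>w\<close>, so \<open>w\<close> lies in
  the eigenspace 0.\<close>

lemma lowest_decomposition:
  assumes "w \<in> nilp Cs 0" "w \<in> nilp Ds 0"
  obtains J u where "finite J" "w = (\<Sum>j\<in>J. \<tau> j (u j))"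
proof -
  define P where "P b s \<longleftrightarrow> Y A0 1 b = of_nat s \<cdot> b \<and> (s = 0 \<longrightarrow> b \<in> span (\<Union>j. range (\<tau> j)))" for b s
  define B where "B = {b. \<exists>s. P b s}"
  define E where "E b = (SOME s. P b s)" for b
  have E: "P b (E b)" if "b \<in> B" for b using that unfolding B_def E_def by (auto intro: someI)
  have step: "Y a (- 1 - int n) b \<in> B" if "b \<in> B" "conf A0 1 a" for a n b
  proof -
    from that(1) obtain s where "P b s" by (auto simp: B_def)
    then have "Y A0 1 (Y a (- 1 - int n) b) = of_nat (s + Suc n) \<cdot> Y a (- 1 - int n) b"
      using conf_mode[OF that(2), of "- 1 - int n" b]
      by (simp add: P_def bilin scale_left_distrib add.assoc)
    then show ?thesis unfolding B_def P_def by (intro CollectI exI[of _ "s + Suc n"]) auto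
  qed
  have spanB: "v \<in> span B" for v
  proof (rule exhaustive)
    show "\<tau> j u \<in> span B" for j u
      by (rule span_base) (auto simp: B_def P_def A0_annihilates[OF \<tau>_lowest] intro!: exI[of _ 0] span_base)
    show "Y C (- 1 - int n) v \<in> span B" if "v \<in> span B" for n v
      by (rule linear_image_span[OF _ _ _ _ that]) (auto simp: bilin intro!: span_base step conf_A0)
    show "Y D (- 1 - int n) v \<in> span B" if "v \<in> span B" for n v
      by (rule linear_image_span[OF _ _ _ _ that]) (auto simp: bilin intro!: span_base step conf_A0)
  qed simp
  have "w \<in> span {b \<in> B. of_nat (E b) = (0::complex)}"
    by (rule eigen_kernel[of w B "Y A0 1"])
      (use spanB E A0_annihilates[OF assms] in \<open>auto simp: bilin P_def\<close>)
  also have "\<dots> \<subseteq> span (\<Union>j. range (\<tau> j))"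
    by (rule span_minimal) (use E in \<open>auto simp: P_def\<close>)
  finally show ?thesis using span_\<tau> that by blast
qed

lemma inj_twice: "inj_on (\<lambda>j::int. 2 * of_int j :: complex) J"
  by (auto simp: inj_on_def)

lemma lowest_weight_vector:
  assumes "w \<in> nilp Cs 0" "w \<in> nilp Ds 0" "Y HH 0 w = (2 * of_int a) \<cdot> w"
  obtains u where "w = \<tau> a u"
proof -
  obtain J u where J: "finite J" "w = (\<Sum>j\<in>J. \<tau> j (u j))" by (rule lowest_decomposition[OF assms(1,2)])
  define u' where "u' j = (if j \<in> J then u j else 0)" for j
  have H: "Y HH 0 (\<tau> j v) = (2 * of_int j) \<cdot> \<tau> j v" for j v using HH_\<tau>[of 0] by simp
  have "w = \<tau> a (u' a)"
  proof (rule eigen_unique_component[of "insert a J" "\<lambda>j. 2 * of_int j" a "Y HH 0" "\<lambda>j. \<tau> j (u' j)"])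
    show "w = (\<Sum>j\<in>insert a J. \<tau> j (u' j))"
      using J by (cases "a \<in> J") (auto simp: u'_def insert_absorb intro!: sum.cong)
  qed (use J assms(3) H in \<open>auto simp: bilin inj_twice\<close>)
  then show ?thesis by (rule that)
qed

lemma nilp0_D_of_H:
  assumes "w \<in> nilp Cs 0"
  shows "Y D (int n) w = Y HH (int n) w"
  using assms by (auto simp: HH_modes Cs_def)

theorem FF_FF: "Y FF (int n) FF = 0"
proof (rule ccontr)
  assume "Y FF (int n) FF \<noteq> 0"
  then obtain J where J: "Y FF (int J) FF \<noteq> 0" "\<And>l. l > J \<Longrightarrow> Y FF (int l) FF = 0"
    by (rule last_nonzero_mode) blast
  define v where "v = Y FF (int J) FF"
  have two: "{..<2::nat} = {0, 1}" by auto
  have FF_HH: "Y FF (int J) HH = (if J = 0 then 2 \<cdot> FF else 0)"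
    using skew[of 1 HH FF "int J"] HH_FF[of 0] HH_FF by (auto simp: creation bilin)
  \<comment> \<open>In \<open>e_(n) f_(J) f\<close> the commutator gives \<open>h_(n+J) f\<close>,
    the other term \<open>f_(J) e_(n) f\<close>. They cancel for \<open>n = 0\<close>, where
    \<open>f_(J) h\<close> is the negative of \<open>h_(J) f\<close>; for \<open>n >= 1\<close> both
    vanish.\<close>
  have Ev: "Y (X 1) (int n) v = 0" for n
  proof -
    have "Y (X 1) (int n) (Y FF (int J) FF) - Y FF (int J) (Y (X 1) (int n) FF) =
      (\<Sum>j<2. (of_int (int n) gchoose j) \<cdot> Y (Y (X 1) (int j) FF) (int n + int J - int j) FF)"
      by (rule commutator) (simp add: X1_FF)
    also have "\<dots> = Y HH (int (n + J)) FF + (of_nat n * k) \<cdot> Y vc (int n + int J - 1) FF"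
      using X1_FF[of 0] X1_FF[of 1] by (simp add: two bilin)
    also have "(of_nat n * k) \<cdot> Y vc (int n + int J - 1) FF = 0"
      by (cases "n = 0") (auto simp: vacuum)
    finally have "Y (X 1) (int n) v = Y FF (int J) (Y (X 1) (int n) FF) + Y HH (int (n + J)) FF"
      by (simp add: v_def algebra_simps)
    moreover have "n = 0 \<or> n = 1 \<or> n \<ge> 2" by linarith
    ultimately show ?thesis
      using HH_FF[of "n + J"] FF_HH X1_FF[of n] by (auto simp: bilin creation)
  qed
  obtain d where "v \<in> nilp Cs d" using C_nilp by blast
  then have vC: "v \<in> nilp Cs 0" using X1_nonneg_zero Ev by blast
  \<comment> \<open>For positive \<open>n\<close> the commutator is a multiple of
    \<open>f_(n+J) f\<close>, which vanishes because \<open>J\<close> is the last nonzero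
    product.\<close>
  have Hv: "Y HH (int n) v = (if n = 0 then (- 4) \<cdot> v else 0)" for n
  proof -
    have "Y HH (int n) (Y FF (int J) FF) - Y FF (int J) (Y HH (int n) FF) =
      (\<Sum>j<1. (of_int (int n) gchoose j) \<cdot> Y (Y HH (int j) FF) (int n + int J - int j) FF)"
      by (rule commutator) (simp add: HH_FF)
    also have "\<dots> = (- 2) \<cdot> Y FF (int (n + J)) FF" using HH_FF[of 0] by (simp add: bilin)
    finally have "Y HH (int n) v = Y FF (int J) (Y HH (int n) FF) - 2 \<cdot> Y FF (int (n + J)) FF"
      by (simp add: v_def algebra_simps)
    moreover have "Y FF (int J) (Y HH (int n) FF) = (if n = 0 then (- 2) \<cdot> v else 0)"
      by (simp add: HH_FF bilin v_def)
    moreover have "(- 2) \<cdot> v - 2 \<cdot> v = (- 4) \<cdot> v"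
      unfolding scale_left_diff_distrib[symmetric] by simp
    ultimately show ?thesis
      using J(2)[of "n + J"] by (cases "n = 0") (simp_all add: v_def[symmetric] del: of_nat_add)
  qed
  have vD: "v \<in> nilp Ds 0"
    using nilp0_D_of_H[OF vC, of "Suc n" for n] Hv[of "Suc n" for n] by (auto simp: Ds_def)
  have "Y HH 0 v = (2 * of_int (- 2)) \<cdot> v" using Hv[of 0] by simp
  then obtain u where u: "v = \<tau> (- 2) u" by (rule lowest_weight_vector[OF vC vD])
  \<comment> \<open>The product \<open>f_(J) f\<close> has weight
    \<open>2 + 2 - J - 1 = 3 - J\<close>. As \<open>A0_(1)\<close> kills \<open>v\<close>, this is
    the \<open>L(0)\<close>-weight of \<open>u\<close> and thus a natural number.\<close>
  have "conf (Om + A0) (2 + 2 - of_int (int J) - 1) v"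
    unfolding v_def by (rule conf_nprod[OF conf_FF conf_FF])
  then have "Y (Om + A0) 1 v = (3 - of_nat J) \<cdot> v" by (simp add: conf_def)
  then have w: "Y Om 1 v = (3 - of_nat J) \<cdot> v"
    using A0_annihilates[OF vC vD] by (simp add: bilin)
  then have "\<tau> (- 2) (nprod L \<omega> 1 u) = \<tau> (- 2) (smul L (3 - of_nat J) u)"
    by (simp add: u Om_\<tau> \<tau>_scale)
  then have "nprod L \<omega> 1 u = smul L (3 - of_nat J) u"
    using \<tau>_diff \<tau>_inj by (metis right_minus_eq)
  moreover have "u \<noteq> 0" using J(1) u by (auto simp: v_def)
  ultimately obtain m :: nat where "3 - of_nat J = (of_nat m :: complex)" using L_spectrum by blast
  then have "(of_nat 3 :: complex) = of_nat (m + J)" by (simp add: algebra_simps)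
  then have "3 = m + J" by (simp only: of_nat_eq_iff)
  moreover have "J \<noteq> 3" using FF_FF3 J(1) by auto
  \<comment> \<open>The weight would be 2, whereas \<open>L(0)\<close> kills
    \<open>f_(1) f\<close>.\<close>
  moreover have "J \<noteq> 1"
  proof
    assume "J = 1"
    then have "2 \<cdot> v = 0" using w Om_FF_FF1 by (simp add: v_def)
    then show False using J(1) by (simp add: v_def)
  qed
  \<comment> \<open>Skew-symmetry of \<open>f\<close> with itself returns \<open>f_(J) f\<close>
    with sign \<open>(-1)^(J+1)\<close>: later products vanish by choice of \<open>J\<close>,
    earlier ones enter through nonnegative modes on the vacuum.\<close>
  moreover have "odd J"
  proof
    assume "even J"
    have "v = - (\<Sum>j<Suc J. (- 1) ^ j \<cdot> Y (Y FF (int j) FF) (int J - 1 - int j) vc)"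
      using skew[of "Suc J" FF FF "int J"] J(2) by (simp add: v_def creation)
    also have "(\<Sum>j<Suc J. (- 1) ^ j \<cdot> Y (Y FF (int j) FF) (int J - 1 - int j) vc) = v"
    proof -
      have "Y (Y FF (int j) FF) (int J - 1 - int j) vc = 0" if "j < J" for j
        using that creation(1)[of "int J - 1 - int j"] by simp
      then show ?thesis using \<open>even J\<close> by (simp add: creation v_def)
    qed
    finally have "2 \<cdot> v = 0" by (simp add: scale_left_distrib[of 1 1, simplified] eq_neg_iff_add_eq_0)
    then show False using J(1) by (simp add: v_def)
  qed
  ultimately show False by (metis (no_types, opaque_lifting) One_nat_def add_eq_if dvd_def even_Suc
        less_2_cases_iff nat_neq_iff not_less_eq numeral_3_eq_3 odd_one trans_less_add2)
qed

theorem affine_relations: "affine_sl2_relations k V (X 1) FF HH"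
  by (rule affine_of_FF) (rule FF_FF)

end

section \<open>A nonzero subspace stable under \<open>e, f, h\<close> contains the vacuum\<close>

context free_field_module
begin

lemma primary_\<tau>: "primary (of_int j) (\<tau> j u)"
  unfolding primary_def nu_def using C_\<tau> D_\<tau> X_\<tau>(1) by (simp add: bilin)

text \<open>Nonnegative modes of \<open>e^(-c)\<close> kill every \<open>\<tau> j u\<close>, so of
  the Virasoro part only \<open>e^(-c)_(-1)\<close> applied to \<open>\<omega>_(J) u\<close>
  remains; the \<open>\<nu>\<close>-part of \<open>f\<close> has no modes beyond 1 on such
  vectors.\<close>

lemma FF_\<tau>:
  assumes J: "J \<ge> 2" and u: "\<And>l. l > J \<Longrightarrow> nprod L \<omega> (int l) u = 0"
  shows "Y FF (int J) (\<tau> j u) = (k + 2) \<cdot> \<tau> (j - 1) (nprod L \<omega> (int J) u)"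
proof -
  obtain m where m: "J = Suc (Suc m)" using J by (metis add_2_eq_Suc le_Suc_ex)
  have "Y Ompsi (int J) (\<tau> j u) = (\<Sum>i<Suc J. Y Om (- 1 - int i) (Y psi (int J + int i) (\<tau> j u))
      + Y psi (int J - 1 - int i) (Y Om (int i) (\<tau> j u)))"
    by (rule Ompsi_iterate) (use X_\<tau>(1)[of "- 1" "J + i" for i] u in \<open>auto simp: Om_\<tau>\<close>)
  also have "\<dots> = (\<Sum>i<J. Y Om (- 1 - int i) (Y psi (int J + int i) (\<tau> j u))
      + Y psi (int J - 1 - int i) (Y Om (int i) (\<tau> j u))) + \<tau> (j - 1) (nprod L \<omega> (int J) u)"
    using X_\<tau>(1)[of "- 1" "J + J"] X_\<tau>(2)[of "- 1"] by (simp add: Om_\<tau>)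
  also have "(\<Sum>i<J. Y Om (- 1 - int i) (Y psi (int J + int i) (\<tau> j u))
      + Y psi (int J - 1 - int i) (Y Om (int i) (\<tau> j u))) = 0"
  proof (rule sum.neutral, rule ballI)
    fix i assume "i \<in> {..<J}"
    then have "int J - 1 - int i = int (J - 1 - i)" by auto
    then show "Y Om (- 1 - int i) (Y psi (int J + int i) (\<tau> j u))
      + Y psi (int J - 1 - int i) (Y Om (int i) (\<tau> j u)) = 0"
      using X_\<tau>(1)[of "- 1" "J + i"] X_\<tau>(1)[of "- 1" "J - 1 - i"] by (simp add: Om_\<tau> del: of_nat_diff)
  qed
  finally have "Y Ompsi (int J) (\<tau> j u) = \<tau> (j - 1) (nprod L \<omega> (int J) u)" by simp
  moreover have "Y GG (int J) (\<tau> j u) = 0"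
    using GG_primary[OF primary_\<tau>, of "Suc m"] unfolding m by (simp del: of_nat_Suc)
  ultimately show ?thesis by (simp add: FF_def bilin)
qed

lemma FF_X: "Y FF 1 (X j) = (of_int j * (k + 1 - of_int j)) \<cdot> X (j - 1)"
proof -
  have "Y Ompsi 1 (X j) = 0"
    using X_X(1)[of "- 1" "1 + i" j for i]
    by (subst Ompsi_iterate[of 0]) (auto simp: Om_X)
  moreover have "Y GG 1 (X j) = (of_int j * (of_int j - k - 1)) \<cdot> X (j - 1)"
    using GG_primary[OF primary_X[of j], of 0] X_X(2)[of "- 1" j] by simp
  moreover have "- (of_int j * (of_int j - k - 1)) = of_int j * (k + 1 - of_int j)"
    by (simp add: algebra_simps)
  ultimately show ?thesis
    by (simp only: FF_def bilin scale_zero_right diff_0 scale_minus_left[symmetric])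
qed

context
  fixes N
  assumes N: "subspace N"
    and E_N: "\<And>n v. v \<in> N \<Longrightarrow> Y (X 1) n v \<in> N"
    and H_N: "\<And>n v. v \<in> N \<Longrightarrow> Y HH n v \<in> N"
    and F_N: "\<And>n v. v \<in> N \<Longrightarrow> Y FF n v \<in> N"
begin

text \<open>On vectors killed by \<open>c(n)\<close>, \<open>n >= 0\<close>, the modes of
  \<open>d\<close> agree with those of \<open>h\<close>. Positive modes of \<open>d\<close>
  therefore stay in \<open>N\<close>, and they lower the level while preserving the condition on
  \<open>c\<close>.\<close>

lemma stable_meets_Ds_lowest:
  assumes "w \<in> N" "w \<noteq> 0" "w \<in> nilp Cs 0" "w \<in> nilp Ds d"
  shows "\<exists>v\<in>N. v \<noteq> 0 \<and> v \<in> nilp Cs 0 \<and> v \<in> nilp Ds 0"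
  using assms
proof (induction d arbitrary: w)
  case (Suc d)
  show ?case
  proof (cases "w \<in> nilp Ds 0")
    case False
    then obtain n where n: "Y D (1 + int n) w \<noteq> 0" by (auto simp: Ds_def)
    have "Y D (1 + int n) w = Y HH (1 + int n) w"
      using nilp0_D_of_H[OF Suc.prems(3), of "Suc n"] by simp
    then have "Y D (1 + int n) w \<in> N" using H_N Suc.prems(1) by simp
    moreover have "Y C (int i) w = 0" for i using Suc.prems(3) by (auto simp: Cs_def)
    then have "Y D (1 + int n) w \<in> nilp Cs 0" by (auto simp: Cs_def C_D_comm)
    moreover have "Y D (1 + int n) w \<in> nilp Ds d"
      using Suc.prems(4) by (auto simp: Ds_def)
    ultimately show ?thesis using Suc.IH n by blast
  qed (use Suc.prems in blast)
qed blast

text \<open>Once a vector of \<open>N\<close> is a sum of terms \<open>\<tau> j (u j)\<close>, the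
  distinct eigenvalues \<open>2 j\<close> of \<open>h(0)\<close> put every summand into
  \<open>N\<close>.\<close>

lemma stable_contains_\<tau>:
  assumes "w \<in> N" "w \<noteq> 0"
  shows "\<exists>j u. u \<noteq> 0 \<and> \<tau> j u \<in> N"
proof -
  obtain d where "w \<in> nilp Cs d" using C_nilp by blast
  then obtain w1 where w1: "w1 \<in> N" "w1 \<noteq> 0" "w1 \<in> nilp Cs 0"
    using X1_stable_meets_lowest[of N w d, OF E_N] assms by blast
  obtain d' where "w1 \<in> nilp Ds d'" using D_nilp by blast
  then obtain v where v: "v \<in> N" "v \<noteq> 0" "v \<in> nilp Cs 0" "v \<in> nilp Ds 0"
    using stable_meets_Ds_lowest[OF w1] by blast
  obtain J u where J: "finite J" "v = (\<Sum>j\<in>J. \<tau> j (u j))" by (rule lowest_decomposition[OF v(3,4)])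
  have "\<tau> j (u j) \<in> N" if "j \<in> J" for j
    by (rule eigen_component_indexed[of J "\<lambda>j. 2 * of_int j" N "Y HH 0" "\<lambda>j. \<tau> j (u j)"])
      (use J N H_N v that HH_\<tau>[of 0] inj_twice in \<open>auto simp: bilin\<close>)
  moreover have "\<exists>j\<in>J. u j \<noteq> 0"
  proof (rule ccontr)
    assume "\<not> (\<exists>j\<in>J. u j \<noteq> 0)"
    then have "v = 0" unfolding J(2) by (intro sum.neutral) auto
    then show False using v(2) by simp
  qed
  ultimately show ?thesis by blast
qed

text \<open>If \<open>\<omega>_(J)\<close>, \<open>J >= 2\<close>, is the last nonzero mode on
  \<open>u\<close>, then \<open>f_(J)\<close> realises it up to the factor \<open>k + 2\<close>. The
  new vector is nonzero, of lower level, with \<open>j\<close> replaced by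
  \<open>j - 1\<close>.\<close>

lemma stable_contains_singular:
  assumes "k + 2 \<noteq> 0" "u \<noteq> 0" "\<tau> j u \<in> N" "u \<in> nilp (positive_modes L \<omega>) d"
  shows "\<exists>j u. u \<noteq> 0 \<and> \<tau> j u \<in> N \<and> u \<in> nilp (positive_modes L \<omega>) 0"
  using assms(2-4)
proof (induction d arbitrary: u j)
  case (Suc d)
  show ?case
  proof (cases "u \<in> nilp (positive_modes L \<omega>) 0")
    case False
    then obtain n where "nprod L \<omega> (int (2 + n)) u \<noteq> 0" by (auto simp: positive_modes_def)
    then obtain J where J: "nprod L \<omega> (int J) u \<noteq> 0" "J \<ge> 2 + n"
      "\<And>l. l > J \<Longrightarrow> nprod L \<omega> (int l) u = 0"
      by (rule L.last_nonzero_mode) blast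
    have "(k + 2) \<cdot> \<tau> (j - 1) (nprod L \<omega> (int J) u) \<in> N"
      using FF_\<tau>[of J u j] J F_N[OF Suc.prems(2), of "int J"] by auto
    then have "(1 / (k + 2)) \<cdot> ((k + 2) \<cdot> \<tau> (j - 1) (nprod L \<omega> (int J) u)) \<in> N"
      by (rule subspace_scale[OF N])
    then have "\<tau> (j - 1) (nprod L \<omega> (int J) u) \<in> N" using assms(1) by simp
    moreover have "nprod L \<omega> (int J) u \<in> nilp (positive_modes L \<omega>) d"
    proof -
      have "nprod L \<omega> (2 + int (J - 2)) \<in> positive_modes L \<omega>" by (auto simp: positive_modes_def)
      moreover have "2 + int (J - 2) = int J" using J(2) by simp
      ultimately show ?thesis using Suc.prems(3) by simp
    qed
    ultimately show ?thesis using Suc.IH J(1) by blast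
  qed (use Suc.prems in blast)
qed blast

text \<open>\<open>e_(-1)\<close> raises the exponent of \<open>e^(jc)\<close> until it is
  nonnegative; \<open>f_(1)\<close> then lowers it to 0. From exponent \<open>m + 1\<close> the
  factor is \<open>(m + 1) (k - m)\<close>, nonzero for every natural \<open>m\<close>.\<close>

theorem stable_contains_vac:
  assumes k: "k + 2 \<noteq> 0" "\<And>m::nat. k \<noteq> of_nat m" and w: "w \<in> N" "w \<noteq> 0"
  shows "vc \<in> N"
proof -
  obtain j0 u0 where "u0 \<noteq> 0" "\<tau> j0 u0 \<in> N" using stable_contains_\<tau>[OF w] by blast
  moreover obtain d where "u0 \<in> nilp (positive_modes L \<omega>) d" using L_nilp by blast
  ultimately obtain j u where u: "u \<noteq> 0" "\<tau> j u \<in> N" "u \<in> nilp (positive_modes L \<omega>) 0"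
    using stable_contains_singular[OF k(1)] by blast
  then obtain r where r: "u = smul L r (vac L)" using L_singular by blast
  then have "r \<noteq> 0" using u(1) by auto
  have "(1 / r) \<cdot> \<tau> j u \<in> N" by (rule subspace_scale[OF N u(2)])
  then have j: "X j \<in> N" using \<open>r \<noteq> 0\<close> by (simp add: r \<tau>_scale X_vac)
  have up: "X (j + int m) \<in> N" for m
  proof (induction m)
    case (Suc m)
    then have "Y (X 1) (- 1) (X (j + int m)) \<in> N" by (rule E_N)
    then show ?case by (simp add: X_X(2) algebra_simps)
  qed (use j in simp)
  have down: "X 0 \<in> N" if "X (int m) \<in> N" for m
    using that
  proof (induction m)
    case (Suc m)
    let ?c = "of_int (int (Suc m)) * (k + 1 - of_int (int (Suc m)))"
    have "?c \<cdot> X (int m) \<in> N" using FF_X[of "int (Suc m)"] F_N[OF Suc.prems, of 1] by simp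
    moreover have "k + 1 - of_int (int (Suc m)) \<noteq> 0" using k(2)[of m] by simp
    then have c: "?c \<noteq> 0" by (simp only: mult_eq_0_iff of_int_of_nat_eq of_nat_eq_0_iff) simp
    ultimately have "inverse ?c \<cdot> (?c \<cdot> X (int m)) \<in> N" by (intro subspace_scale[OF N, of "?c \<cdot> X (int m)"])
    then have "X (int m) \<in> N" unfolding scale_scale left_inverse[OF c] by simp
    then show ?case by (rule Suc.IH)
  qed simp
  have "X (int (nat (j + \<bar>j\<bar>))) \<in> N" using up[of "nat \<bar>j\<bar>"]
    by (simp add: abs_if split: if_splits)
  then show ?thesis using down X_0 by metis
qed

end

end

section \<open>The simple Virasoro vertex algebra\<close>

text \<open>Mode \<open>n\<close> of \<open>\<omega>\<close> is \<open>L(n - 1)\<close>.\<close>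

locale simple_virasoro_va = vertex_algebra V for V :: "'l::ab_group_add va" +
  fixes \<omega> :: 'l and cc :: complex
  assumes virasoro: "nprod V \<omega> m (nprod V \<omega> n v) = nprod V \<omega> n (nprod V \<omega> m v)
      + smul V (of_int (m - n)) (nprod V \<omega> (m + n - 1) v)
      + (if m + n = 2 then smul V (of_int ((m - 1) ^ 3 - (m - 1)) / 12 * cc) v else 0)"
    and generated: "generated_by V {\<omega>}"
    and words: "module.span (smul V)
      {foldr (\<lambda>n. nprod V \<omega> (1 - int n)) ns (vac V) | ns. 0 \<notin> set ns} = UNIV"
    and simple: "simple_va V"
begin

lemma \<omega>_\<omega>: "Y \<omega> (int n) \<omega> = (if n = 0 then tr \<omega> else if n = 1 then 2 \<cdot> \<omega>
    else if n = 3 then (cc / 2) \<cdot> vc else 0)"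
proof -
  have "Y \<omega> (int n) \<omega> = Y \<omega> (int n) (Y \<omega> (- 1) vc)" by (simp add: creation)
  also have "\<dots> = of_int (int n + 1) \<cdot> Y \<omega> (int n - 2) vc
      + (if n = 3 then (cc / 2) \<cdot> vc else 0)"
    using virasoro[of "int n" "- 1" vc] by (auto simp: creation)
  also have "\<dots> = (if n = 0 then tr \<omega> else if n = 1 then 2 \<cdot> \<omega>
    else if n = 3 then (cc / 2) \<cdot> vc else 0)"
  proof -
    have "n = 0 \<or> n = 1 \<or> n \<ge> 2" by linarith
    then show ?thesis by (elim disjE) (auto simp: creation)
  qed
  finally show ?thesis .
qed

lemma conf_\<omega>: "conf \<omega> 2 \<omega>"
  using \<omega>_\<omega>[of 0] \<omega>_\<omega>[of 1] by (simp add: conf_def)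

lemma tr_\<omega>: "Y \<omega> 0 a = tr a"
  by (rule generated_tr[OF generated, where H = "\<lambda>_. 2"]) (use conf_\<omega> in auto)

lemma L0_mode: "Y \<omega> 1 u = s \<cdot> u \<Longrightarrow> Y \<omega> 1 (Y \<omega> n u) = (s + 1 - of_int n) \<cdot> Y \<omega> n u"
  using conf_mode[OF conf_\<omega>, of n u]
  by (simp add: bilin scale_left_distrib[symmetric])

lemma eigen_vectors:
  obtains B and E :: "'l \<Rightarrow> nat" where "span B = UNIV" "\<And>b. b \<in> B \<Longrightarrow> Y \<omega> 1 b = of_nat (E b) \<cdot> b"
    "\<And>b. b \<in> B \<Longrightarrow> E b = 0 \<Longrightarrow> b \<in> span {vc}"
proof -
  define B where "B = {foldr (\<lambda>n. Y \<omega> (1 - int n)) ns vc | ns. 0 \<notin> set ns}"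
  define P where "P b m \<longleftrightarrow> Y \<omega> 1 b = of_nat m \<cdot> b \<and> (m = 0 \<longrightarrow> b \<in> span {vc})" for b m
  have ex: "\<exists>m. P b m" if "b \<in> B" for b
  proof -
    from that obtain ns where ns: "b = foldr (\<lambda>n. Y \<omega> (1 - int n)) ns vc" "0 \<notin> set ns"
      by (auto simp: B_def)
    have "Y \<omega> 1 (foldr (\<lambda>n. Y \<omega> (1 - int n)) ns vc) =
        of_nat (sum_list ns) \<cdot> foldr (\<lambda>n. Y \<omega> (1 - int n)) ns vc"
    proof (induction ns)
      case Nil
      then show ?case by (simp add: creation)
    next
      case (Cons n ns)
      from L0_mode[OF this, of "1 - int n"] show ?case by (simp add: add.commute)
    qed
    moreover have "b \<in> span {vc}" if "sum_list ns = 0"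
    proof -
      have "ns = []" using that ns(2) by (cases ns) auto
      then show ?thesis using ns(1) by (simp add: span_base)
    qed
    ultimately have "P b (sum_list ns)" unfolding P_def by (simp add: ns(1))
    then show ?thesis by blast
  qed
  have P: "P b (SOME m. P b m)" if "b \<in> B" for b by (rule someI_ex[OF ex[OF that]])
  show ?thesis
  proof (rule that[of B "\<lambda>b. SOME m. P b m"])
    show "span B = UNIV" unfolding B_def by (rule words)
    fix b assume b: "b \<in> B"
    show "Y \<omega> 1 b = of_nat (SOME m. P b m) \<cdot> b"
      using P[OF b] unfolding P_def by (rule conjunct1)
    show "b \<in> span {vc}" if "(SOME m. P b m) = 0"
      using P[OF b] that unfolding P_def by (metis (no_types, lifting))
  qed
qed

lemma spectrum:
  assumes "Y \<omega> 1 u = s \<cdot> u" "u \<noteq> 0"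
  shows "\<exists>m::nat. s = of_nat m"
proof -
  obtain B and E :: "'l \<Rightarrow> nat" where B: "span B = UNIV" "\<And>b. b \<in> B \<Longrightarrow> Y \<omega> 1 b = of_nat (E b) \<cdot> b"
    by (rule eigen_vectors) blast
  have "u \<in> span {b \<in> B. of_nat (E b) = s}"
    by (rule eigen_kernel[of u B "Y \<omega> 1"]) (use B assms in \<open>auto simp: bilin\<close>)
  moreover have "{b \<in> B. of_nat (E b) = s} \<noteq> {}"
  proof
    assume "{b \<in> B. of_nat (E b) = s} = {}"
    with \<open>u \<in> span _\<close> have "u \<in> span {}" by (simp only:)
    then show False using assms(2) by simp
  qed
  ultimately show ?thesis by blast
qed

lemma positive_modes_subset: "positive_modes V \<omega> \<subseteq> range (\<lambda>(a, n). Y a n)"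
  by (auto simp: positive_modes_def)

text \<open>Each \<open>L(n)\<close>, \<open>n >= 1\<close>, lowers the eigenvalue by
  \<open>n\<close>, and by \<open>spectrum\<close> nonzero eigenvectors have natural
  eigenvalues.\<close>

lemma eigen_nilp:
  assumes "Y \<omega> 1 u = of_nat m \<cdot> u"
  shows "u \<in> nilp (positive_modes V \<omega>) m"
  using assms
proof (induction m arbitrary: u rule: less_induct)
  case (less m)
  have *: "Y \<omega> (2 + int n) u = 0 \<or> (\<exists>m'<m. Y \<omega> (2 + int n) u \<in> nilp (positive_modes V \<omega>) m')" for n
  proof (cases "Y \<omega> (2 + int n) u = 0")
    case False
    have e: "Y \<omega> 1 (Y \<omega> (2 + int n) u) = (of_nat m + 1 - of_int (2 + int n)) \<cdot> Y \<omega> (2 + int n) u"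
      by (rule L0_mode[OF less.prems])
    then obtain m' :: nat where m': "of_nat m + 1 - of_int (2 + int n) = (of_nat m' :: complex)"
      using spectrum False by blast
    then have "(of_nat m :: complex) = of_nat (m' + n + 1)" by (simp add: algebra_simps)
    then have "m' < m" by (simp only: of_nat_eq_iff)
    then show ?thesis using less.IH[of m'] e m' by auto
  qed simp
  show ?case
  proof (cases m)
    case 0
    then show ?thesis using * by (auto simp: positive_modes_def)
  next
    case (Suc k)
    have "Y \<omega> (2 + int n) u \<in> nilp (positive_modes V \<omega>) k" for n
      using *[of n]
    proof (elim disjE exE conjE)
      assume "Y \<omega> (2 + int n) u = 0"
      then show ?thesis using subspace_0[OF nilp_modes_subspace[OF positive_modes_subset, of k]] by simp
    next
      fix m' assume "m' < m" "Y \<omega> (2 + int n) u \<in> nilp (positive_modes V \<omega>) m'"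
      then show ?thesis using Suc nilp_modes_mono[OF positive_modes_subset, of m' k] by auto
    qed
    then show ?thesis using Suc by (auto simp: positive_modes_def)
  qed
qed

lemma exhausted_by_nilp: "\<exists>d. u \<in> nilp (positive_modes V \<omega>) d"
proof -
  note sub = nilp_modes_subspace[OF positive_modes_subset]
  obtain B and E :: "'l \<Rightarrow> nat" where B: "span B = UNIV" "\<And>b. b \<in> B \<Longrightarrow> Y \<omega> 1 b = of_nat (E b) \<cdot> b"
    by (rule eigen_vectors) blast
  have "u \<in> span B" using B by simp
  then show ?thesis
  proof (induction rule: span_induct_alt)
    case base
    then show ?case using subspace_0[OF sub] by blast
  next
    case (step r x y)
    then obtain d where "y \<in> nilp (positive_modes V \<omega>) d" by blast
    then have "y \<in> nilp (positive_modes V \<omega>) (d + E x)" "x \<in> nilp (positive_modes V \<omega>) (d + E x)"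
      using eigen_nilp[OF B(2)[OF step(1)]] nilp_modes_mono[OF positive_modes_subset, of _ "d + E x"]
      by (meson le_add1 le_add2 subsetD)+
    then show ?case using sub subspace_add subspace_scale by blast
  qed
qed

text \<open>Stability under all left modes comes from generation by \<open>\<omega>\<close>. In
  particular \<open>M\<close> is stable under \<open>\<omega>_(0) = T\<close>, so it contains all
  \<open>x_(n) 1\<close> with \<open>x\<close> in \<open>M\<close>, and skew-symmetry turns left
  stability into right stability.\<close>

lemma subspace_closed_is_ideal:
  assumes M: "subspace M" and \<omega>: "\<And>n v. v \<in> M \<Longrightarrow> Y \<omega> n v \<in> M"
  shows "va_ideal V M"
  unfolding va_ideal_def
proof (intro conjI allI ballI M)
  have left: "Y a n v \<in> M" if "v \<in> M" for a n v
    by (rule generated_closed[OF generated M _ that]) (use \<omega> in auto)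
  have vac: "Y x (- 1 - int i) vc \<in> M" if "x \<in> M" for x i
    using that
  proof (induction i arbitrary: x)
    case 0
    then show ?case by (simp add: creation)
  next
    case (Suc i)
    have "tr x \<in> M" using \<omega>[OF Suc.prems, of 0] by (simp add: tr_\<omega>)
    from Suc.IH[OF this] show ?case unfolding nprod_neg_vac by (rule subspace_scale[OF M])
  qed
  have vac': "Y x n vc \<in> M" if "x \<in> M" for x n
  proof (cases "n \<ge> 0")
    case True
    then show ?thesis using subspace_0[OF M] by (simp add: creation)
  next
    case False
    then show ?thesis using vac[OF that, of "nat (- 1 - n)"] by simp
  qed
  fix a n v assume v: "v \<in> M"
  then show "Y a n v \<in> M" by (rule left)
  obtain N where N: "\<And>j. j \<ge> N \<Longrightarrow> Y a (int j) v = 0" by (rule truncation1[of a v]) blast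
  have "Y v n a = Y a (- 1) (Y v n vc) - (\<Sum>j<N. ((- 1) ^ j) \<cdot> Y (Y a (int j) v) (n - 1 - int j) vc)"
    by (rule skew) (rule N)
  also have "\<dots> \<in> M"
    by (intro subspace_diff[OF M] subspace_sum[OF M] subspace_scale[OF M] left vac' v)
  finally show "Y v n a \<in> M" .
qed

text \<open>The Virasoro module generated by \<open>u\<close> is an ideal; if nonzero, it contains
  the vacuum by simplicity. But it is spanned by lowering modes applied to \<open>u\<close>, whose
  weights are at least \<open>s > 0\<close>.\<close>

lemma singular_eigenvector:
  assumes u: "Y \<omega> 1 u = of_nat s \<cdot> u" "\<And>n. Y \<omega> (2 + int n) u = 0" and s: "s \<noteq> 0"
  shows "u = 0"
proof (rule ccontr)
  assume "u \<noteq> 0"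
  define B where "B = {foldr (\<lambda>n. Y \<omega> (- int n)) ns u | ns. True}"
  define M where "M = span B"
  have M: "subspace M" by (simp add: M_def)
  have lower: "Y \<omega> (- int n) v \<in> M" if "v \<in> M" for n v
  proof (rule linear_image_span[where A = "Y \<omega> (- int n)" and B = B])
    show "v \<in> span B" using that by (simp add: M_def)
    fix b assume "b \<in> B"
    then obtain ns where "b = foldr (\<lambda>n. Y \<omega> (- int n)) ns u" by (auto simp: B_def)
    then have "Y \<omega> (- int n) b = foldr (\<lambda>n. Y \<omega> (- int n)) (n # ns) u" by simp
    then show "Y \<omega> (- int n) b \<in> M" unfolding M_def B_def by (intro span_base) blast
  qed (auto simp: bilin M)
  have word: "foldr (\<lambda>n. Y \<omega> (- int n)) ns u \<in> M" for ns
    unfolding M_def B_def by (rule span_base) blast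
  have uM: "u \<in> M" using word[of "[]"] by simp
  have all: "Y \<omega> i (foldr (\<lambda>n. Y \<omega> (- int n)) ns u) \<in> M" for i ns
  proof (induction ns arbitrary: i)
    case Nil
    consider "i \<le> 0" | "i = 1" | "i \<ge> 2" by linarith
    then show ?case
    proof cases
      case 1
      then show ?thesis using lower[OF uM, of "nat (- i)"] by simp
    next
      case 2
      then show ?thesis using u(1) subspace_scale[OF M uM] by simp
    next
      case 3
      then show ?thesis using u(2)[of "nat (i - 2)"] subspace_0[OF M] by simp
    qed
  next
    case (Cons n ns)
    let ?w = "foldr (\<lambda>n. Y \<omega> (- int n)) ns u"
    have "Y \<omega> i (Y \<omega> (- int n) ?w) \<in> M"
      unfolding virasoro[of i "- int n" ?w]
      by (intro subspace_add[OF M] subspace_scale[OF M] lower Cons.IH)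
        (auto intro!: subspace_0[OF M] subspace_scale[OF M] word)
    then show ?case by simp
  qed
  have "Y \<omega> n v \<in> M" if "v \<in> M" for n v
    by (rule linear_image_span[where A = "Y \<omega> n" and B = B])
      (use that all M in \<open>auto simp: bilin B_def M_def\<close>)
  then have "va_ideal V M" by (rule subspace_closed_is_ideal[OF M])
  then have "vc \<in> M" using simple uM \<open>u \<noteq> 0\<close> unfolding simple_va_def by blast
  define P where "P b m \<longleftrightarrow> Y \<omega> 1 b = of_nat (Suc m) \<cdot> b" for b m
  have ex: "\<exists>m. P b m" if "b \<in> B" for b
  proof -
    from that obtain ns where b: "b = foldr (\<lambda>n. Y \<omega> (- int n)) ns u" by (auto simp: B_def)
    have "\<exists>m. P (foldr (\<lambda>n. Y \<omega> (- int n)) ns u) m"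
    proof (induction ns)
      case Nil
      then show ?case using u(1) s by (auto simp: P_def intro!: exI[of _ "s - 1"])
    next
      case (Cons n ns)
      then obtain m where "P (foldr (\<lambda>n. Y \<omega> (- int n)) ns u) m" by blast
      from L0_mode[OF this[unfolded P_def], of "- int n"] show ?case
        unfolding P_def by (intro exI[of _ "m + Suc n"]) (simp add: algebra_simps)
    qed
    then show ?thesis by (simp add: b)
  qed
  have P: "P b (SOME m. P b m)" if "b \<in> B" for b by (rule someI_ex[OF ex[OF that]])
  have "vc \<in> span {b \<in> B. of_nat (Suc (SOME m. P b m)) = (0 :: complex)}"
    by (rule eigen_kernel[of vc B "Y \<omega> 1"])
      (use P \<open>vc \<in> M\<close> in \<open>auto simp: bilin P_def M_def creation simp del: of_nat_Suc\<close>)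
  then have "vc = 0" by (simp only: of_nat_eq_0_iff) simp
  then show False using simple by (simp add: simple_va_def)
qed

text \<open>The components of \<open>u\<close> for different \<open>L(0)\<close>-eigenvalues are
  sent by each \<open>L(n)\<close> to vectors with different eigenvalues, so each component is
  singular by itself; those of positive weight vanish.\<close>

lemma singular:
  assumes "u \<in> nilp (positive_modes V \<omega>) 0"
  shows "\<exists>r. u = r \<cdot> vc"
proof -
  have sing: "Y \<omega> (2 + int n) u = 0" for n using assms by (auto simp: positive_modes_def)
  obtain B and E :: "'l \<Rightarrow> nat" where B: "span B = UNIV" "\<And>b. b \<in> B \<Longrightarrow> Y \<omega> 1 b = of_nat (E b) \<cdot> b"
    "\<And>b. b \<in> B \<Longrightarrow> E b = 0 \<Longrightarrow> b \<in> span {vc}"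
    by (rule eigen_vectors) blast
  obtain S v where S: "finite S" "u = (\<Sum>s\<in>S. v s)" "\<And>s. s \<in> S \<Longrightarrow> Y \<omega> 1 (v s) = s \<cdot> v s"
    and vB: "\<And>s. s \<in> S \<Longrightarrow> v s \<in> span {b \<in> B. of_nat (E b) = s}"
    by (rule eigen_decomposition[of u B "Y \<omega> 1" "\<lambda>b. of_nat (E b)"]) (use B in \<open>auto simp: bilin\<close>)
  have vs: "Y \<omega> (2 + int n) (v s) = 0" if "s \<in> S" for s n
  proof -
    have "Y \<omega> (2 + int n) (v s) \<in> {0}"
    proof (rule eigen_component_indexed[of S "\<lambda>s. s + 1 - of_int (2 + int n)" "{0}" "Y \<omega> 1"
          "\<lambda>s. Y \<omega> (2 + int n) (v s)"])
      show "(\<Sum>s\<in>S. Y \<omega> (2 + int n) (v s)) \<in> {0}"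
        using sing[of n] by (simp add: S(2) nprod_sum_right)
      show "Y \<omega> 1 (Y \<omega> (2 + int n) (v i)) = (i + 1 - of_int (2 + int n)) \<cdot> Y \<omega> (2 + int n) (v i)"
        if "i \<in> S" for i by (rule L0_mode[OF S(3)[OF that]])
    qed (use S(1) that in \<open>auto simp: bilin inj_on_def subspace_def\<close>)
    then show ?thesis by simp
  qed
  have v0: "v s = 0" if s: "s \<in> S" "s \<noteq> 0" for s
  proof (rule ccontr)
    assume "v s \<noteq> 0"
    then obtain m :: nat where "s = of_nat m" using spectrum S(3)[OF s(1)] by blast
    then show False
      using singular_eigenvector[of "v s" m] S(3)[OF s(1)] vs[OF s(1)] s(2) \<open>v s \<noteq> 0\<close> by auto
  qed
  have "u = (if 0 \<in> S then v 0 else 0)"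
  proof (cases "0 \<in> S")
    case True
    then show ?thesis using S v0 by (simp add: sum.remove[of S 0])
  next
    case False
    then show ?thesis using S(2) v0 by (auto intro!: sum.neutral)
  qed
  moreover have "v 0 \<in> span {vc}" if "0 \<in> S"
  proof -
    have "span {b \<in> B. of_nat (E b) = (0 :: complex)} \<subseteq> span {vc}"
      by (rule span_minimal) (use B(3) in auto)
    then show ?thesis using vB[OF that] by auto
  qed
  ultimately have "u \<in> span {vc}" using span_zero by auto
  then show ?thesis by (auto simp: span_singleton)
qed

end

lemma simple_virasoro_vaI:
  assumes "simple_virasoro cc W r L \<omega>"
  shows "simple_virasoro_va L \<omega> cc"
proof -
  obtain \<omega>' where W: "universal_virasoro cc W \<omega>'" and \<omega>: "\<omega> = r \<omega>'" and Q: "simple_quotient W L r"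
    using assms unfolding simple_virasoro_def by blast
  interpret W: vertex_algebra W using W by (simp add: universal_virasoro_def)
  interpret L: vertex_algebra L using Q by (simp add: simple_quotient_def simple_va_def)
  have hom: "r (nprod W a n b) = nprod L (r a) n (r b)" and vac: "r (vac W) = vac L"
    and lin: "Vector_Spaces.linear (smul W) (smul L) r" and surj: "surj r" for a n b
    using Q by (auto simp: simple_quotient_def va_hom_def)
  interpret lin: Vector_Spaces.linear "smul W" "smul L" r by (rule lin)
  let ?B = "(\<lambda>ns. foldr (\<lambda>n. vir W \<omega>' (- int n)) ns (vac W)) ` {ns\<in>partitions. 1 \<notin> set ns}"
  have spanW: "W.span ?B = UNIV"
    using W by (simp add: universal_virasoro_def basis_family_def)
  show ?thesis
  proof (unfold_locales)
    fix m n v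
    obtain v' where v: "v = r v'" using surj by (rule surjE)
    have "vir W \<omega>' (m - 1) (vir W \<omega>' (n - 1) v') - vir W \<omega>' (n - 1) (vir W \<omega>' (m - 1) v') =
        smul W (of_int (m - 1 - (n - 1))) (vir W \<omega>' (m - 1 + (n - 1)) v') +
        (if m - 1 + (n - 1) = 0 then smul W (of_int ((m - 1) ^ 3 - (m - 1)) / 12 * cc) v' else 0)"
      using W unfolding universal_virasoro_def by blast
    then have "r (nprod W \<omega>' m (nprod W \<omega>' n v')) = r (nprod W \<omega>' n (nprod W \<omega>' m v')
        + (smul W (of_int (m - n)) (nprod W \<omega>' (m + n - 1) v') +
        (if m + n = 2 then smul W (of_int ((m - 1) ^ 3 - (m - 1)) / 12 * cc) v' else 0)))"
      by (intro arg_cong[where f = r]) (simp add: vir_def algebra_simps)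
    then show "nprod L \<omega> m (nprod L \<omega> n v) = nprod L \<omega> n (nprod L \<omega> m v)
      + smul L (of_int (m - n)) (nprod L \<omega> (m + n - 1) v)
      + (if m + n = 2 then smul L (of_int ((m - 1) ^ 3 - (m - 1)) / 12 * cc) v else 0)"
      by (simp add: lin.add lin.scale lin.zero hom v \<omega> add.assoc if_distrib[of r] cong: if_cong)
  next
    have "generated_by W {\<omega>'}"
      unfolding generated_by_def
    proof (intro allI impI)
      fix N assume N: "W.subspace N" "vac W \<in> N" "\<forall>g\<in>{\<omega>'}. \<forall>n. \<forall>v\<in>N. nprod W g n v \<in> N"
      have "foldr (\<lambda>n. vir W \<omega>' (- int n)) ns (vac W) \<in> N" for ns
        using N by (induction ns) (auto simp: vir_def)
      then have "W.span ?B \<subseteq> N" by (intro W.span_minimal N(1)) auto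
      then show "N = UNIV" using spanW by auto
    qed
    from generated_by_surj[OF W.vertex_algebra_axioms L.vertex_algebra_axioms this _ surj]
    show "generated_by L {\<omega>}" using Q \<omega> by (simp add: simple_quotient_def)
  next
    have word: "r (foldr (\<lambda>n. vir W \<omega>' (- int n)) ns (vac W)) = foldr (\<lambda>n. nprod L \<omega> (1 - int n)) ns (vac L)" for ns
      by (induction ns) (simp_all add: hom vac vir_def \<omega>)
    have "UNIV = r ` W.span ?B" using spanW surj by simp
    also have "\<dots> = L.span (r ` ?B)" by (simp add: lin.span_image)
    also have "\<dots> \<subseteq> L.span {foldr (\<lambda>n. nprod L \<omega> (1 - int n)) ns (vac L) | ns. 0 \<notin> set ns}"
      by (rule L.span_mono) (auto simp: word partitions_def)
    finally show "L.span {foldr (\<lambda>n. nprod L \<omega> (1 - int n)) ns (vac L) | ns. 0 \<notin> set ns} = UNIV" by auto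
  next
    show "simple_va L" using Q by (simp add: simple_quotient_def)
  qed
qed

section \<open>The lattice vertex algebra and the tensor product\<close>

lemma exp_coeff_0 [simp]: "exp_coeff s X 0 v = s 1 v"
proof -
  have "{is :: nat list. 0 \<notin> set is \<and> sum_list is = 0} = {[]}"
  proof (intro set_eqI iffI)
    fix l :: "nat list" assume "l \<in> {is. 0 \<notin> set is \<and> sum_list is = 0}"
    then show "l \<in> {[]}" by (cases l) auto
  qed auto
  then show ?thesis by (simp add: exp_coeff_def)
qed

lemma exp_coeff_1 [simp]: "exp_coeff s X (Suc 0) v = s 1 (X 1 v)"
proof -
  have "{is :: nat list. 0 \<notin> set is \<and> sum_list is = Suc 0} = {[1]}"
  proof (intro set_eqI iffI)
    fix l :: "nat list" assume l: "l \<in> {is. 0 \<notin> set is \<and> sum_list is = Suc 0}"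
    then obtain x xs where x: "l = x # xs" "x \<noteq> 0" "x + sum_list xs = Suc 0" by (cases l) auto
    then have "x = 1" "sum_list xs = 0" by linarith+
    moreover have "0 \<notin> set xs" using l x(1) by simp
    ultimately show "l \<in> {[1]}" using x(1) by (cases xs) auto
  qed auto
  then show ?thesis by (simp add: exp_coeff_def)
qed

lemma exp_coeff_annihilated:
  assumes "r \<noteq> 0" "\<And>i. i \<ge> 1 \<Longrightarrow> X i v = 0" "\<And>i. X i 0 = 0" "\<And>a. s a 0 = 0"
  shows "exp_coeff s X r v = 0"
  unfolding exp_coeff_def
proof (rule sum.neutral, rule ballI)
  fix l assume l: "l \<in> {is. 0 \<notin> set is \<and> sum_list is = r}"
  then have "l \<noteq> []" using assms(1) by auto
  then obtain us i where us: "l = us @ [i]" by (metis append_butlast_last_id)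
  have "foldr X us 0 = 0" by (induction us) (simp_all add: assms)
  then show "s (1 / fact (length l)) (foldr X l v) = 0"
    using l assms(2)[of i] assms(4) by (simp add: us)
qed

context vertex_algebra
begin

context
  fixes c d :: 'v and ex :: "int \<Rightarrow> 'v"
  assumes P: "lattice_Pi0 V c d ex"
begin

lemma lattice_c_ex: "Y c (int n) (ex j) = 0" "Y d (int n) (ex j) = (if n = 0 then (2 * of_int j) \<cdot> ex j else 0)"
  using P unfolding lattice_Pi0_def by auto

lemma lattice_ex_ex:
  "Y (ex m) n (ex j) = lattice_vertex_coeff V (of_int m \<cdot> c) n (ex (j + m))"
proof -
  have "[] \<in> partitions" by (simp add: partitions_def)
  then have "Y (ex m) n (pi_monomial V c d ex ([], [], j)) =
      lattice_vertex_coeff V (of_int m \<cdot> c) n (pi_monomial V c d ex ([], [], j + m))"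
    using P unfolding lattice_Pi0_def by blast
  then show ?thesis by (simp add: pi_monomial_def lower_def)
qed

text \<open>\<open>c(i)\<close> kills \<open>e^(jc)\<close> for \<open>i >= 0\<close>: the
  annihilating exponential acts as the identity and only \<open>s = 0\<close> remains.\<close>

lemma lattice_coeff_ex:
  "lattice_vertex_coeff V (of_int m \<cdot> c) n (ex j) = (if n \<ge> 0 then 0 else
     exp_coeff (smul V) (\<lambda>i w. (1 / of_nat i) \<cdot> Y (of_int m \<cdot> c) (- int i) w) (nat (- n - 1)) (ex j))"
proof -
  have inner: "exp_coeff (smul V) (\<lambda>i w. (- 1 / of_nat i) \<cdot> Y (of_int m \<cdot> c) (int i) w) s (ex j) = 0"
    if "s \<noteq> 0" for s
    by (rule exp_coeff_annihilated[OF that]) (simp_all add: bilin lattice_c_ex)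
  have outer: "exp_coeff (smul V) (\<lambda>i w. (1 / of_nat i) \<cdot> Y (of_int m \<cdot> c) (- int i) w) r 0 = 0" for r
    unfolding exp_coeff_def
  proof (rule sum.neutral, rule ballI)
    fix l :: "nat list"
    show "(1 / fact (length l)) \<cdot> foldr (\<lambda>i w. (1 / of_nat i) \<cdot> Y (of_int m \<cdot> c) (- int i) w) l 0 = 0"
      by (induction l) simp_all
  qed
  let ?out = "\<lambda>s. exp_coeff (smul V) (\<lambda>i w. (1 / of_nat i) \<cdot> Y (of_int m \<cdot> c) (- int i) w) (nat (int s - n - 1))"
  let ?in = "\<lambda>s. exp_coeff (smul V) (\<lambda>i w. (- 1 / of_nat i) \<cdot> Y (of_int m \<cdot> c) (int i) w) s (ex j)"
  have zero: "(if int s - n - 1 < 0 then 0 else ?out s (?in s)) = 0" if "s \<noteq> 0" for s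
    unfolding inner[OF that] outer by simp
  have "lattice_vertex_coeff V (of_int m \<cdot> c) n (ex j) = (if int 0 - n - 1 < 0 then 0 else ?out 0 (?in 0))"
    unfolding lattice_vertex_coeff_def by (rule Sum_any_single) (rule zero)
  then show ?thesis by auto
qed

lemma lattice_ex_modes:
  "Y (ex m) (int n) (ex j) = 0" "Y (ex m) (- 1) (ex j) = ex (m + j)"
  "Y (ex m) (- 2) (ex j) = of_int m \<cdot> Y c (- 1) (ex (m + j))"
  by (simp_all add: lattice_ex_ex lattice_coeff_ex bilin add.commute)

lemma lattice_c_d:
  "Y c (int n) c = 0" "Y d (int n) d = 0" "Y c (int n) d = (if n = 1 then 2 \<cdot> vc else 0)"
proof -
  have R: "Y c m (Y c n v) - Y c n (Y c m v) = 0" "Y d m (Y d n v) - Y d n (Y d m v) = 0"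
    "Y c m (Y d n v) - Y d n (Y c m v) = (if m + n = 0 then (2 * of_int m) \<cdot> v else 0)" for m n v
    using P unfolding lattice_Pi0_def Let_def by blast+
  show "Y c (int n) c = 0" "Y d (int n) d = 0" "Y c (int n) d = (if n = 1 then 2 \<cdot> vc else 0)"
    using R(1)[of "int n" "- 1" vc] R(2)[of "int n" "- 1" vc] R(3)[of "int n" "- 1" vc]
    by (auto simp: creation)
qed

end

end

section \<open>The tensor product as a model of the free-field assumptions\<close>

locale tensor_va =
  fixes A :: "'a::ab_group_add va" and B :: "'b::ab_group_add va" and T :: "'t::ab_group_add va" and t
  assumes tensor: "tensor_product_va A B T t"
begin

sublocale A: vertex_algebra A using tensor by (simp add: tensor_product_va_def)
sublocale B: vertex_algebra B using tensor by (simp add: tensor_product_va_def)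
sublocale T: vertex_algebra T using tensor by (simp add: tensor_product_va_def)

lemma t_linear: "Vector_Spaces.linear (smul B) (smul T) (t a)" "Vector_Spaces.linear (smul A) (smul T) (\<lambda>a. t a b)"
  using tensor by (simp_all add: tensor_product_va_def)

lemma t_right: "t a (b + b') = t a b + t a b'" "t a (smul B r b) = smul T r (t a b)" "t a 0 = 0"
  "t a (b - b') = t a b - t a b'"
proof -
  interpret Vector_Spaces.linear "smul B" "smul T" "t a" by (rule t_linear)
  show "t a (b + b') = t a b + t a b'" "t a (smul B r b) = smul T r (t a b)" "t a 0 = 0"
    "t a (b - b') = t a b - t a b'"
    by (simp_all add: add scale zero diff)
qed

lemma t_left: "t (a + a') b = t a b + t a' b" "t (smul A r a) b = smul T r (t a b)" "t 0 b = 0"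
proof -
  interpret Vector_Spaces.linear "smul A" "smul T" "\<lambda>a. t a b" by (rule t_linear)
  show "t (a + a') b = t a b + t a' b" "t (smul A r a) b = smul T r (t a b)" "t 0 b = 0"
    by (simp_all add: add scale zero)
qed

lemma t_nprod: "nprod T (t a b) n (t a' b') = Sum_any (\<lambda>j::int. t (nprod A a j a') (nprod B b (n - 1 - j) b'))"
  using tensor by (simp add: tensor_product_va_def)

lemma t_vac: "vac T = t (vac A) (vac B)"
  using tensor by (simp add: tensor_product_va_def)

lemma vac_t_mode: "nprod T (t (vac A) b) n (t a b') = t a (nprod B b n b')"
  unfolding t_nprod by (subst Sum_any_single[of "- 1"]) (auto simp: A.vacuum t_left)

lemma t_vac_mode: "nprod T (t a (vac B)) n (t a' b) = t (nprod A a n a') b"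
  unfolding t_nprod by (subst Sum_any_single[of n]) (auto simp: B.vacuum t_right)

lemma t_basis:
  assumes "\<not> A.dependent X" "A.span X = UNIV" "\<not> B.dependent Y" "B.span Y = UNIV"
  shows "T.independent ((\<lambda>(x, y). t x y) ` (X \<times> Y))" "T.span ((\<lambda>(x, y). t x y) ` (X \<times> Y)) = UNIV"
  using tensor assms by (auto simp: tensor_product_va_def basis_family_def)

text \<open>Nonzero \<open>a\<close> and \<open>b\<close> extend to bases, and \<open>t a b\<close>
  is then a member of a basis of the tensor product.\<close>

lemma t_eq_0:
  assumes "t a b = 0"
  shows "a = 0 \<or> b = 0"
proof (rule ccontr)
  assume "\<not> (a = 0 \<or> b = 0)"
  then have ind: "A.independent {a}" "B.independent {b}" by simp_all
  have "T.independent ((\<lambda>(x, y). t x y) ` (A.extend_basis {a} \<times> B.extend_basis {b}))"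
    by (rule t_basis A.independent_extend_basis B.independent_extend_basis
        A.span_extend_basis B.span_extend_basis ind)+
  moreover have "t a b \<in> (\<lambda>(x, y). t x y) ` (A.extend_basis {a} \<times> B.extend_basis {b})"
    using A.extend_basis_superset[OF ind(1)] B.extend_basis_superset[OF ind(2)] by auto
  ultimately show False using T.dependent_zero assms by metis
qed

lemma t_spans:
  assumes "T.subspace N" "\<And>a b. t a b \<in> N"
  shows "w \<in> N"
proof -
  have "T.span ((\<lambda>(x, y). t x y) ` (A.extend_basis {} \<times> B.extend_basis {})) = UNIV"
    by (rule t_basis A.independent_extend_basis B.independent_extend_basis
        A.span_extend_basis B.span_extend_basis A.independent_empty B.independent_empty)+
  moreover have "T.span ((\<lambda>(x, y). t x y) ` (A.extend_basis {} \<times> B.extend_basis {})) \<subseteq> N"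
    by (rule T.span_minimal[OF _ assms(1)]) (use assms(2) in auto)
  ultimately show ?thesis by auto
qed

end

lemma (in tensor_va) free_field_module:
  assumes L: "simple_virasoro_va A \<omega> cc" and P: "lattice_Pi0 B c d ex"
    and cc: "(k + 2) * cc = (k + 2) - 6 * (k + 1)\<^sup>2"
  shows "free_field_module T (t (vac A) c) (t (vac A) d) (t \<omega> (vac B)) (\<lambda>j. t (vac A) (ex j)) k cc A \<omega>
    (\<lambda>j u. t u (ex j))"
proof -
  interpret V: simple_virasoro_va A \<omega> cc by (rule L)
  note c_ex = B.lattice_c_ex[OF P] and ex_ex = B.lattice_ex_modes[OF P] and c_d = B.lattice_c_d[OF P]
  have ex0: "ex 0 = vac B" using P by (simp add: lattice_Pi0_def)
  \<comment> \<open>As \<open>e^(-jc)_(-1) e^(jc) = 1\<close>, a vanishing \<open>e^(jc)\<close>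
    would make the vacuum and hence the whole space zero, against the injectivity of the basis
    family.\<close>
  have exj: "ex j \<noteq> 0" for j
  proof
    assume "ex j = 0"
    then have "B.Y (ex (- j)) (- 1) (ex j) = 0" by simp
    then have "vac B = 0" using ex_ex(2)[of "- j" j] ex0 by simp
    then have "x = 0" for x :: 'b using B.creation(2)[of x] by simp
    moreover have "inj_on (pi_monomial B c d ex) (partitions \<times> partitions \<times> UNIV)"
      using P by (simp add: lattice_Pi0_def basis_family_def)
    moreover have "([], [], 0) \<in> partitions \<times> partitions \<times> UNIV" "([], [], 1) \<in> partitions \<times> partitions \<times> UNIV"
      by (simp_all add: partitions_def)
    ultimately have "([] :: nat list, [] :: nat list, 0 :: int) = ([], [], 1)" by (metis inj_onD)
    then show False by simp
  qed
  show ?thesis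
  proof (unfold_locales)
    fix u :: 'a
    show "nprod A \<omega> 1 u = smul A s u \<Longrightarrow> u \<noteq> 0 \<Longrightarrow> \<exists>m::nat. s = of_nat m" for s
      by (rule V.spectrum)
    show "\<exists>d. u \<in> nilp (positive_modes A \<omega>) d" by (rule V.exhausted_by_nilp)
    show "u \<in> nilp (positive_modes A \<omega>) 0 \<Longrightarrow> \<exists>r. u = smul A r (vac A)" by (rule V.singular)
    show "t u (ex j) = 0 \<Longrightarrow> u = 0" for j using t_eq_0 exj by blast
  next
    fix N w
    assume N: "T.subspace N" and \<tau>: "\<And>j u. t u (ex j) \<in> N"
      and C: "\<And>n v. v \<in> N \<Longrightarrow> nprod T (t (vac A) c) (- 1 - int n) v \<in> N"
      and D: "\<And>n v. v \<in> N \<Longrightarrow> nprod T (t (vac A) d) (- 1 - int n) v \<in> N"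
    show "w \<in> N"
    proof (rule t_spans[OF N])
      fix a b
      have sub: "B.subspace {b. t a b \<in> N}"
        by (rule B.subspaceI)
          (use N in \<open>auto simp: t_right T.subspace_0 T.subspace_add T.subspace_scale\<close>)
      have low: "t a (lower B x ns b) \<in> N" if "0 \<notin> set ns" "t a b \<in> N"
        "\<And>n v. v \<in> N \<Longrightarrow> nprod T (t (vac A) x) (- 1 - int n) v \<in> N" for x ns b
        using that(1)
      proof (induction ns)
        case Nil
        then show ?case using that(2) by (simp add: lower_def)
      next
        case (Cons n ns)
        then have "nprod T (t (vac A) x) (- 1 - int (n - 1)) (t a (lower B x ns b)) \<in> N"
          by (intro that(3)) auto
        moreover have "- 1 - int (n - 1) = - int n" using Cons.prems by (cases n) auto
        ultimately show ?case by (simp add: vac_t_mode lower_def)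
      qed
      have "UNIV = B.span (pi_monomial B c d ex ` (partitions \<times> partitions \<times> UNIV))"
        using P by (simp add: lattice_Pi0_def basis_family_def)
      also have "\<dots> \<subseteq> {b. t a b \<in> N}"
        by (rule B.span_minimal[OF _ sub])
          (auto simp: pi_monomial_def partitions_def intro!: low C D \<tau>)
      finally show "t a b \<in> N" by auto
    qed
  qed (simp_all add: vac_t_mode t_vac_mode t_vac c_ex ex_ex c_d V.\<omega>_\<omega> t_left t_right cc ex0 A.creation
      B.creation ex_ex(3)[of _ 0, unfolded ex0, simplified])
qed

section \<open>The image of the Sugawara vector\<close>

context free_field
begin

text \<open>Both sides are linear combinations of the six vectors listed in \<open>cb\<close>; the coefficients are compared.\<close>

lemma sugawara_eq:
  assumes R: "affine_sl2_relations k V (X 1) FF HH" and k: "k + 2 \<noteq> 0" "k \<noteq> 0"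
  defines "mu \<equiv> (1 / 2) \<cdot> D + (k / 4) \<cdot> C"
  shows "sugawara k V (X 1) FF HH = Om + ((1 / k) \<cdot> Y mu (- 1) (Y mu (- 1) vc)
      - (1 / k) \<cdot> Y nu (- 1) (Y nu (- 1) vc) - Y nu (- 2) vc)" (is ?A)
    and "sugawara k V (X 1) FF HH = Om + ((1 / 2) \<cdot> Y C (- 1) (Y D (- 1) vc)
      - (1 / 2) \<cdot> Y D (- 2) vc + (k / 4) \<cdot> Y C (- 2) vc)" (is ?B)
proof -
  define DD CD CC D2 C2 where "DD = Y D (- 1) D" and "CD = Y C (- 1) D" and "CC = Y C (- 1) C"
    and "D2 = tr D" and "C2 = tr C"
  define cb where "cb a1 a2 a3 a4 a5 a6 =
    a1 \<cdot> Om + a2 \<cdot> DD + a3 \<cdot> CD + a4 \<cdot> CC + a5 \<cdot> D2 + a6 \<cdot> C2" for a1 a2 a3 a4 a5 a6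
  have add: "cb a1 a2 a3 a4 a5 a6 + cb b1 b2 b3 b4 b5 b6 =
      cb (a1 + b1) (a2 + b2) (a3 + b3) (a4 + b4) (a5 + b5) (a6 + b6)"
    and diff: "cb a1 a2 a3 a4 a5 a6 - cb b1 b2 b3 b4 b5 b6 =
      cb (a1 - b1) (a2 - b2) (a3 - b3) (a4 - b4) (a5 - b5) (a6 - b6)"
    and scl: "r \<cdot> cb a1 a2 a3 a4 a5 a6 = cb (r * a1) (r * a2) (r * a3) (r * a4) (r * a5) (r * a6)"
    for r a1 a2 a3 a4 a5 a6 b1 b2 b3 b4 b5 b6
    by (simp_all add: cb_def scale_left_distrib scale_left_diff_distrib scale_right_distrib)
  have cong: "cb a1 a2 a3 a4 a5 a6 = cb b1 b2 b3 b4 b5 b6"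
    if "a1 = b1" "a2 = b2" "a3 = b3" "a4 = b4" "a5 = b5" "a6 = b6"
    for a1 a2 a3 a4 a5 a6 b1 b2 b3 b4 b5 b6 using that by simp
  have DC: "Y D (- 1) C = CD" using D_C_comm[of "- 1" "- 1" vc] by (simp add: CD_def creation)
  have atoms: "Om = cb 1 0 0 0 0 0" "DD = cb 0 1 0 0 0 0" "CD = cb 0 0 1 0 0 0" "CC = cb 0 0 0 1 0 0"
    "D2 = cb 0 0 0 0 1 0" "C2 = cb 0 0 0 0 0 1"
    by (simp_all add: cb_def)
  note lin = atoms[THEN eq_reflection] add diff scl
  have modes: "Y C (- 1) D = CD" "Y D (- 1) D = DD" "Y C (- 1) C = CC" "tr D = D2" "tr C = C2"
    by (simp_all add: DD_def CD_def CC_def D2_def C2_def)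
  have nunu: "Y nu (- 1) nu = (1 / 4) \<cdot> DD - (k / 4) \<cdot> CD + (k\<^sup>2 / 16) \<cdot> CC"
    unfolding nu_def bilin DC modes
    by (simp only: lin) (simp add: power2_eq_square field_simps)
  have mumu: "Y mu (- 1) mu = (1 / 4) \<cdot> DD + (k / 4) \<cdot> CD + (k\<^sup>2 / 16) \<cdot> CC"
    unfolding mu_def bilin DC modes
    by (simp only: lin) (simp add: power2_eq_square field_simps)
  have nuC: "Y nu (- 1) C = (1 / 2) \<cdot> CD - (k / 4) \<cdot> CC"
    unfolding nu_def bilin DC modes ..
  have nu2: "tr nu = (1 / 2) \<cdot> D2 - (k / 4) \<cdot> C2"
    unfolding nu_def bilin DC modes ..
  have H2: "tr HH = D2 + (k / 2) \<cdot> C2"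
    unfolding HH_def bilin DC modes ..
  have HH: "Y HH (- 1) HH = DD + k \<cdot> CD + (k\<^sup>2 / 4) \<cdot> CC"
    unfolding HH_def bilin DC modes
    by (simp only: lin) (simp add: power2_eq_square field_simps)
  have X3: "Y (X 1) (- 3) psi = (1 / 2) \<cdot> (C2 + CC)"
  proof -
    have "Y (X 1) (- 3) psi = (1 / 2) \<cdot> (2 \<cdot> Y (X 1) (- 3) psi)" by simp
    also have "\<dots> = (1 / 2) \<cdot> (C2 + CC)" unfolding X1_psi(4) modes ..
    finally show ?thesis .
  qed
  have E: "Y (X 1) (- 1) FF = (k + 2) \<cdot> Om - (Y nu (- 1) nu - 2 \<cdot> Y nu (- 1) C + Y (X 1) (- 3) psi
      + (k + 1) \<cdot> (tr nu - Y (X 1) (- 3) psi))"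
    by (simp add: FF_def GG_def bilin X1_Ompsi X1_sq X1_dn X1_psi(2,3) creation)
  have F: "Y FF (- 1) (X 1) = Y (X 1) (- 1) FF - tr HH"
    using affine_rules(3)[OF R, of "- 1" "- 1" vc] by (simp add: creation)
  have S: "sugawara k V (X 1) FF HH = (1 / (2 * (k + 2))) \<cdot>
      (Y (X 1) (- 1) FF + (Y (X 1) (- 1) FF - tr HH) + (1 / 2) \<cdot> Y HH (- 1) HH)"
    unfolding sugawara_def by (simp add: creation F)
  \<comment> \<open>Written in \<open>K = k + 2\<close>, the only denominator besides numerals is a
    variable known to be nonzero.\<close>
  obtain K where K: "K = k + 2" "K \<noteq> 0" using k(1) by blast
  then have kK: "k = K - 2" by simp
  have "sugawara k V (X 1) FF HH = cb 1 0 (1 / 2) 0 (- 1 / 2) (k / 4)"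
    unfolding S E X3 nunu nuC nu2 H2 HH
    unfolding K(1)[symmetric] unfolding kK
    by (simp only: lin, rule cong) (use K(2) in \<open>simp_all add: field_simps power2_eq_square\<close>)
  moreover have "Om + ((1 / 2) \<cdot> CD - (1 / 2) \<cdot> D2 + (k / 4) \<cdot> C2) = cb 1 0 (1 / 2) 0 (- 1 / 2) (k / 4)"
    by (simp add: cb_def)
  moreover have "Om + ((1 / k) \<cdot> Y mu (- 1) mu - (1 / k) \<cdot> Y nu (- 1) nu - tr nu) = cb 1 0 (1 / 2) 0 (- 1 / 2) (k / 4)"
    unfolding mumu nunu nu2
    by (simp only: lin, rule cong) (use k in \<open>simp_all add: field_simps\<close>)
  ultimately show ?A ?B by (simp_all add: creation modes)
qed

end

section \<open>The realization of \<open>V\<^sub>k(sl(2))\<close>\<close>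

text \<open>The weight of a basis vector is the sum of all parts of its three partitions, and only
  empty partitions have sum 0.\<close>

lemma universal_affine_grading:
  assumes U: "universal_affine_sl2 k U e f h" and k: "k + 2 \<noteq> 0"
  obtains B and E :: "'u::ab_group_add \<Rightarrow> nat" where "module.span (smul U) B = UNIV"
    "\<And>b. b \<in> B \<Longrightarrow> nprod U (sugawara k U e f h) 1 b = smul U (of_nat (E b)) b"
    "\<And>b. b \<in> B \<Longrightarrow> E b = 0 \<Longrightarrow> b \<in> module.span (smul U) {vac U}"
proof -
  interpret vertex_algebra U using U by (simp add: universal_affine_sl2_def)
  have R: "affine_sl2_relations k U e f h" using U by (simp add: universal_affine_sl2_def)
  define w where "w = sugawara k U e f h"
  have conf: "conf w 1 e" "conf w 1 f" "conf w 1 h" unfolding w_def using sugawara_conf[OF R k] .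
  let ?I = "partitions \<times> partitions \<times> partitions"
  define b where "b = (\<lambda>(xs, ys, zs). lower U e xs (lower U h ys (lower U f zs vc)))"
  define E where "E v = (case inv_into ?I b v of (xs, ys, zs) \<Rightarrow> sum_list xs + sum_list ys + sum_list zs)" for v
  have inj: "inj_on b ?I" and span: "span (b ` ?I) = UNIV"
    using U by (simp_all add: universal_affine_sl2_def basis_family_def b_def)
  have E: "E (b (xs, ys, zs)) = sum_list xs + sum_list ys + sum_list zs" if "(xs, ys, zs) \<in> ?I" for xs ys zs
    unfolding E_def inv_into_f_f[OF inj that] by simp
  show ?thesis
  proof (rule that[of "b ` ?I" E])
    show "span (b ` ?I) = UNIV" by (rule span)
    fix v assume "v \<in> b ` ?I"
    then obtain xs ys zs where i: "(xs, ys, zs) \<in> ?I" and v: "v = b (xs, ys, zs)" by auto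
    have "conf w (0 + of_nat (sum_list zs) + of_nat (sum_list ys) + of_nat (sum_list xs)) v"
      unfolding v b_def prod.case by (intro conf_lower conf conf_vac)
    then show "nprod U (sugawara k U e f h) 1 v = smul U (of_nat (E v)) v"
      unfolding w_def[symmetric] by (simp add: conf_def v E[OF i] add_ac)
    show "v \<in> span {vc}" if "E v = 0"
    proof -
      have "sum_list xs = 0" "sum_list ys = 0" "sum_list zs = 0" using that E[OF i] by (auto simp: v)
      moreover have "0 \<notin> set xs" "0 \<notin> set ys" "0 \<notin> set zs" using i by (auto simp: partitions_def)
      ultimately have "xs = []" "ys = []" "zs = []"
        by (metis last_in_set sum_list_eq_0_iff)+
      then show ?thesis by (simp add: v b_def lower_def span_base)
    qed
  qed
qed

text \<open>Otherwise \<open>v\<close> would lie in the kernel of \<open>\<psi>\<close> and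
  \<open>v - 1\<close> in that of \<open>\<phi>\<close>. Both are stable under the Sugawara
  \<open>L(0)\<close> and miss the vacuum, which \<open>vac_not_in_sum\<close> excludes.\<close>

lemma proper_kernels_not_complementary:
  assumes U: "universal_affine_sl2 k U e f h" and k: "k + 2 \<noteq> 0"
    and \<phi>: "va_hom U T \<phi>" "vertex_algebra T" "vac T \<noteq> 0"
    and \<psi>: "va_hom U V \<psi>" "vertex_algebra V" "vac V \<noteq> 0"
    and v: "\<psi> v = 0"
  shows "\<phi> v \<noteq> vac T"
proof
  assume v': "\<phi> v = vac T"
  interpret U: vertex_algebra U using U by (simp add: universal_affine_sl2_def)
  interpret T: vertex_algebra T by fact
  interpret V: vertex_algebra V by fact
  interpret p: Vector_Spaces.linear "smul U" "smul T" \<phi> using \<phi>(1) by (simp add: va_hom_def)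
  interpret s: Vector_Spaces.linear "smul U" "smul V" \<psi> using \<psi>(1) by (simp add: va_hom_def)
  obtain B and E :: "'a \<Rightarrow> nat" where B: "U.span B = UNIV"
    "\<And>b. b \<in> B \<Longrightarrow> nprod U (sugawara k U e f h) 1 b = smul U (of_nat (E b)) b"
    "\<And>b. b \<in> B \<Longrightarrow> E b = 0 \<Longrightarrow> b \<in> U.span {vac U}"
    by (rule universal_affine_grading[OF U k]) blast
  show False
  proof (rule U.vac_not_in_sum[of B "sugawara k U e f h" E "{x. \<psi> x = 0}" "{x. \<phi> x = 0}" v])
    show "U.subspace {x. \<psi> x = 0}" "U.subspace {x. \<phi> x = 0}"
      by (auto intro!: U.subspaceI simp: p.add s.add p.scale s.scale p.zero s.zero)
    show "nprod U (sugawara k U e f h) 1 (vac U) = 0" by (simp add: U.creation)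
  qed (use B v v' \<phi> \<psi> in \<open>auto simp: va_hom_def p.diff\<close>)
qed

lemma va_hom_factor:
  assumes "vertex_algebra U" and q: "va_hom U V q" "surj q" and V: "vertex_algebra V"
    and \<phi>: "va_hom U T \<phi>" "vertex_algebra T" and ker: "\<And>u. q u = 0 \<Longrightarrow> \<phi> u = 0"
  shows "\<exists>\<Phi>. va_hom V T \<Phi> \<and> (\<forall>u. \<Phi> (q u) = \<phi> u)"
proof -
  interpret U: vertex_algebra U by fact
  interpret T: vertex_algebra T by fact
  interpret V: vertex_algebra V by fact
  interpret p: Vector_Spaces.linear "smul U" "smul T" \<phi> using \<phi>(1) by (simp add: va_hom_def)
  interpret s: Vector_Spaces.linear "smul U" "smul V" q using q(1) by (simp add: va_hom_def)
  define \<Phi> where "\<Phi> v = \<phi> (inv q v)" for v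
  have \<Phi>: "\<Phi> (q u) = \<phi> u" for u
  proof -
    have "q (inv q (q u)) = q u" using q(2) by (simp add: surj_f_inv_f)
    then have "q (inv q (q u) - u) = 0" by (simp add: s.diff)
    then have "\<phi> (inv q (q u) - u) = 0" by (rule ker)
    then show ?thesis by (simp add: \<Phi>_def p.diff)
  qed
  have "va_hom V T \<Phi>"
    unfolding va_hom_def
  proof (intro conjI allI)
    show "Vector_Spaces.linear (smul V) (smul T) \<Phi>"
    proof (unfold_locales)
      fix x y r
      obtain x' y' where x: "x = q x'" and y: "y = q y'" using q(2) by (metis surjD)
      show "\<Phi> (x + y) = \<Phi> x + \<Phi> y" unfolding x y s.add[symmetric] by (simp only: \<Phi> p.add)
      show "\<Phi> (smul V r x) = smul T r (\<Phi> x)" unfolding x s.scale[symmetric] by (simp only: \<Phi> p.scale)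
    qed
    show "\<Phi> (vac V) = vac T" using \<Phi>[of "vac U"] q(1) \<phi>(1) by (simp add: va_hom_def)
    fix a n b
    obtain a' b' where a: "a = q a'" and b: "b = q b'" using q(2) by (metis surjD)
    have "q (nprod U a' n b') = nprod V (q a') n (q b')" using q(1) by (simp add: va_hom_def)
    then show "\<Phi> (nprod V a n b) = nprod T (\<Phi> a) n (\<Phi> b)"
      using \<Phi>[of "nprod U a' n b'"] \<phi>(1) by (simp add: a b \<Phi> va_hom_def)
  qed
  then show ?thesis using \<Phi> by blast
qed

text \<open>\<open>k + 1 = (p' - p)/p\<close>, so that
  \<open>(k + 1)^2 / (k + 2) = (p - p')^2 / (p p')\<close>.\<close>

lemma minimal_charge_eq:
  assumes "p \<ge> 2" "p' \<ge> 2" "k + 2 = of_nat p' / of_nat p"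
  shows "(k + 2) * minimal_charge p p' = (k + 2) - 6 * (k + 1)\<^sup>2"
proof -
  have p: "(of_nat p :: complex) \<noteq> 0" "(of_nat p' :: complex) \<noteq> 0" using assms by auto
  have "k = of_nat p' / of_nat p - 2" using assms(3) by (metis add_diff_cancel_right')
  then have k1: "k + 1 = (of_nat p' - of_nat p) / of_nat p" using p by (simp add: field_simps)
  show ?thesis unfolding assms(3) k1 minimal_charge_def using p
    by (simp add: field_simps power2_eq_square)
qed

lemma level_not_nat:
  assumes "p \<ge> 2" "coprime p p'" "k + 2 = of_nat p' / of_nat p"
  shows "k \<noteq> (of_nat m :: complex)"
proof
  assume "k = of_nat m"
  then have "of_nat (m + 2) = (of_nat p' / of_nat p :: complex)" using assms(3) by (simp add: add.commute)
  then have "(of_nat p' :: complex) = of_nat ((m + 2) * p)"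
    using assms(1) by (simp add: field_simps)
  then have "p' = (m + 2) * p" by (simp only: of_nat_eq_iff)
  then have "p dvd p'" by simp
  then have "p = 1" using assms(2) by (metis coprime_absorb_left nat_dvd_1_iff_1 is_unit_left_imp_coprime)
  then show False using assms(1) by simp
qed

theorem theorem5p5:
  fixes p p' :: nat and k :: complex
    and U :: "'u::ab_group_add va" and q :: "'u::ab_group_add \<Rightarrow> 'v::ab_group_add"
    and V :: "'v::ab_group_add va" and e f h :: "'v::ab_group_add"
    and W :: "'w::ab_group_add va" and r :: "'w::ab_group_add \<Rightarrow> 'l::ab_group_add"
    and L :: "'l::ab_group_add va" and \<omega> :: "'l::ab_group_add"
    and P :: "'p::ab_group_add va" and c d \<mu> \<nu> :: "'p::ab_group_add" and ex :: "int \<Rightarrow> 'p::ab_group_add"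
    and T :: "'t::ab_group_add va" and t :: "'l::ab_group_add \<Rightarrow> 'p::ab_group_add \<Rightarrow> 't::ab_group_add"
  assumes p: "p \<ge> 2" "p' \<ge> 2" "coprime p p'"
    and k: "k + 2 = of_nat p' / of_nat p"
    and V: "simple_affine_sl2 k U q V e f h"
    and L: "simple_virasoro (minimal_charge p p') W r L \<omega>"
    and P: "lattice_Pi0 P c d ex"
    and T: "tensor_product_va L P T t"
    and \<mu>: "\<mu> = smul P (1 / 2) d + smul P (k / 4) c"
    and \<nu>: "\<nu> = smul P (1 / 2) d - smul P (k / 4) c"
  shows "\<exists>\<Phi>.
     (va_hom V T \<Phi> \<and>
      \<Phi> e = t (vac L) (ex 1) \<and>
      \<Phi> h = t (vac L) (smul P 2 (nprod P \<mu> (- 1) (vac P))) \<and>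
      \<Phi> f = smul T (k + 2) (t \<omega> (ex (- 1)))
            - t (vac L) (nprod P \<nu> (- 1) (nprod P \<nu> (- 1) (ex (- 1))))
            - smul T (k + 1) (t (vac L) (nprod P \<nu> (- 2) (ex (- 1))))) \<and>
     (\<forall>\<Psi>. va_hom V T \<Psi> \<and> \<Psi> e = \<Phi> e \<and> \<Psi> h = \<Phi> h \<and> \<Psi> f = \<Phi> f \<longrightarrow> \<Psi> = \<Phi>) \<and>
     (\<exists>v. \<Phi> v \<noteq> 0) \<and>
     \<Phi> (sugawara k V e f h) =
       t \<omega> (vac P) + t (vac L)
         (smul P (1 / k) (nprod P \<mu> (- 1) (nprod P \<mu> (- 1) (vac P)))
          - smul P (1 / k) (nprod P \<nu> (- 1) (nprod P \<nu> (- 1) (vac P)))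
          - nprod P \<nu> (- 2) (vac P)) \<and>
     \<Phi> (sugawara k V e f h) =
       t \<omega> (vac P) + t (vac L)
         (smul P (1 / 2) (nprod P c (- 1) (nprod P d (- 1) (vac P)))
          - smul P (1 / 2) (nprod P d (- 2) (vac P))
          + smul P (k / 4) (nprod P c (- 2) (vac P)))"
proof -
  have kn: "k \<noteq> of_nat m" for m by (rule level_not_nat[OF p(1,3) k])
  have k2: "k + 2 \<noteq> 0" using p k by simp
  have k0: "k \<noteq> 0" using kn[of 0] by simp
  interpret tensor_va L P T t by unfold_locales (rule T)
  interpret L: simple_virasoro_va L \<omega> "minimal_charge p p'" by (rule simple_virasoro_vaI[OF L])
  interpret M: free_field_module T "t (vac L) c" "t (vac L) d" "t \<omega> (vac P)" "\<lambda>j. t (vac L) (ex j)" k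
    "minimal_charge p p'" L \<omega> "\<lambda>j u. t u (ex j)"
    by (rule free_field_module[OF L.simple_virasoro_va_axioms P minimal_charge_eq[OF p(1,2) k]])
  obtain e' f' h' where U: "universal_affine_sl2 k U e' f' h'" and efh: "e = q e'" "f = q f'" "h = q h'"
    and Q: "simple_quotient U V q"
    using V unfolding simple_affine_sl2_def by blast
  have UV: "vertex_algebra U" "vertex_algebra V" "va_hom U V q" "surj q" "vac V \<noteq> 0"
    using Q by (auto simp: simple_quotient_def simple_va_def)
  interpret U: vertex_algebra U by (rule UV)
  interpret V: vertex_algebra V by (rule UV)
  interpret q: Vector_Spaces.linear "smul U" "smul V" q using UV(3) by (simp add: va_hom_def)
  obtain \<phi> where \<phi>: "va_hom U T \<phi>" "\<phi> e' = t (vac L) (ex 1)" "\<phi> f' = M.FF" "\<phi> h' = M.HH"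
    by (rule universal_affine_hom[OF U T.vertex_algebra_axioms M.affine_relations])
  interpret \<phi>: Vector_Spaces.linear "smul U" "smul T" \<phi> using \<phi>(1) by (simp add: va_hom_def)
  have \<phi>_nprod: "\<phi> (nprod U a n b) = nprod T (\<phi> a) n (\<phi> b)" for a n b
    using \<phi>(1) by (simp add: va_hom_def)
  have q_nprod: "q (nprod U a n b) = nprod V (q a) n (q b)" for a n b
    using UV(3) by (simp add: va_hom_def)
  have vacT: "vac T \<noteq> 0"
    using M.\<tau>_inj[of "vac L" 0] M.X_0 L.simple by (auto simp: simple_va_def)
  have ker: "\<phi> u = 0" if "q u = 0" for u
  proof (rule ccontr)
    assume nz: "\<phi> u \<noteq> 0"
    \<comment> \<open>The image of the maximal ideal. It need not be an ideal of \<open>T\<close>,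
      but it is stable under the modes of the images of \<open>e, f, h\<close>.\<close>
    let ?N = "\<phi> ` {v. q v = 0}"
    have "vac T \<in> ?N"
    proof (rule M.stable_contains_vac[OF _ _ _ _ k2 kn _ nz])
      have "U.subspace {v. q v = 0}"
        by (auto intro!: U.subspaceI simp: q.add q.scale q.zero)
      then show "T.subspace ?N" by (rule \<phi>.subspace_image)
      show "\<phi> u \<in> ?N" using that by blast
      have stable: "nprod T (\<phi> g) n v \<in> ?N" if "v \<in> ?N" for g n v
      proof -
        from that obtain x where x: "v = \<phi> x" "q x = 0" by blast
        then have "q (nprod U g n x) = 0" by (simp add: q_nprod)
        then show ?thesis unfolding x(1) \<phi>_nprod[symmetric] by blast
      qed
      show "nprod T (t (vac L) (ex 1)) n v \<in> ?N" if "v \<in> ?N" for n v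
        using stable[OF that, of e'] \<phi>(2) by simp
      show "nprod T M.HH n v \<in> ?N" if "v \<in> ?N" for n v
        using stable[OF that, of h'] \<phi>(4) by simp
      show "nprod T M.FF n v \<in> ?N" if "v \<in> ?N" for n v
        using stable[OF that, of f'] \<phi>(3) by simp
    qed
    then obtain v where v: "q v = 0" "\<phi> v = vac T" by force
    show False
      using proper_kernels_not_complementary[OF U k2 \<phi>(1) T.vertex_algebra_axioms vacT UV(3,2,5) v(1)] v(2)
      by simp
  qed
  from va_hom_factor[OF UV(1,3,4,2) \<phi>(1) T.vertex_algebra_axioms ker]
  obtain \<Phi> where \<Phi>: "va_hom V T \<Phi>" "\<And>u. \<Phi> (q u) = \<phi> u" by blast
  interpret \<Phi>: Vector_Spaces.linear "smul V" "smul T" \<Phi> using \<Phi>(1) by (simp add: va_hom_def)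
  have gen: "generated_by V {e, f, h}"
    using generated_by_surj[OF UV(1,2) universal_affine_generated[OF U] UV(3,4)] by (simp add: efh)
  have \<nu>': "M.nu = t (vac L) \<nu>" by (simp add: M.nu_def \<nu> t_right)
  have \<mu>': "smul T (1 / 2) (t (vac L) d) + smul T (k / 4) (t (vac L) c) = t (vac L) \<mu>"
    by (simp add: \<mu> t_right)
  have e: "\<Phi> e = t (vac L) (ex 1)" by (simp add: efh \<Phi>(2) \<phi>)
  have h: "\<Phi> h = t (vac L) (smul P 2 (nprod P \<mu> (- 1) (vac P)))"
    by (simp add: efh \<Phi>(2) \<phi> M.HH_def \<mu> B.creation t_right B.scale_right_distrib)
  have f: "\<Phi> f = smul T (k + 2) (t \<omega> (ex (- 1)))
            - t (vac L) (nprod P \<nu> (- 1) (nprod P \<nu> (- 1) (ex (- 1))))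
            - smul T (k + 1) (t (vac L) (nprod P \<nu> (- 2) (ex (- 1))))"
    by (simp add: efh \<Phi>(2) \<phi> M.FF_def M.GG_def M.Ompsi_def M.sq_def M.dn_def \<nu>' vac_t_mode t_vac_mode
        A.creation diff_diff_eq)
  have \<Phi>_nprod: "\<Phi> (nprod V a n b) = nprod T (\<Phi> a) n (\<Phi> b)" and \<Phi>_vac: "\<Phi> (vac V) = vac T" for a n b
    using \<Phi>(1) by (simp_all add: va_hom_def)
  have "\<Phi> (sugawara k V e f h) = sugawara k T (\<Phi> e) (\<Phi> f) (\<Phi> h)"
    by (simp add: sugawara_def \<Phi>.add \<Phi>.scale \<Phi>_nprod \<Phi>_vac)
  also have "\<dots> = sugawara k T (t (vac L) (ex 1)) M.FF M.HH"
    by (simp add: efh \<Phi>(2) \<phi>)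
  finally have sug: "\<Phi> (sugawara k V e f h) = sugawara k T (t (vac L) (ex 1)) M.FF M.HH" .
  note S = M.sugawara_eq[OF M.affine_relations k2 k0]
  have s1: "\<Phi> (sugawara k V e f h) = t \<omega> (vac P) + t (vac L)
         (smul P (1 / k) (nprod P \<mu> (- 1) (nprod P \<mu> (- 1) (vac P)))
          - smul P (1 / k) (nprod P \<nu> (- 1) (nprod P \<nu> (- 1) (vac P)))
          - nprod P \<nu> (- 2) (vac P))"
    unfolding sug S(1) \<mu>' \<nu>' t_vac by (simp only: vac_t_mode t_right)
  have s2: "\<Phi> (sugawara k V e f h) = t \<omega> (vac P) + t (vac L)
         (smul P (1 / 2) (nprod P c (- 1) (nprod P d (- 1) (vac P)))
          - smul P (1 / 2) (nprod P d (- 2) (vac P))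
          + smul P (k / 4) (nprod P c (- 2) (vac P)))"
    unfolding sug S(2) t_vac by (simp only: vac_t_mode t_right)
  have unique: "\<Psi> = \<Phi>" if "va_hom V T \<Psi>" "\<Psi> e = \<Phi> e" "\<Psi> h = \<Phi> h" "\<Psi> f = \<Phi> f" for \<Psi>
    by (rule va_hom_unique[OF UV(2) T.vertex_algebra_axioms gen]) (use that \<Phi>(1) in auto)
  have "\<Phi> (vac V) \<noteq> 0" using vacT \<Phi>_vac by simp
  then have nontrivial: "\<exists>v. \<Phi> v \<noteq> 0" by blast
  show ?thesis
    by (rule exI[of _ \<Phi>], intro conjI allI impI)
      (rule \<Phi>(1) e h f nontrivial s1 s2 | (elim conjE, rule unique; assumption))+
qed

end
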